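(* Let $\phi$ be a $k$-density on a manifold $M$, let $N\subset M$ be an oriented $k$-dimensional submanifold with tangent lift $\tilde N\subset S_\phi TM$, and let $\omega_k,\omega_k'$ be two Hilbert $k$-forms for $\phi$. Then $i_b\,d\omega_k=i_b\,d\omega_k'$ for every tangent $k$-vector $b\in\Lambda^k_sT\tilde N$.
   Context: All manifolds and maps are smooth. $\Lambda^k_sV\subset\Lambda^kV$ is the cone of simple $k$-vectors of a real vector space $V$; $0\neq a=v_1\wedge\dots\wedge v_k$ determines the oriented $k$-plane $\langle a\rangle=\mathrm{span}\{v_1,\dots,v_k\}$. A $k$-density on $V$ is a map $\phi:\Lambda^k_sV\to[0,\infty)$, smooth off $0$, with $\phi(a)=0\Leftrightarrow a=0$ and $\phi(ta)=|t|\phi(a)$. A $k$-density on $M$ is a map $\phi:\Lambda^k_sTM\to[0,\infty)$, smooth off the zero section, restricting to a $k$-density on each $T_xM$. $S_\phi TM=\{(x,a)\in\Lambda^k_sTM:\phi(x,a)=1\}$, with projection $\pi$ to $M$; $S_\phi\subset\Lambda^k_sT_xM$ denotes its fibre. Legendre map for $\phi$: a fibre-preserving map $\mathcal L:\Lambda^k_sTM\to\Lambda^kT^*M$, smooth off the zero section, such that for each $x$: $\mathcal L_x(ta)=t\mathcal L_x(a)$; $\mathcal L_x(a)(a)=\phi(x,a)^2$; and for $a\in S_\phi$, $\mathcal L_x(a)$ vanishes on $T_aS_\phi\subset\Lambda^kT_xM$. A Hilbert form for $\phi$ is the $k$-form on $S_\phi TM$ given by $(\omega_k)_{(x,a)}=\mathcal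 L_x(a)\circ D\pi$ for some Legendre map $\mathcal L$ for $\phi$ (Legendre maps, hence Hilbert forms, are in general not unique). Tangent lift: $\tilde N=\{(x,a)\in S_\phi TM: x\in N,\ \langle a\rangle=T_xN \text{ as oriented planes}\}$. For $b\in\Lambda^kT_{(x,a)}\tilde N$, $i_bd\omega_k$ is the covector on $T_{(x,a)}S_\phi TM$ obtained by contracting $d\omega_k$ with $b$. *)

theory Defs
  imports "HOL-Analysis.Analysis"
begin

section \<open>Smooth maps between Euclidean spaces\<close>

primrec Ck_on :: "nat \<Rightarrow> 'v::real_normed_vector set \<Rightarrow> ('v \<Rightarrow> 'w::real_normed_vector) \<Rightarrow> bool" where
  "Ck_on 0 U f \<longleftrightarrow> continuous_on U f"
| "Ck_on (Suc m) U f \<longleftrightarrow> (\<forall>x\<in>U. f differentiable (at x)) \<and>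
     (\<forall>v. Ck_on m U (\<lambda>x. frechet_derivative f (at x) v))"

text \<open>Only used for open \<open>U\<close> and finite-dimensional spaces.\<close>

definition smooth_on :: "'v::real_normed_vector set \<Rightarrow> ('v \<Rightarrow> 'w::real_normed_vector) \<Rightarrow> bool" where
  "smooth_on U f \<longleftrightarrow> (\<forall>m. Ck_on m U f)"

text \<open>Smoothness on an arbitrary subset: local smooth extendability. On embedded submanifolds this
  is the usual notion.\<close>

definition smooth_map_on :: "'v::real_normed_vector set \<Rightarrow> ('v \<Rightarrow> 'w::real_normed_vector) \<Rightarrow> bool" where
  "smooth_map_on S f \<longleftrightarrow>
     (\<forall>p\<in>S. \<exists>U g. open U \<and> p \<in> U \<and> smooth_on U g \<and> (\<forall>q\<in>S \<inter> U. g q = f q))"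

text \<open>Velocities at \<open>p\<close> of smooth curves in \<open>S\<close>; for an embedded submanifold this is its tangent
  space, realised as a linear subspace of the ambient space.\<close>

definition tangent_set :: "'v::real_normed_vector set \<Rightarrow> 'v \<Rightarrow> 'v set" where
  "tangent_set S p =
     {v. \<exists>\<gamma> e. e > 0 \<and> smooth_on {- e<..<e} \<gamma> \<and> \<gamma> ` {- e<..<e} \<subseteq> S \<and> \<gamma> 0 = p \<and>
         (\<gamma> has_vector_derivative v) (at (0::real))}"


section \<open>Simple vectors of degree \<open>k = CARD('k)\<close>\<close>

text \<open>\<open>\<Lambda>\<^sup>k\<real>\<^sup>n\<close> is realised inside the space of \<open>k\<close>-tensors as the span of the
  antisymmetrised products of \<open>k\<close> vectors. The slots of a tensor are indexed by the type \<open>'k\<close>, so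
  that tensor coordinates are indexed by \<open>'n ^ 'k\<close>.\<close>

type_synonym ('n, 'k) tensor = "(real, ('n, 'k) vec) vec"

definition wedge :: "('k::finite \<Rightarrow> real ^ 'n::finite) \<Rightarrow> ('n, 'k) tensor" where
  "wedge v = (\<chi> J. det (\<chi> i j. v i $ (J $ j)))"

definition simple_vectors :: "('n::finite, 'k::finite) tensor set" where
  "simple_vectors = range wedge"

definition k_vectors :: "('n::finite, 'k::finite) tensor set" where
  "k_vectors = span simple_vectors"

text \<open>The \<open>k\<close>-th tensor power of a linear map; on \<open>k_vectors\<close> it is the induced map
  \<open>\<Lambda>\<^sup>k A\<close>, sending \<open>wedge v\<close> to \<open>wedge (A \<circ> v)\<close>.\<close>

definition tensor_map ::
  "(real ^ 'n::finite \<Rightarrow> real ^ 'n) \<Rightarrow> ('n, 'k::finite) tensor \<Rightarrow> ('n, 'k) tensor" where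
  "tensor_map A T = (\<chi> J. \<Sum>K\<in>UNIV. (\<Prod>i\<in>UNIV. A (axis (K $ i) 1) $ (J $ i)) * T $ K)"

text \<open>Elements of the dual space of \<open>\<Lambda>\<^sup>k\<real>\<^sup>n\<close>; values outside \<open>k_vectors\<close> are irrelevant.\<close>

definition k_covector :: "(('n::finite, 'k::finite) tensor \<Rightarrow> real) \<Rightarrow> bool" where
  "k_covector l \<longleftrightarrow>
     (\<forall>c\<in>k_vectors. \<forall>d\<in>k_vectors. l (c + d) = l c + l d) \<and>
     (\<forall>t. \<forall>c\<in>k_vectors. l (t *\<^sub>R c) = t * l c)"

text \<open>The oriented plane of a nonzero simple vector \<open>a\<close>. An oriented \<open>k\<close>-plane is given by the set
  of its positively oriented bases (which determines both the plane, as their common span, and its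
  orientation): \<open>v\<close> is a positive basis of the plane of \<open>a\<close> iff \<open>wedge v\<close> is a positive
  multiple of \<open>a\<close>.\<close>

definition oriented_plane :: "('n::finite, 'k::finite) tensor \<Rightarrow> ('k \<Rightarrow> real ^ 'n) set" where
  "oriented_plane a = {v. \<exists>c>0. wedge v = c *\<^sub>R a}"


section \<open>Manifolds\<close>

type_synonym ('a, 'v) chart = "'a set \<times> ('a \<Rightarrow> 'v)"

definition chart_inv :: "('a, 'v) chart \<Rightarrow> 'v \<Rightarrow> 'a" where
  "chart_inv C = inv_into (fst C) (snd C)"

definition smooth_manifold :: "'a topology \<Rightarrow> ('a, 'v::euclidean_space) chart set \<Rightarrow> bool" where
  "smooth_manifold X \<A> \<longleftrightarrow>
     Hausdorff_space X \<and> second_countable X \<and>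
     (\<Union>C\<in>\<A>. fst C) = topspace X \<and>
     (\<forall>C\<in>\<A>. openin X (fst C) \<and> open (snd C ` fst C) \<and>
        homeomorphic_map (subtopology X (fst C)) (top_of_set (snd C ` fst C)) (snd C)) \<and>
     (\<forall>C\<in>\<A>. \<forall>D\<in>\<A>. smooth_on (snd C ` (fst C \<inter> fst D)) (snd D \<circ> chart_inv C))"

text \<open>
  Tangent vectors at a point \<open>x\<close> are represented by their coordinates in one preferred chart
  around \<open>x\<close>, so that every tangent space is a copy of the model space; in any other chart the
  coordinates are obtained through the derivative of the change of charts. The functions \<open>\<kappa>\<close> below
  assign to every point its preferred chart.
\<close>

definition chart_at :: "('a, 'v) chart set \<Rightarrow> 'a \<Rightarrow> ('a, 'v) chart" where
  "chart_at \<A> x = (SOME C. C \<in> \<A> \<and> x \<in> fst C)"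

definition to_coords ::
  "('a \<Rightarrow> ('a, 'v::real_normed_vector) chart) \<Rightarrow> ('a, 'v) chart \<Rightarrow> 'a \<Rightarrow> 'v \<Rightarrow> 'v" where
  "to_coords \<kappa> C x = frechet_derivative (snd C \<circ> chart_inv (\<kappa> x)) (at (snd (\<kappa> x) x))"

definition from_coords ::
  "('a \<Rightarrow> ('a, 'v::real_normed_vector) chart) \<Rightarrow> ('a, 'v) chart \<Rightarrow> 'a \<Rightarrow> 'v \<Rightarrow> 'v" where
  "from_coords \<kappa> C x = frechet_derivative (snd (\<kappa> x) \<circ> chart_inv C) (at (snd C x))"

definition manifold_deriv ::
  "('a \<Rightarrow> ('a, 'v::real_normed_vector) chart) \<Rightarrow> ('b \<Rightarrow> ('b, 'w::real_normed_vector) chart) \<Rightarrow>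
     ('a \<Rightarrow> 'b) \<Rightarrow> 'a \<Rightarrow> 'v \<Rightarrow> 'w" where
  "manifold_deriv \<kappa> \<kappa>' f p =
     frechet_derivative (snd (\<kappa>' (f p)) \<circ> f \<circ> chart_inv (\<kappa> p)) (at (snd (\<kappa> p) p))"

definition smooth_function_on ::
  "('a \<Rightarrow> ('a, 'v::real_normed_vector) chart) \<Rightarrow> 'a set \<Rightarrow> ('a \<Rightarrow> real) \<Rightarrow> bool" where
  "smooth_function_on \<kappa> S f \<longleftrightarrow>
     (\<forall>p\<in>S. smooth_map_on (snd (\<kappa> p) ` (S \<inter> fst (\<kappa> p))) (f \<circ> chart_inv (\<kappa> p)))"

text \<open>The tangent space at \<open>p\<close> of a submanifold \<open>S\<close>, as a subspace of the ambient one.\<close>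

definition tangent_space ::
  "('a \<Rightarrow> ('a, 'v::real_normed_vector) chart) \<Rightarrow> 'a set \<Rightarrow> 'a \<Rightarrow> 'v set" where
  "tangent_space \<kappa> S p = tangent_set (snd (\<kappa> p) ` (S \<inter> fst (\<kappa> p))) (snd (\<kappa> p) p)"


section \<open>Differential forms and the exterior derivative\<close>

definition alternating_form :: "(('i \<Rightarrow> 'v::real_vector) \<Rightarrow> real) \<Rightarrow> bool" where
  "alternating_form \<beta> \<longleftrightarrow>
     (\<forall>u i. linear (\<lambda>v. \<beta> (u(i := v)))) \<and>
     (\<forall>u i j. i \<noteq> j \<longrightarrow> u i = u j \<longrightarrow> \<beta> u = 0)"

text \<open>
  Exterior derivative of a \<open>k\<close>-form on an open subset of a vector space. The \<open>k + 1\<close> arguments are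
  indexed by \<open>'k option\<close>, where \<open>None\<close> is the first slot. This is the usual formula
  \<open>\<Sum>i. (-1)\<^sup>i D\<^bsub>u\<^sub>i\<^esub> \<Omega>(u\<^sub>0, \<dots>, omit u\<^sub>i, \<dots>, u\<^sub>k)\<close>: for \<open>i > 0\<close>, moving \<open>u\<^sub>0\<close> into the
  vacated slot costs the sign \<open>(-1)\<^sup>i\<^sup>-\<^sup>1\<close>, and what remains is the sign \<open>-1\<close> of the transposition
  exchanging \<open>u\<^sub>0\<close> and \<open>u\<^sub>i\<close>.
\<close>

definition ext_deriv ::
  "('v::real_normed_vector \<Rightarrow> ('k::finite \<Rightarrow> 'v) \<Rightarrow> real) \<Rightarrow> 'v \<Rightarrow> ('k option \<Rightarrow> 'v) \<Rightarrow> real" where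
  "ext_deriv \<Omega> y u =
     (\<Sum>i\<in>UNIV. of_int (sign (Transposition.transpose None i)) *
        frechet_derivative (\<lambda>z. \<Omega> z (\<lambda>j. u (Transposition.transpose None i (Some j)))) (at y) (u i))"

text \<open>A form \<open>\<omega>\<close> on a submanifold \<open>S\<close> assigns to \<open>q \<in> S\<close> and to vectors of
  \<open>tangent_space \<kappa> S q\<close> a number; other values of \<open>\<omega>\<close> are irrelevant. \<open>\<Omega>\<close> is an extension of
  \<open>\<omega>\<close> near \<open>p\<close> to a smooth form on an open set of the ambient manifold, in coordinates of the
  chart \<open>\<kappa> p\<close>.\<close>

definition local_extension ::
  "('a \<Rightarrow> ('a, 'v::real_normed_vector) chart) \<Rightarrow> 'a set \<Rightarrow> ('a \<Rightarrow> ('k::finite \<Rightarrow> 'v) \<Rightarrow> real) \<Rightarrow> 'a \<Rightarrow>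
     ('v \<Rightarrow> ('k \<Rightarrow> 'v) \<Rightarrow> real) \<Rightarrow> bool" where
  "local_extension \<kappa> S \<omega> p \<Omega> \<longleftrightarrow>
     (\<exists>W. open W \<and> snd (\<kappa> p) p \<in> W \<and> W \<subseteq> snd (\<kappa> p) ` fst (\<kappa> p) \<and>
        (\<forall>y\<in>W. alternating_form (\<Omega> y)) \<and> (\<forall>u. smooth_on W (\<lambda>y. \<Omega> y u)) \<and>
        (\<forall>q\<in>S \<inter> fst (\<kappa> p). snd (\<kappa> p) q \<in> W \<longrightarrow>
           (\<forall>u. (\<forall>i. u i \<in> tangent_set (snd (\<kappa> p) ` (S \<inter> fst (\<kappa> p))) (snd (\<kappa> p) q)) \<longrightarrow>
              \<Omega> (snd (\<kappa> p) q) u = \<omega> q (\<lambda>i. from_coords \<kappa> (\<kappa> p) q (u i)))))"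

text \<open>The exterior derivative at \<open>p \<in> S\<close> of a form on an embedded submanifold \<open>S\<close>, on vectors
  tangent to \<open>S\<close>: restriction of the exterior derivative of any local extension. As the exterior
  derivative commutes with pullback to \<open>S\<close>, the choice of the extension does not matter.\<close>

definition form_deriv ::
  "('a \<Rightarrow> ('a, 'v::real_normed_vector) chart) \<Rightarrow> 'a set \<Rightarrow> ('a \<Rightarrow> ('k::finite \<Rightarrow> 'v) \<Rightarrow> real) \<Rightarrow> 'a \<Rightarrow>
     ('k option \<Rightarrow> 'v) \<Rightarrow> real" where
  "form_deriv \<kappa> S \<omega> p = ext_deriv (SOME \<Omega>. local_extension \<kappa> S \<omega> p \<Omega>) (snd (\<kappa> p) p)"

text \<open>The covector obtained by contracting a \<open>k + 1\<close>-form \<open>\<beta>\<close> with the simple \<open>k\<close>-vector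
  \<open>b\<^sub>1 \<and> \<dots> \<and> b\<^sub>k\<close>, that is \<open>w \<mapsto> \<beta>(b\<^sub>1, \<dots>, b\<^sub>k, w)\<close>. The sign comes from moving \<open>w\<close> to the
  first slot.\<close>

definition contraction ::
  "('k::finite \<Rightarrow> 'v) \<Rightarrow> (('k option \<Rightarrow> 'v) \<Rightarrow> real) \<Rightarrow> 'v \<Rightarrow> real" where
  "contraction b \<beta> w = (-1) ^ CARD('k) * \<beta> (case_option w b)"


section \<open>The bundle of tensors and the cone of simple vectors\<close>

text \<open>Total space of the bundle of \<open>k\<close>-tensors on \<open>M\<close>, with point set \<open>M \<times> \<real>\<^bsup>n^k\<^esup>\<close>: the
  fibre over \<open>x\<close> consists of the coordinates with respect to the preferred chart around \<open>x\<close>. The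
  bundle of \<open>k\<close>-vectors and the cone of simple vectors are subsets of it.\<close>

definition bundle_chart ::
  "('a \<Rightarrow> ('a, real ^ 'n::finite) chart) \<Rightarrow> ('a, real ^ 'n) chart \<Rightarrow>
     ('a \<times> ('n, 'k::finite) tensor, (real ^ 'n) \<times> ('n, 'k) tensor) chart" where
  "bundle_chart \<kappa> C =
     (fst C \<times> UNIV, \<lambda>(x, a). (snd C x, tensor_map (to_coords \<kappa> C x) a))"

definition bundle_chart_at ::
  "('a \<Rightarrow> ('a, real ^ 'n::finite) chart) \<Rightarrow> 'a \<times> ('n, 'k::finite) tensor \<Rightarrow>
     ('a \<times> ('n, 'k) tensor, (real ^ 'n) \<times> ('n, 'k) tensor) chart" where
  "bundle_chart_at \<kappa> p = bundle_chart \<kappa> (\<kappa> (fst p))"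

definition nonzero_simple_bundle :: "'a set \<Rightarrow> ('a \<times> ('n::finite, 'k::finite) tensor) set" where
  "nonzero_simple_bundle M = M \<times> (simple_vectors - {0})"


section \<open>Densities, Legendre maps and Hilbert forms\<close>

definition vector_density :: "(('n::finite, 'k::finite) tensor \<Rightarrow> real) \<Rightarrow> bool" where
  "vector_density \<phi> \<longleftrightarrow>
     (\<forall>a\<in>simple_vectors. \<phi> a \<ge> 0 \<and> (\<phi> a = 0 \<longleftrightarrow> a = 0) \<and> (\<forall>t. \<phi> (t *\<^sub>R a) = \<bar>t\<bar> * \<phi> a)) \<and>
     smooth_map_on (simple_vectors - {0}) \<phi>"

definition k_density ::
  "'a set \<Rightarrow> ('a \<Rightarrow> ('a, real ^ 'n::finite) chart) \<Rightarrow> ('a \<Rightarrow> ('n, 'k::finite) tensor \<Rightarrow> real) \<Rightarrow> bool" where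
  "k_density M \<kappa> \<phi> \<longleftrightarrow>
     (\<forall>x\<in>M. vector_density (\<phi> x)) \<and>
     smooth_function_on (bundle_chart_at \<kappa>) (nonzero_simple_bundle M) (\<lambda>(x, a). \<phi> x a)"

definition unit_fibre :: "(('n::finite, 'k::finite) tensor \<Rightarrow> real) \<Rightarrow> ('n, 'k) tensor set" where
  "unit_fibre \<phi> = {a \<in> simple_vectors. \<phi> a = 1}"

definition unit_bundle ::
  "'a set \<Rightarrow> ('a \<Rightarrow> ('n::finite, 'k::finite) tensor \<Rightarrow> real) \<Rightarrow> ('a \<times> ('n, 'k) tensor) set" where
  "unit_bundle M \<phi> = {(x, a). x \<in> M \<and> a \<in> unit_fibre (\<phi> x)}"

text \<open>A family of \<open>k\<close>-covectors \<open>L x a\<close> is smooth if, in every bundle chart over \<open>C\<close>, all its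
  components, i.e. its values on wedge products of vector fields with constant coordinates \<open>v i\<close>
  in \<open>C\<close>, are smooth.\<close>

definition legendre_map ::
  "'a set \<Rightarrow> ('a \<Rightarrow> ('a, real ^ 'n::finite) chart) \<Rightarrow> ('a \<Rightarrow> ('n, 'k::finite) tensor \<Rightarrow> real) \<Rightarrow>
     ('a \<Rightarrow> ('n, 'k) tensor \<Rightarrow> ('n, 'k) tensor \<Rightarrow> real) \<Rightarrow> bool" where
  "legendre_map M \<kappa> \<phi> L \<longleftrightarrow>
     (\<forall>x\<in>M. \<forall>a\<in>simple_vectors. k_covector (L x a)) \<and>
     (\<forall>x\<^sub>0\<in>M. let C = \<kappa> x\<^sub>0; B = bundle_chart \<kappa> C in
        \<forall>v. smooth_map_on (snd B ` (nonzero_simple_bundle M \<inter> fst B))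
          ((\<lambda>(x, a). L x a (wedge (\<lambda>i. from_coords \<kappa> C x (v i)))) \<circ> chart_inv B)) \<and>
     (\<forall>x\<in>M. \<forall>a\<in>simple_vectors. \<forall>t. \<forall>c\<in>k_vectors. L x (t *\<^sub>R a) c = t * L x a c) \<and>
     (\<forall>x\<in>M. \<forall>a\<in>simple_vectors. L x a a = (\<phi> x a)\<^sup>2) \<and>
     (\<forall>x\<in>M. \<forall>a\<in>unit_fibre (\<phi> x). \<forall>c\<in>tangent_set (unit_fibre (\<phi> x)) a. L x a c = 0)"

text \<open>The bundle projection is \<open>fst\<close>.\<close>

definition hilbert_form ::
  "'a set \<Rightarrow> ('a \<Rightarrow> ('a, real ^ 'n::finite) chart) \<Rightarrow> ('a \<Rightarrow> ('n, 'k::finite) tensor \<Rightarrow> real) \<Rightarrow>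
     ('a \<times> ('n, 'k) tensor \<Rightarrow> ('k \<Rightarrow> (real ^ 'n) \<times> ('n, 'k) tensor) \<Rightarrow> real) \<Rightarrow> bool" where
  "hilbert_form M \<kappa> \<phi> \<omega> \<longleftrightarrow>
     (\<exists>L. legendre_map M \<kappa> \<phi> L \<and>
        (\<forall>(x, a)\<in>unit_bundle M \<phi>. \<forall>u.
           (\<forall>i. u i \<in> tangent_space (bundle_chart_at \<kappa>) (unit_bundle M \<phi>) (x, a)) \<longrightarrow>
           \<omega> (x, a) u =
             L x a (wedge (\<lambda>i. manifold_deriv (bundle_chart_at \<kappa>) \<kappa> fst (x, a) (u i)))))"


section \<open>Oriented submanifolds and their tangent lifts\<close>

text \<open>An embedded submanifold \<open>N\<close> of dimension \<open>CARD('k)\<close> with an orientation \<open>ori\<close>, where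
  \<open>ori x\<close> is the oriented tangent plane at \<open>x \<in> N\<close> (see \<open>oriented_plane\<close>): near each of its points,
  \<open>N\<close> is diffeomorphic through some \<open>\<psi>\<close> to an open subset of \<open>\<real>\<^sup>k\<close>, with the coordinate frames
  of \<open>\<psi>\<close> positively oriented bases of the tangent planes. The map \<open>\<eta>\<close> smoothly extends the inverse
  of \<open>\<psi>\<close>; in particular the derivatives of \<open>\<psi>\<close> are injective.\<close>

definition oriented_submanifold ::
  "'a set \<Rightarrow> ('a \<Rightarrow> ('a, real ^ 'n::finite) chart) \<Rightarrow> 'a set \<Rightarrow>
     ('a \<Rightarrow> ('k::finite \<Rightarrow> real ^ 'n) set) \<Rightarrow> bool" where
  "oriented_submanifold M \<kappa> N ori \<longleftrightarrow> N \<subseteq> M \<and>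
     (\<forall>x\<in>N. let C = \<kappa> x in
        \<exists>W V (\<psi> :: real ^ 'k \<Rightarrow> real ^ 'n) \<eta>.
          open W \<and> snd C x \<in> W \<and> W \<subseteq> snd C ` fst C \<and> open V \<and>
          smooth_on V \<psi> \<and> smooth_on W \<eta> \<and>
          \<psi> ` V = snd C ` (N \<inter> fst C) \<inter> W \<and> (\<forall>t\<in>V. \<eta> (\<psi> t) = t) \<and>
          (\<forall>t\<in>V. let q = chart_inv C (\<psi> t) in
             ori q = oriented_plane
               (wedge (\<lambda>i. from_coords \<kappa> C q (frechet_derivative \<psi> (at t) (axis i 1))))))"

definition tangent_lift ::
  "'a set \<Rightarrow> ('a \<Rightarrow> ('n::finite, 'k::finite) tensor \<Rightarrow> real) \<Rightarrow> 'a set \<Rightarrow>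
     ('a \<Rightarrow> ('k \<Rightarrow> real ^ 'n) set) \<Rightarrow> ('a \<times> ('n, 'k) tensor) set" where
  "tangent_lift M \<phi> N ori = {(x, a) \<in> unit_bundle M \<phi>. x \<in> N \<and> oriented_plane a = ori x}"

end

theory Submission
  imports Defs
begin

text \<open>
  The difference \<open>\<theta>\<close> of the two Hilbert forms is \<open>h(x, a) \<circ> D\<pi>\<close>, where the covector \<open>h(x, a)\<close>
  vanishes on \<open>a\<close> and on the tangent space of the unit fibre, hence on all velocities at \<open>a\<close> of curves
  of simple vectors. Let \<open>G(t, s)\<close> be a map with \<open>G(\<cdot>, 0)\<close> a parametrisation of the tangent lift
  and \<open>\<partial>\<^sub>s G = w\<close>. In \<open>d(G\<^sup>*\<theta>)(\<partial>\<^sub>s, \<tau>\<^sub>1, \<dots>, \<tau>\<^sub>k)\<close> the terms differentiated along \<open>\<tau>\<^sub>i\<close> vanish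
  because \<open>h\<close> annihilates \<open>k\<close>-fold products with \<open>k - 1\<close> factors in the plane \<open>\<langle>a\<rangle>\<close>. The remaining
  term is a multiple of the derivative of \<open>h(\<cdot>)(a)\<close> along \<open>w\<close>, which vanishes by differentiating
  \<open>h(x(s), a(s))(a(s)) = 0\<close> along a curve in the unit bundle.

  To have forms on open sets, everything is precomposed with a local retraction \<open>r\<close> onto the unit
  bundle that preserves base points; on tangent vectors, \<open>r\<^sup>*\<Omega>\<close> depends only on the form that
  \<open>\<Omega>\<close> extends.
\<close>

section \<open>Calculus of smooth maps\<close>

text \<open>The exterior derivative on the unit bundle is defined through an extension picked by
  \<open>SOME\<close> and constrained only on vectors tangent to the unit bundle. The picks for two
  Hilbert forms cannot be subtracted directly; pulling each back by the same r replaces it by an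
  explicit form. This works because a Hilbert form reads base components only, and Dr preserves
  them. No manifold structure on the unit bundle is established: a tangent vector is the velocity of
  a smooth curve, and not even closure under addition is proved. Facts about tangent vectors are
  therefore obtained by differentiating along curves, and the explicit polynomial
  \<open>simple_proj\<close>, followed by normalisation, takes the place of submanifold charts. The
  values of a Legendre map are linear on \<open>k_vectors\<close> only. Hence velocities have to be
  shown to lie there, and a pairing in which covector and argument both move is differentiated
  through a fixed finite basis.\<close>

lemma has_derivative_frechet: "f differentiable at x \<Longrightarrow> (f has_derivative frechet_derivative f (at x)) (at x)"
  using frechet_derivative_works by blast

lemma frechet_derivative_cong_open:
  assumes "open V" "x \<in> V" "\<And>z. z \<in> V \<Longrightarrow> f z = g z"
  shows "frechet_derivative f (at x) = frechet_derivative g (at x)"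
proof -
  have "(f has_derivative f') (at x) \<longleftrightarrow> (g has_derivative f') (at x)" for f'
    using assms by (metis has_derivative_transform_within_open)
  then show ?thesis by (simp add: frechet_derivative_def)
qed

lemma Ck_on_cong:
  assumes "open U" "\<And>x. x \<in> U \<Longrightarrow> f x = g x" "Ck_on m U f"
  shows "Ck_on m U g"
  using assms(2,3)
proof (induction m arbitrary: f g)
  case 0
  then show ?case by (auto cong: continuous_on_cong)
next
  case (Suc m)
  have D: "frechet_derivative f (at x) = frechet_derivative g (at x)" if "x \<in> U" for x
    by (rule frechet_derivative_cong_open[OF assms(1) that]) (rule Suc.prems)
  have "(g has_derivative frechet_derivative f (at x)) (at x)" if "x \<in> U" for x
    by (rule has_derivative_transform_within_open[OF has_derivative_frechet])
      (use Suc.prems that assms(1) in auto)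
  then have "\<forall>x\<in>U. g differentiable at x" by (auto intro: differentiableI)
  moreover have "Ck_on m U (\<lambda>x. frechet_derivative g (at x) v)" for v
    by (rule Suc.IH[of "\<lambda>x. frechet_derivative f (at x) v"]) (use Suc.prems D in auto)
  ultimately show ?case by simp
qed

text \<open>\<open>Ck_on\<close> speaks of the chosen \<open>frechet_derivative\<close>; by
  uniqueness of derivatives any explicit formula may stand in for it. Most product and chain rules
  below enter through this rule.\<close>

lemma Ck_on_SucI:
  assumes "open U" "\<And>x. x \<in> U \<Longrightarrow> (f has_derivative f' x) (at x)"
    and "\<And>v. Ck_on m U (\<lambda>x. f' x v)"
  shows "Ck_on (Suc m) U f"
proof -
  have "Ck_on m U (\<lambda>x. frechet_derivative f (at x) v)" for v
    by (rule Ck_on_cong[OF assms(1) _ assms(3)[of v]])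
      (use fun_cong[OF frechet_derivative_at[OF assms(2)]] in blast)
  then show ?thesis
    using assms(2) by (auto simp: differentiable_def)
qed

lemma Ck_on_continuous: "Ck_on m U f \<Longrightarrow> continuous_on U f"
  by (cases m) (auto intro!: differentiable_imp_continuous_on differentiable_at_imp_differentiable_on)

lemma Ck_on_Suc_imp: "Ck_on (Suc m) U f \<Longrightarrow> Ck_on m U f"
proof (induction m arbitrary: f)
  case 0
  then show ?case using Ck_on_continuous by (metis Ck_on.simps(1))
qed auto

lemma Ck_on_subset: "Ck_on m U f \<Longrightarrow> V \<subseteq> U \<Longrightarrow> Ck_on m V f"
  by (induction m arbitrary: f) (auto intro: continuous_on_subset)

lemma Ck_on_local:
  assumes "\<And>x. x \<in> U \<Longrightarrow> \<exists>V. open V \<and> x \<in> V \<and> Ck_on m V f"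
  shows "Ck_on m U f"
  using assms
proof (induction m arbitrary: f)
  case 0
  then show ?case
    by (metis Ck_on.simps(1) continuous_at_imp_continuous_on continuous_on_eq_continuous_at)
next
  case (Suc m)
  have "Ck_on m U (\<lambda>x. frechet_derivative f (at x) v)" for v
    by (rule Suc.IH) (metis Suc.prems Ck_on.simps(2))
  moreover have "\<forall>x\<in>U. f differentiable at x"
    using Suc.prems by (metis Ck_on.simps(2))
  ultimately show ?case by simp
qed

lemma Ck_on_const: "open U \<Longrightarrow> Ck_on m U (\<lambda>x. c)"
  by (induction m arbitrary: c) simp_all

lemma Ck_on_bounded_linear_comp:
  assumes "bounded_linear L" "open U" "Ck_on m U f"
  shows "Ck_on m U (\<lambda>x. L (f x))"
  using assms(3)
proof (induction m arbitrary: f)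
  case 0
  then show ?case
    by (auto intro: bounded_linear.continuous_on[OF assms(1)])
next
  case (Suc m)
  show ?case
  proof (rule Ck_on_SucI[OF assms(2)])
    show "((\<lambda>x. L (f x)) has_derivative (\<lambda>v. L (frechet_derivative f (at x) v))) (at x)" if "x \<in> U" for x
      using Suc.prems that
      by (auto intro!: bounded_linear.has_derivative[OF assms(1)] has_derivative_frechet)
  qed (use Suc in auto)
qed

lemma Ck_on_add:
  assumes "open U" "Ck_on m U f" "Ck_on m U g"
  shows "Ck_on m U (\<lambda>x. f x + g x)"
  using assms(2,3)
proof (induction m arbitrary: f g)
  case 0
  then show ?case by (auto intro: continuous_on_add)
next
  case (Suc m)
  show ?case
    by (rule Ck_on_SucI[OF assms(1),
          where f' = "\<lambda>x v. frechet_derivative f (at x) v + frechet_derivative g (at x) v"])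
      (use Suc in \<open>auto intro!: has_derivative_add has_derivative_frechet\<close>)
qed

lemma Ck_on_bilinear:
  assumes "bounded_bilinear B" "open U" "Ck_on m U f" "Ck_on m U g"
  shows "Ck_on m U (\<lambda>x. B (f x) (g x))"
  using assms(3,4)
proof (induction m arbitrary: f g)
  case 0
  then show ?case by (auto intro: bounded_bilinear.continuous_on[OF assms(1)])
next
  case (Suc m)
  show ?case
  proof (rule Ck_on_SucI[OF assms(2)])
    show "((\<lambda>x. B (f x) (g x)) has_derivative
       (\<lambda>v. B (f x) (frechet_derivative g (at x) v) + B (frechet_derivative f (at x) v) (g x))) (at x)"
      if "x \<in> U" for x
      using Suc.prems that
      by (auto intro!: bounded_bilinear.FDERIV[OF assms(1)] has_derivative_frechet)
    show "Ck_on m U (\<lambda>x. B (f x) (frechet_derivative g (at x) v) + B (frechet_derivative f (at x) v) (g x))" for v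
      using Suc.prems Ck_on_Suc_imp[OF Suc.prems(1)] Ck_on_Suc_imp[OF Suc.prems(2)]
      by (intro Ck_on_add Suc.IH assms(2)) auto
  qed
qed

lemma Ck_on_sum:
  assumes "open U" "\<And>i. i \<in> I \<Longrightarrow> Ck_on m U (f i)"
  shows "Ck_on m U (\<lambda>x. \<Sum>i\<in>I. f i x)"
  using assms(2)
  by (induction I rule: infinite_finite_induct) (auto intro!: Ck_on_add Ck_on_const assms(1))

text \<open>In the chain rule the direction \<open>frechet_derivative f (at x) v\<close> moves with
  x, whereas \<open>Ck_on\<close> controls derivatives in fixed directions. Expanding the direction
  in \<open>Basis\<close> turns the chain rule into a finite sum of products of controlled
  functions, which is why the middle space of a composition is Euclidean.\<close>

lemma frechet_derivative_euclidean:
  fixes f :: "'v::euclidean_space \<Rightarrow> 'w::real_normed_vector"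
  assumes "f differentiable at x"
  shows "frechet_derivative f (at x) v = (\<Sum>b\<in>Basis. (v \<bullet> b) *\<^sub>R frechet_derivative f (at x) b)"
proof -
  interpret linear "frechet_derivative f (at x)"
    by (rule linear_frechet_derivative[OF assms])
  have "frechet_derivative f (at x) (\<Sum>b\<in>Basis. (v \<bullet> b) *\<^sub>R b) = (\<Sum>b\<in>Basis. (v \<bullet> b) *\<^sub>R frechet_derivative f (at x) b)"
    by (simp only: sum scaleR)
  then show ?thesis by (simp only: euclidean_representation)
qed

lemma Ck_on_compose:
  fixes g :: "'v::euclidean_space \<Rightarrow> 'w::real_normed_vector"
  assumes "open U" "open V" "f ` U \<subseteq> V" "Ck_on m V g" "Ck_on m U f"
  shows "Ck_on m U (\<lambda>x. g (f x))"
  using assms(4,5)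
proof (induction m arbitrary: g)
  case 0
  then show ?case using assms(3) by (auto intro: continuous_on_compose2)
next
  case (Suc m)
  have m: "Ck_on m U f" using Suc.prems(2) by (rule Ck_on_Suc_imp)
  show ?case
  proof (rule Ck_on_SucI[OF assms(1)])
    fix x assume x: "x \<in> U"
    then have g: "g differentiable at (f x)" using assms(3) Suc.prems by auto
    have "((\<lambda>x. g (f x)) has_derivative
         (\<lambda>v. frechet_derivative g (at (f x)) (frechet_derivative f (at x) v))) (at x)"
      by (rule has_derivative_compose[where f = f and g = g])
        (use Suc.prems x g in \<open>auto intro: has_derivative_frechet\<close>)
    then show "((\<lambda>x. g (f x)) has_derivative
         (\<lambda>v. \<Sum>b\<in>Basis. (frechet_derivative f (at x) v \<bullet> b) *\<^sub>R frechet_derivative g (at (f x)) b)) (at x)"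
      by (simp add: frechet_derivative_euclidean[OF g, symmetric])
  next
    show "Ck_on m U (\<lambda>x. \<Sum>b\<in>Basis. (frechet_derivative f (at x) v \<bullet> b) *\<^sub>R frechet_derivative g (at (f x)) b)" for v
    proof (intro Ck_on_sum assms(1) Ck_on_bilinear[OF bounded_bilinear_scaleR])
      show "Ck_on m U (\<lambda>x. frechet_derivative f (at x) v \<bullet> b)" for b
        using Suc.prems by (intro Ck_on_bounded_linear_comp[OF bounded_linear_inner_left assms(1)]) auto
      show "Ck_on m U (\<lambda>x. frechet_derivative g (at (f x)) b)" for b
        by (rule Suc.IH) (use Suc.prems m in auto)
    qed
  qed
qed

text \<open>The derivative is a polynomial in the inverse itself, so the induction closes.\<close>

lemma Ck_on_inverse: "Ck_on m (- {0}) (inverse :: real \<Rightarrow> real)"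
proof (induction m)
  case 0
  then show ?case by (auto intro!: continuous_intros)
next
  case (Suc m)
  have o: "open (- {0::real})" by auto
  show ?case
    by (rule Ck_on_SucI[OF o, where f' = "\<lambda>x v. - (inverse x * v * inverse x)"])
      (auto intro!: derivative_eq_intros Ck_on_bilinear[OF bounded_bilinear_mult o] Suc Ck_on_const[OF o]
          Ck_on_bounded_linear_comp[OF bounded_linear_minus[OF bounded_linear_ident] o])
qed

section \<open>Closure properties of smooth maps\<close>

lemma smooth_on_cong:
  "open U \<Longrightarrow> (\<And>x. x \<in> U \<Longrightarrow> f x = g x) \<Longrightarrow> smooth_on U f \<Longrightarrow> smooth_on U g"
  unfolding smooth_on_def using Ck_on_cong by blast

lemma smooth_on_subset: "smooth_on U f \<Longrightarrow> V \<subseteq> U \<Longrightarrow> smooth_on V f"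
  unfolding smooth_on_def using Ck_on_subset by blast

lemma smooth_on_local:
  assumes "\<And>x. x \<in> U \<Longrightarrow> \<exists>V. open V \<and> x \<in> V \<and> smooth_on V f"
  shows "smooth_on U f"
  unfolding smooth_on_def
proof
  show "Ck_on m U f" for m
    by (rule Ck_on_local) (use assms in \<open>unfold smooth_on_def, blast\<close>)
qed

lemma smooth_on_const: "open U \<Longrightarrow> smooth_on U (\<lambda>x. c)"
  unfolding smooth_on_def using Ck_on_const by blast

lemma smooth_on_bounded_linear_comp:
  "bounded_linear L \<Longrightarrow> open U \<Longrightarrow> smooth_on U f \<Longrightarrow> smooth_on U (\<lambda>x. L (f x))"
  unfolding smooth_on_def using Ck_on_bounded_linear_comp by blast

lemma smooth_on_add:
  "open U \<Longrightarrow> smooth_on U f \<Longrightarrow> smooth_on U g \<Longrightarrow> smooth_on U (\<lambda>x. f x + g x)"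
  unfolding smooth_on_def using Ck_on_add by blast

lemma smooth_on_diff:
  assumes "open U" "smooth_on U f" "smooth_on U g"
  shows "smooth_on U (\<lambda>x. f x - g x)"
  using smooth_on_add[OF assms(1,2) smooth_on_bounded_linear_comp
      [OF bounded_linear_minus[OF bounded_linear_ident] assms(1,3)]] by simp

lemma smooth_on_bilinear:
  "bounded_bilinear B \<Longrightarrow> open U \<Longrightarrow> smooth_on U f \<Longrightarrow> smooth_on U g \<Longrightarrow> smooth_on U (\<lambda>x. B (f x) (g x))"
  unfolding smooth_on_def using Ck_on_bilinear by blast

lemmas smooth_on_mult = smooth_on_bilinear[OF bounded_bilinear_mult]
  and smooth_on_scaleR = smooth_on_bilinear[OF bounded_bilinear_scaleR]

lemma smooth_on_sum:
  "open U \<Longrightarrow> (\<And>i. i \<in> I \<Longrightarrow> smooth_on U (f i)) \<Longrightarrow> smooth_on U (\<lambda>x. \<Sum>i\<in>I. f i x)"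
  unfolding smooth_on_def by (simp add: Ck_on_sum)

lemma smooth_on_prod:
  fixes f :: "'i \<Rightarrow> 'v::real_normed_vector \<Rightarrow> real"
  assumes "open U" "\<And>i. i \<in> I \<Longrightarrow> smooth_on U (f i)"
  shows "smooth_on U (\<lambda>x. \<Prod>i\<in>I. f i x)"
  using assms(2)
  by (induction I rule: infinite_finite_induct) (auto intro!: smooth_on_mult smooth_on_const assms(1))

lemma smooth_on_compose:
  fixes g :: "'v::euclidean_space \<Rightarrow> 'w::real_normed_vector"
  shows "open U \<Longrightarrow> open V \<Longrightarrow> f ` U \<subseteq> V \<Longrightarrow> smooth_on V g \<Longrightarrow> smooth_on U f \<Longrightarrow> smooth_on U (\<lambda>x. g (f x))"
  unfolding smooth_on_def using Ck_on_compose by blast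

lemma smooth_on_inverse:
  fixes f :: "'v::real_normed_vector \<Rightarrow> real"
  assumes "open U" "smooth_on U f" "\<And>x. x \<in> U \<Longrightarrow> f x \<noteq> 0"
  shows "smooth_on U (\<lambda>x. inverse (f x))"
  by (rule smooth_on_compose[of _ "- {0}"]) (use assms Ck_on_inverse in \<open>auto simp: smooth_on_def\<close>)

lemma smooth_on_divide:
  fixes f :: "'v::real_normed_vector \<Rightarrow> real"
  assumes "open U" "smooth_on U f" "smooth_on U g" "\<And>x. x \<in> U \<Longrightarrow> g x \<noteq> 0"
  shows "smooth_on U (\<lambda>x. f x / g x)"
  unfolding divide_inverse by (intro smooth_on_mult smooth_on_inverse assms)

lemma smooth_on_differentiable: "smooth_on U f \<Longrightarrow> x \<in> U \<Longrightarrow> f differentiable at x"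
  unfolding smooth_on_def by (metis Ck_on.simps(2))

lemma smooth_on_has_derivative:
  "smooth_on U f \<Longrightarrow> x \<in> U \<Longrightarrow> (f has_derivative frechet_derivative f (at x)) (at x)"
  by (intro has_derivative_frechet smooth_on_differentiable)

lemma smooth_on_frechet_derivative:
  "smooth_on U f \<Longrightarrow> smooth_on U (\<lambda>x. frechet_derivative f (at x) v)"
  unfolding smooth_on_def by (metis Ck_on.simps(2))

lemma smooth_on_continuous: "smooth_on U f \<Longrightarrow> continuous_on U f"
  unfolding smooth_on_def by (metis Ck_on.simps(1))

lemma smooth_on_ident: "open U \<Longrightarrow> smooth_on U (\<lambda>x. x)"
proof -
  assume U: "open U"
  have "Ck_on m U (\<lambda>x. x)" for m
    by (cases m) (auto simp: U Ck_on_const)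
  then show ?thesis by (simp add: smooth_on_def)
qed

lemma smooth_on_bounded_linear: "bounded_linear L \<Longrightarrow> open U \<Longrightarrow> smooth_on U L"
  using smooth_on_bounded_linear_comp[OF _ _ smooth_on_ident] by blast

lemma smooth_on_Pair:
  assumes "open U" "smooth_on U f" "smooth_on U g"
  shows "smooth_on U (\<lambda>x. (f x, g x))"
proof -
  have "smooth_on U (\<lambda>x. (f x, 0) + (0, g x))"
    by (intro smooth_on_add smooth_on_bounded_linear_comp[OF _ _ assms(2)]
        smooth_on_bounded_linear_comp[OF _ _ assms(3)] assms(1) bounded_linear_intros)
  then show ?thesis by simp
qed

lemma smooth_on_fst: "open U \<Longrightarrow> smooth_on U f \<Longrightarrow> smooth_on U (\<lambda>x. fst (f x))"
  and smooth_on_snd: "open U \<Longrightarrow> smooth_on U f \<Longrightarrow> smooth_on U (\<lambda>x. snd (f x))"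
  and smooth_on_nth: "open U \<Longrightarrow> smooth_on U g \<Longrightarrow> smooth_on U (\<lambda>x. g x $ i)"
  by (rule smooth_on_bounded_linear_comp; simp add: bounded_linear_fst bounded_linear_snd bounded_linear_vec_nth)+

lemma smooth_on_vec:
  fixes f :: "'i::finite \<Rightarrow> 'v::real_normed_vector \<Rightarrow> real"
  assumes "open U" "\<And>i. smooth_on U (f i)"
  shows "smooth_on U (\<lambda>x. \<chi> i. f i x)"
proof -
  have "smooth_on U (\<lambda>x. \<Sum>i\<in>UNIV. f i x *\<^sub>R axis i (1::real))"
    by (intro smooth_on_sum smooth_on_scaleR assms smooth_on_const)
  moreover have "(\<lambda>x. \<Sum>i\<in>UNIV. f i x *\<^sub>R axis i (1::real)) = (\<lambda>x. \<chi> i. f i x)"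
    by (simp add: fun_eq_iff vec_eq_iff axis_def if_distrib sum.delta cong: if_cong)
  ultimately show ?thesis by simp
qed

text \<open>Near each value g has a smooth extension, and f never leaves S, so the choice of
  extension is invisible. This is how densities and Legendre maps, given only on the cone of simple
  vectors, become ordinary smooth functions.\<close>

lemma smooth_map_on_compose:
  fixes g :: "'v::euclidean_space \<Rightarrow> 'w::real_normed_vector"
  assumes "open U" "smooth_on U f" "f ` U \<subseteq> S" "smooth_map_on S g"
  shows "smooth_on U (\<lambda>x. g (f x))"
proof (rule smooth_on_local)
  fix x assume x: "x \<in> U"
  then obtain V h where V: "open V" "f x \<in> V" "smooth_on V h" "\<forall>q\<in>S \<inter> V. h q = g q"
    using assms(3,4) unfolding smooth_map_on_def by (metis image_subset_iff)
  define W where "W = U \<inter> f -` V"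
  have W: "open W"
    unfolding W_def using smooth_on_continuous[OF assms(2)] assms(1) V(1) 
    by (metis continuous_open_preimage)
  have "smooth_on W (\<lambda>x. h (f x))"
    by (rule smooth_on_compose[OF W V(1) _ V(3)]) (use assms(2) in \<open>auto simp: W_def intro: smooth_on_subset\<close>)
  then have "smooth_on W (\<lambda>x. g (f x))"
    by (rule smooth_on_cong[OF W, rotated]) (use V assms(3) in \<open>auto simp: W_def\<close>)
  then show "\<exists>V. open V \<and> x \<in> V \<and> smooth_on V (\<lambda>x. g (f x))"
    using W x V by (auto simp: W_def)
qed

section \<open>Symmetry of second derivatives\<close>

text \<open>The mixed second difference \<open>d h a b\<close> is symmetric in a and b. Two uses of
  the mean value theorem write it as \<open>h * h\<close> times a mixed second derivative at a point
  near x, in either order, and continuity finishes. The mean value theorem needs real values; the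
  vector version goes by components.\<close>

lemma symmetric_second_derivative_real:
  fixes f :: "'v::real_normed_vector \<Rightarrow> real"
  assumes U: "open U" "x \<in> U" and f: "smooth_on U f"
  shows "frechet_derivative (\<lambda>z. frechet_derivative f (at z) a) (at x) b =
    frechet_derivative (\<lambda>z. frechet_derivative f (at z) b) (at x) a"
proof -
  define D where "D a = (\<lambda>z. frechet_derivative f (at z) a)" for a
  define D2 where "D2 a b = (\<lambda>z. frechet_derivative (D a) (at z) b)" for a b
  have sD: "smooth_on U (D a)" for a
    unfolding D_def by (rule smooth_on_frechet_derivative[OF f])
  have cD2: "continuous_on U (D2 a b)" for a b
    unfolding D2_def by (rule smooth_on_continuous[OF smooth_on_frechet_derivative[OF sD]])
  obtain r where r: "r > 0" "ball x r \<subseteq> U"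
    using U openE by blast
  have line: "((\<lambda>s. g (p + s *\<^sub>R v)) has_real_derivative frechet_derivative g (at (p + s *\<^sub>R v)) v) (at s)"
    if "smooth_on U g" "p + s *\<^sub>R v \<in> U" for g :: "'v \<Rightarrow> real" and p v s
  proof -
    have "((\<lambda>s. g (p + s *\<^sub>R v)) has_derivative
        (\<lambda>t. frechet_derivative g (at (p + s *\<^sub>R v)) (t *\<^sub>R v))) (at s)"
      by (rule has_derivative_compose[where f = "\<lambda>s. p + s *\<^sub>R v" and g = g])
        (auto intro!: derivative_eq_intros smooth_on_has_derivative[OF that])
    moreover have "frechet_derivative g (at (p + s *\<^sub>R v)) (t *\<^sub>R v) =
        frechet_derivative g (at (p + s *\<^sub>R v)) v * t" for t
      using linear_cmul[OF linear_frechet_derivative[OF smooth_on_differentiable[OF that]]]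
      by simp
    ultimately show ?thesis by (simp add: has_field_derivative_def)
  qed
  define d where "d h a b = f (x + h *\<^sub>R a + h *\<^sub>R b) - f (x + h *\<^sub>R a) - f (x + h *\<^sub>R b) + f x" for h a b
  have key: "\<exists>z\<in>cball x (h * (norm a + norm b)). d h a b = h * h * D2 a b z"
    if h: "h > 0" "h * (norm a + norm b) < r" for h a b
  proof -
    have inb: "x + (s *\<^sub>R a + t *\<^sub>R b) \<in> cball x (h * (norm a + norm b))"
      if "0 \<le> s" "s \<le> h" "0 \<le> t" "t \<le> h" for s t
    proof -
      have "norm (s *\<^sub>R a + t *\<^sub>R b) \<le> s * norm a + t * norm b"
        using norm_triangle_ineq[of "s *\<^sub>R a" "t *\<^sub>R b"] that by simp
      also have "\<dots> \<le> h * (norm a + norm b)"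
        using that by (auto simp: distrib_left intro!: add_mono mult_right_mono)
      finally show ?thesis unfolding mem_cball dist_commute[of x] by (simp add: dist_norm)
    qed
    have sub: "cball x (h * (norm a + norm b)) \<subseteq> U"
      using h r by (auto simp: subset_iff)
    \<comment> \<open>The difference in direction b, viewed as a function along a: its increment
      over [0, h] is the second difference.\<close>
    define \<phi> where "\<phi> s = f (x + h *\<^sub>R b + s *\<^sub>R a) - f (x + s *\<^sub>R a)" for s
    have d\<phi>: "(\<phi> has_real_derivative (D a (x + h *\<^sub>R b + s *\<^sub>R a) - D a (x + s *\<^sub>R a))) (at s)"
      if "0 \<le> s" "s \<le> h" for s
      unfolding \<phi>_def D_def
      using inb[of s h] inb[of s 0] sub that h
      by (intro DERIV_diff line f) (auto simp: algebra_simps)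
    obtain s where s: "0 < s" "s < h" "\<phi> h - \<phi> 0 = (h - 0) * (D a (x + h *\<^sub>R b + s *\<^sub>R a) - D a (x + s *\<^sub>R a))"
      using MVT2[of 0 h \<phi> "\<lambda>s. D a (x + h *\<^sub>R b + s *\<^sub>R a) - D a (x + s *\<^sub>R a)"] h d\<phi> by auto
    have d\<psi>: "((\<lambda>t. D a (x + s *\<^sub>R a + t *\<^sub>R b)) has_real_derivative D2 a b (x + s *\<^sub>R a + t *\<^sub>R b)) (at t)"
      if "0 \<le> t" "t \<le> h" for t
      unfolding D2_def using inb[of s t] sub that s
      by (intro line sD) (auto simp: algebra_simps)
    obtain t where t: "0 < t" "t < h"
      "D a (x + s *\<^sub>R a + h *\<^sub>R b) - D a (x + s *\<^sub>R a + 0 *\<^sub>R b) = (h - 0) * D2 a b (x + s *\<^sub>R a + t *\<^sub>R b)"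
      using MVT2[of 0 h "\<lambda>t. D a (x + s *\<^sub>R a + t *\<^sub>R b)" "\<lambda>t. D2 a b (x + s *\<^sub>R a + t *\<^sub>R b)"] h d\<psi> by auto
    have "d h a b = \<phi> h - \<phi> 0" by (simp add: d_def \<phi>_def algebra_simps)
    also have "\<dots> = h * h * D2 a b (x + (s *\<^sub>R a + t *\<^sub>R b))"
      using s(3) t(3) by (simp add: algebra_simps)
    finally show ?thesis using inb[of s t] s t by auto
  qed
  have sym: "d h a b = d h b a" for h by (simp add: d_def algebra_simps)
  have "\<bar>D2 a b x - D2 b a x\<bar> < e" if e: "e > 0" for e
  proof -
    obtain d1 where d1: "d1 > 0" "\<And>z. z \<in> U \<Longrightarrow> dist z x < d1 \<Longrightarrow> dist (D2 a b z) (D2 a b x) < e / 2"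
      using cD2[of a b] U e unfolding continuous_on_iff by (metis half_gt_zero)
    obtain d2 where d2: "d2 > 0" "\<And>z. z \<in> U \<Longrightarrow> dist z x < d2 \<Longrightarrow> dist (D2 b a z) (D2 b a x) < e / 2"
      using cD2[of b a] U e unfolding continuous_on_iff by (metis half_gt_zero)
    \<comment> \<open>The summand 1 keeps n positive when a and b both vanish, and makes the bounds
      on h strict.\<close>
    define n where "n = norm a + norm b + 1"
    have n: "n > 0" "norm a + norm b < n" by (auto simp: n_def add_nonneg_pos)
    define h where "h = Min {r, d1, d2} / n"
    have h: "h > 0" using r d1 d2 n by (simp add: h_def)
    have "h * (norm a + norm b) < h * n" using h n by simp
    also have "\<dots> = Min {r, d1, d2}" using n by (simp add: h_def)
    finally have hn: "h * (norm a + norm b) < r" "h * (norm a + norm b) < d1" "h * (norm a + norm b) < d2"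
      by auto
    obtain z where z: "z \<in> cball x (h * (norm a + norm b))" "d h a b = h * h * D2 a b z"
      using key[OF h hn(1)] by blast
    obtain z' where z': "z' \<in> cball x (h * (norm a + norm b))" "d h b a = h * h * D2 b a z'"
      using key[of h b a] h hn by (auto simp: add.commute)
    have zz: "D2 a b z = D2 b a z'" using z z' sym[of h] h by auto
    have "z \<in> U" "z' \<in> U" "dist z x < d1" "dist z' x < d2"
      using z z' hn r by (auto simp: subset_iff dist_commute)
    then have "dist (D2 a b z) (D2 a b x) < e / 2" "dist (D2 b a z') (D2 b a x) < e / 2"
      using d1 d2 by auto
    then show ?thesis using zz unfolding dist_real_def by linarith
  qed
  then have "D2 a b x = D2 b a x" by (metis abs_eq_0 less_irrefl zero_less_abs_iff right_minus_eq)
  then show ?thesis by (simp add: D2_def D_def)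
qed

lemma symmetric_second_derivative:
  fixes f :: "'v::real_normed_vector \<Rightarrow> 'w::euclidean_space"
  assumes U: "open U" "x \<in> U" and f: "smooth_on U f"
  shows "frechet_derivative (\<lambda>z. frechet_derivative f (at z) a) (at x) b =
    frechet_derivative (\<lambda>z. frechet_derivative f (at z) b) (at x) a"
proof (rule euclidean_eqI)
  fix e :: 'w assume "e \<in> Basis"
  have D: "frechet_derivative (\<lambda>z. g z \<bullet> e) (at z) v = frechet_derivative g (at z) v \<bullet> e"
    if "smooth_on U g" "z \<in> U" for g :: "'v \<Rightarrow> 'w" and z v
    using frechet_derivative_at[OF has_derivative_inner_left[OF smooth_on_has_derivative[OF that]], of e]
    by metis
  have 2: "frechet_derivative (\<lambda>z. frechet_derivative (\<lambda>z. f z \<bullet> e) (at z) a) (at x) b =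
      frechet_derivative (\<lambda>z. frechet_derivative f (at z) a) (at x) b \<bullet> e" for a b
  proof -
    have "((\<lambda>z. frechet_derivative f (at z) a \<bullet> e) has_derivative
        (\<lambda>b. frechet_derivative (\<lambda>z. frechet_derivative f (at z) a) (at x) b \<bullet> e)) (at x)"
      by (intro has_derivative_inner_left smooth_on_has_derivative[OF _ U(2)] smooth_on_frechet_derivative f)
    then have "((\<lambda>z. frechet_derivative (\<lambda>z. f z \<bullet> e) (at z) a) has_derivative
        (\<lambda>b. frechet_derivative (\<lambda>z. frechet_derivative f (at z) a) (at x) b \<bullet> e)) (at x)"
      by (rule has_derivative_transform_within_open[OF _ U]) (simp add: D[OF f])
    from frechet_derivative_at[OF this] show ?thesis by metis
  qed
  have "smooth_on U (\<lambda>z. f z \<bullet> e)"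
    by (intro smooth_on_bounded_linear_comp[OF bounded_linear_inner_left U(1) f])
  from symmetric_second_derivative_real[OF U this, of a b]
  show "frechet_derivative (\<lambda>z. frechet_derivative f (at z) a) (at x) b \<bullet> e =
      frechet_derivative (\<lambda>z. frechet_derivative f (at z) b) (at x) a \<bullet> e"
    by (simp only: 2)
qed

section \<open>Pullback of forms\<close>

lemma has_vector_derivative_compose_frechet:
  assumes "f differentiable at (\<gamma> s)" "(\<gamma> has_vector_derivative v) (at s)"
  shows "((\<lambda>t. f (\<gamma> t)) has_vector_derivative frechet_derivative f (at (\<gamma> s)) v) (at s)"
proof -
  have "((\<lambda>t. f (\<gamma> t)) has_derivative (\<lambda>h. frechet_derivative f (at (\<gamma> s)) (h *\<^sub>R v))) (at s)"
    by (rule has_derivative_compose[where f = \<gamma> and g = f])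
      (use assms has_derivative_frechet in \<open>auto simp: has_vector_derivative_def\<close>)
  then show ?thesis
    by (simp add: has_vector_derivative_def linear_cmul[OF linear_frechet_derivative[OF assms(1)]])
qed

text \<open>Any curve with velocity v computes the derivative in direction v. This transfers what is
  known only along curves inside a subset to the ambient derivative.\<close>

lemma frechet_derivative_along_curve:
  assumes "f differentiable at (\<gamma> s)" "(\<gamma> has_vector_derivative v) (at s)"
    and "((\<lambda>t. f (\<gamma> t)) has_vector_derivative d) (at s)"
  shows "frechet_derivative f (at (\<gamma> s)) v = d"
  using has_vector_derivative_compose_frechet[OF assms(1,2)] assms(3)
  by (rule vector_derivative_unique_at)

lemma alternating_form_linear: "alternating_form \<beta> \<Longrightarrow> linear (\<lambda>v. \<beta> (u(i := v)))"
  unfolding alternating_form_def by blast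

lemma alternating_form_eq_0: "alternating_form \<beta> \<Longrightarrow> i \<noteq> j \<Longrightarrow> u i = u j \<Longrightarrow> \<beta> u = 0"
  unfolding alternating_form_def by blast

text \<open>Polarisation: with x + y in both slots i and j the form vanishes, and so do the diagonal
  terms of the expansion.\<close>

lemma alternating_form_swap:
  assumes "alternating_form \<beta>" "i \<noteq> j"
  shows "\<beta> (u(i := x, j := y)) = - \<beta> (u(i := y, j := x))"
proof -
  have add: "\<beta> (v(l := p + q)) = \<beta> (v(l := p)) + \<beta> (v(l := q))" for v l p q
    by (rule linear_add[OF alternating_form_linear[OF assms(1)]])
  have addi: "\<beta> (v(i := p + q, j := r)) = \<beta> (v(i := p, j := r)) + \<beta> (v(i := q, j := r))" for v p q r
    using add[of "v(j := r)" i p q] assms(2) by (simp add: fun_upd_twist)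
  have z: "\<beta> (u(i := p, j := p)) = 0" for p
    by (rule alternating_form_eq_0[OF assms]) simp
  show ?thesis
    using z[of "x + y"] z[of x] z[of y] by (simp add: add addi)
qed

lemma alternating_form_expand:
  fixes x :: "'v::euclidean_space"
  assumes "alternating_form \<beta>"
  shows "\<beta> (u(a := x)) = (\<Sum>e\<in>Basis. (x \<bullet> e) * \<beta> (u(a := e)))"
proof -
  have "\<beta> (u(a := \<Sum>e\<in>Basis. (x \<bullet> e) *\<^sub>R e)) = (\<Sum>e\<in>Basis. (x \<bullet> e) * \<beta> (u(a := e)))"
    using linear_sum[OF alternating_form_linear[OF assms], of u a "\<lambda>e. (x \<bullet> e) *\<^sub>R e" Basis]
      linear_cmul[OF alternating_form_linear[OF assms], of u a] by simp
  then show ?thesis by (simp only: euclidean_representation)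
qed

text \<open>The transposition of \<open>None\<close> and \<open>Some m\<close> has sign -1 and puts
  the first vector into slot m of the others; \<open>i = None\<close> gives the identity and the
  first summand.\<close>

lemma ext_deriv_expand:
  "ext_deriv \<Omega> y u = frechet_derivative (\<lambda>z. \<Omega> z (\<lambda>j. u (Some j))) (at y) (u None) -
     (\<Sum>m\<in>UNIV. frechet_derivative (\<lambda>z. \<Omega> z ((\<lambda>j. u (Some j))(m := u None))) (at y) (u (Some m)))"
proof -
  have "(\<lambda>j. u (Transposition.transpose None (Some m) (Some j))) = (\<lambda>j. u (Some j))(m := u None)" for m
    by (auto simp: Transposition.transpose_def fun_eq_iff)
  then show ?thesis
    unfolding ext_deriv_def
    by (simp add: UNIV_option_conv sum.reindex sign_swap_id sum_negf)
qed

lemma ext_deriv_cong_open: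
  assumes "open V" "y \<in> V" "\<And>z u. z \<in> V \<Longrightarrow> \<Omega> z u = \<Omega>' z u"
  shows "ext_deriv \<Omega> y u = ext_deriv \<Omega>' y u"
proof -
  have "frechet_derivative (\<lambda>z. \<Omega> z w) (at y) = frechet_derivative (\<lambda>z. \<Omega>' z w) (at y)" for w
    by (rule frechet_derivative_cong_open[OF assms(1,2)]) (rule assms(3))
  then show ?thesis by (simp only: ext_deriv_def)
qed

lemma ext_deriv_diff:
  assumes "\<And>u. (\<lambda>z. \<Omega> z u) differentiable at y" "\<And>u. (\<lambda>z. \<Omega>' z u) differentiable at y"
  shows "ext_deriv (\<lambda>z u. \<Omega> z u - \<Omega>' z u) y u = ext_deriv \<Omega> y u - ext_deriv \<Omega>' y u"
proof -
  have "frechet_derivative (\<lambda>z. \<Omega> z u - \<Omega>' z u) (at y) =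
      (\<lambda>v. frechet_derivative (\<lambda>z. \<Omega> z u) (at y) v - frechet_derivative (\<lambda>z. \<Omega>' z u) (at y) v)" for u
    by (rule frechet_derivative_at[symmetric]) (intro has_derivative_diff has_derivative_frechet assms)
  then show ?thesis by (simp add: ext_deriv_expand sum_subtractf)
qed

text \<open>Differentiability of \<Omega> is assumed for frozen arguments. Multilinearity transfers
  it to moving ones: one slot at a time is replaced by its finite expansion in \<open>Basis\<close>,
  whose coefficients are differentiable.\<close>

lemma has_derivative_form_compose:
  fixes \<Omega> :: "'v::real_normed_vector \<Rightarrow> ('k::finite \<Rightarrow> 'w::euclidean_space) \<Rightarrow> real"
    and F :: "'u::real_normed_vector \<Rightarrow> 'v"
  assumes V: "open V" "F y \<in> V" and alt: "\<And>z. z \<in> V \<Longrightarrow> alternating_form (\<Omega> z)"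
    and diff: "\<And>u. (\<lambda>z. \<Omega> z u) differentiable at (F y)"
    and F: "(F has_derivative F') (at y)"
    and v: "\<And>j. (v j has_derivative v' j) (at y)"
  shows "((\<lambda>z. \<Omega> (F z) (\<lambda>j. v j z)) has_derivative
     (\<lambda>h. frechet_derivative (\<lambda>z. \<Omega> z (\<lambda>j. v j y)) (at (F y)) (F' h) +
        (\<Sum>j\<in>UNIV. \<Omega> (F y) ((\<lambda>j. v j y)(j := v' j h))))) (at y)"
proof -
  \<comment> \<open>Slots in A move, the others hold the constants c. In the induction c stays
    arbitrary, because the slot added next is first frozen at a basis vector.\<close>
  define T where "T A c z = (\<lambda>j. if j \<in> A then v j z else c j)" for A c z
  have "((\<lambda>z. \<Omega> (F z) (T A c z)) has_derivative
     (\<lambda>h. frechet_derivative (\<lambda>z. \<Omega> z (T A c y)) (at (F y)) (F' h) +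
        (\<Sum>j\<in>A. \<Omega> (F y) ((T A c y)(j := v' j h))))) (at y)" if "finite A" for A c
    using that
  proof (induction A arbitrary: c)
    case empty
    show ?case
      unfolding T_def by (simp add: has_derivative_compose[OF F has_derivative_frechet[OF diff]])
  next
    case (insert a A)
    have Ta: "T A (c(a := e)) z = (T A c z)(a := e)" for e z
      using insert.hyps by (auto simp: T_def fun_eq_iff)
    have Ti: "T (insert a A) c z = (T A c z)(a := v a z)" for z
      using insert.hyps by (auto simp: T_def fun_eq_iff)
    define D where "D u = frechet_derivative (\<lambda>z. \<Omega> z u) (at (F y))" for u
    have "((\<lambda>z. \<Sum>e\<in>Basis. (v a z \<bullet> e) * \<Omega> (F z) (T A (c(a := e)) z)) has_derivative
      (\<lambda>h. \<Sum>e\<in>Basis. (v a y \<bullet> e) * (D (T A (c(a := e)) y) (F' h) +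
           (\<Sum>j\<in>A. \<Omega> (F y) ((T A (c(a := e)) y)(j := v' j h)))) +
         (v' a h \<bullet> e) * \<Omega> (F y) (T A (c(a := e)) y))) (at y)"
      unfolding D_def
      by (intro has_derivative_sum has_derivative_mult has_derivative_inner_left v insert.IH)
    moreover have "(\<Sum>e\<in>Basis. (v a y \<bullet> e) * (D (T A (c(a := e)) y) (F' h) +
           (\<Sum>j\<in>A. \<Omega> (F y) ((T A (c(a := e)) y)(j := v' j h)))) +
         (v' a h \<bullet> e) * \<Omega> (F y) (T A (c(a := e)) y)) =
       D (T (insert a A) c y) (F' h) + (\<Sum>j\<in>insert a A. \<Omega> (F y) ((T (insert a A) c y)(j := v' j h)))" for h
    proof -
      note ex = alternating_form_expand[OF alt]
      have 1: "(\<Sum>e\<in>Basis. (v' a h \<bullet> e) * \<Omega> (F y) (T A (c(a := e)) y)) =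
          \<Omega> (F y) ((T (insert a A) c y)(a := v' a h))"
        unfolding Ta Ti using ex[OF V(2), of "T A c y" a "v' a h"] by simp
      have 2: "(\<Sum>e\<in>Basis. (v a y \<bullet> e) * (\<Sum>j\<in>A. \<Omega> (F y) ((T A (c(a := e)) y)(j := v' j h)))) =
          (\<Sum>j\<in>A. \<Omega> (F y) ((T (insert a A) c y)(j := v' j h)))"
      proof -
        have "(\<Sum>e\<in>Basis. (v a y \<bullet> e) * (\<Sum>j\<in>A. \<Omega> (F y) ((T A (c(a := e)) y)(j := v' j h)))) =
           (\<Sum>j\<in>A. \<Sum>e\<in>Basis. (v a y \<bullet> e) * \<Omega> (F y) ((T A (c(a := e)) y)(j := v' j h)))"
          unfolding sum_distrib_left by (rule sum.swap)
        also have "\<dots> = (\<Sum>j\<in>A. \<Omega> (F y) ((T (insert a A) c y)(j := v' j h)))"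
        proof (rule sum.cong[OF refl])
          fix j assume "j \<in> A"
          then have "j \<noteq> a" using insert.hyps by auto
          then have tw: "(T A c y)(a := x, j := v' j h) = (T A c y)(j := v' j h, a := x)" for x
            by (simp add: fun_upd_twist)
          show "(\<Sum>e\<in>Basis. (v a y \<bullet> e) * \<Omega> (F y) ((T A (c(a := e)) y)(j := v' j h))) =
              \<Omega> (F y) ((T (insert a A) c y)(j := v' j h))"
            unfolding Ta Ti tw using ex[OF V(2)] by metis
        qed
        finally show ?thesis .
      qed
      \<comment> \<open>Resumming the expansion inside a derivative uses multilinearity at nearby
        points too, hence the open set V.\<close>
      have 3: "(\<Sum>e\<in>Basis. (v a y \<bullet> e) * D (T A (c(a := e)) y) (F' h)) = D (T (insert a A) c y) (F' h)"
      proof -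
        have "((\<lambda>z. \<Sum>e\<in>Basis. (v a y \<bullet> e) * \<Omega> z (T A (c(a := e)) y)) has_derivative
            (\<lambda>k. \<Sum>e\<in>Basis. (v a y \<bullet> e) * D (T A (c(a := e)) y) k)) (at (F y))"
          unfolding D_def by (intro has_derivative_sum has_derivative_mult_right has_derivative_frechet diff)
        then have "((\<lambda>z. \<Omega> z (T (insert a A) c y)) has_derivative
            (\<lambda>k. \<Sum>e\<in>Basis. (v a y \<bullet> e) * D (T A (c(a := e)) y) k)) (at (F y))"
          by (rule has_derivative_transform_within_open[OF _ V])
            (simp add: Ta Ti alternating_form_expand[OF alt, of _ "T A c y" a "v a y"])
        from frechet_derivative_at[OF this] show ?thesis
          unfolding D_def by (rule fun_cong)
      qed
      show ?thesis
        using insert.hyps by (simp add: distrib_left sum.distrib 1 2 3)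
    qed
    ultimately have *: "((\<lambda>z. \<Sum>e\<in>Basis. (v a z \<bullet> e) * \<Omega> (F z) (T A (c(a := e)) z)) has_derivative
       (\<lambda>h. D (T (insert a A) c y) (F' h) +
          (\<Sum>j\<in>insert a A. \<Omega> (F y) ((T (insert a A) c y)(j := v' j h))))) (at y)"
      by simp
    have "\<forall>\<^sub>F z in at y. F z \<in> V"
      using has_derivative_continuous[OF F] V
      by (metis continuous_within topological_tendstoD)
    then have ev: "\<forall>\<^sub>F z in at y. (\<Sum>e\<in>Basis. (v a z \<bullet> e) * \<Omega> (F z) (T A (c(a := e)) z)) =
        \<Omega> (F z) (T (insert a A) c z)"
      by eventually_elim (simp add: Ta Ti alternating_form_expand[OF alt, of _ "T A c _" a "v a _"])
    show ?case
      by (rule has_derivative_transform_eventually[OF *[unfolded D_def] ev])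
        (simp_all add: Ta Ti alternating_form_expand[OF alt[OF V(2)], of "T A c y" a "v a y"])
  qed
  from this[of UNIV undefined] show ?thesis by (simp add: T_def)
qed

text \<open>Besides the wanted terms, differentiating the pullback yields terms with a second
  derivative of F in one slot. They cancel because second derivatives are symmetric and \<Omega> is
  alternating.\<close>

lemma ext_deriv_pullback:
  fixes \<Omega> :: "'v::euclidean_space \<Rightarrow> ('k::finite \<Rightarrow> 'v) \<Rightarrow> real"
    and F :: "'u::euclidean_space \<Rightarrow> 'v"
  assumes U: "open U" "y \<in> U" "smooth_on U F"
    and V: "open V" "F y \<in> V" and alt: "\<And>z. z \<in> V \<Longrightarrow> alternating_form (\<Omega> z)"
    and diff: "\<And>u. (\<lambda>z. \<Omega> z u) differentiable at (F y)"
  shows "ext_deriv (\<lambda>z u. \<Omega> (F z) (\<lambda>j. frechet_derivative F (at z) (u j))) y u =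
    ext_deriv \<Omega> (F y) (\<lambda>i. frechet_derivative F (at y) (u i))"
proof -
  define L where "L = frechet_derivative F (at y)"
  define D2 where "D2 a = frechet_derivative (\<lambda>z. frechet_derivative F (at z) a) (at y)" for a
  have D2_sym: "D2 a b = D2 b a" for a b
    unfolding D2_def by (rule symmetric_second_derivative[OF U])
  define D where "D w = frechet_derivative (\<lambda>z. \<Omega> z w) (at (F y))" for w
  have "((\<lambda>z. \<Omega> (F z) (\<lambda>j. frechet_derivative F (at z) (w j))) has_derivative
     (\<lambda>h. D (\<lambda>j. L (w j)) (L h) + (\<Sum>j\<in>UNIV. \<Omega> (F y) ((\<lambda>j. L (w j))(j := D2 (w j) h))))) (at y)" for w
    unfolding D_def L_def D2_def
    by (rule has_derivative_form_compose[where F = F and V = V])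
      (use V alt diff in \<open>auto intro!: smooth_on_has_derivative[OF _ U(2)] smooth_on_frechet_derivative U\<close>)
  note FD = frechet_derivative_at[OF this, symmetric]
  let ?U = "\<lambda>j. u (Some j)" and ?u = "u None"
  \<comment> \<open>The terms with the first vector in slot m and a second derivative in slot j. The
    diagonal is set to 0 because \<open>inner\<close> splits it off: it cancels against the second
    derivative terms from the first summand of \<open>ext_deriv_expand\<close>.\<close>
  define Q where "Q m j = (if j = m then 0 else \<Omega> (F y) ((\<lambda>j. L (?U j))(m := L ?u, j := D2 (?U j) (?U m))))" for m j
  have Q_anti: "Q m j = - Q j m" for m j
  proof (cases "j = m")
    case False
    let ?w = "\<lambda>j. L (?U j)" and ?x = "D2 (?U j) (?U m)"
    have "Q m j = - \<Omega> (F y) (?w(m := ?x, j := L ?u))"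
      unfolding Q_def using False alternating_form_swap[OF alt[OF V(2)], of m j ?w "L ?u" ?x] by simp
    also have "?w(m := ?x, j := L ?u) = ?w(j := L ?u, m := ?x)"
      using False by (intro fun_upd_twist) auto
    finally show ?thesis using False by (simp add: Q_def D2_sym[of "?U j" "?U m"] fun_upd_def)
  qed (simp add: Q_def)
  have "(\<Sum>m\<in>UNIV. \<Sum>j\<in>UNIV. Q m j) = (\<Sum>m\<in>UNIV. \<Sum>j\<in>UNIV. - Q m j)"
    by (subst sum.swap) (simp only: Q_anti[symmetric])
  then have Q0: "(\<Sum>m\<in>UNIV. \<Sum>j\<in>UNIV. Q m j) = 0"
    by (simp add: sum_negf)
  have LU: "(\<lambda>j. L ((?U(m := ?u)) j)) = (\<lambda>j. L (?U j))(m := L ?u)" for m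
    by auto
  have inner: "(\<Sum>j\<in>UNIV. \<Omega> (F y) ((\<lambda>j. L ((?U(m := ?u)) j))(j := D2 ((?U(m := ?u)) j) (?U m)))) =
      \<Omega> (F y) ((\<lambda>j. L (?U j))(m := D2 (?U m) ?u)) + (\<Sum>j\<in>UNIV. Q m j)" (is "?l = ?r") for m
  proof -
    have "?l = (\<Sum>j\<in>UNIV. (if j = m then \<Omega> (F y) ((\<lambda>j. L (?U j))(m := D2 (?U m) ?u)) else 0) + Q m j)"
      unfolding LU by (rule sum.cong) (auto simp: Q_def D2_sym[of "u None"])
    then show ?thesis by (simp add: sum.distrib sum.delta)
  qed
  show ?thesis
    unfolding ext_deriv_expand FD inner unfolding LU D_def[symmetric] L_def[symmetric]
    by (simp add: sum.distrib Q0)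
qed

section \<open>Simple vectors\<close>

lemma linear_nth:
  fixes A :: "real ^ 'm::finite \<Rightarrow> real ^ 'n::finite"
  assumes "linear A"
  shows "A x $ j = (\<Sum>m\<in>UNIV. x $ m * A (axis m 1) $ j)"
  using linear_componentwise[of A x j] assms by (simp add: linear_matrix_vector_mul_eq)

lemma det_eq_0_iff_kernel:
  fixes A :: "real ^ 'n::finite ^ 'n"
  shows "det A = 0 \<longleftrightarrow> (\<exists>c. c \<noteq> 0 \<and> A *v c = 0)"
  by (metis invertible_det_nz invertible_left_inverse matrix_left_invertible_ker)

lemma wedge_nth: "wedge v $ J = det (\<chi> i j. v i $ (J $ j))"
  by (simp add: wedge_def)

lemma wedge_upd_nth:
  "wedge (v(i := x)) $ J = det (\<chi> l. if l = i then (\<chi> j. x $ (J $ j)) else (\<chi> j. v l $ (J $ j)))"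
  unfolding wedge_nth by (rule arg_cong[of _ _ det]) (simp add: vec_eq_iff)

lemma linear_wedge:
  fixes v :: "'k::finite \<Rightarrow> real ^ 'n::finite"
  shows "linear (\<lambda>x. wedge (v(i := x)))"
proof (rule linearI)
  show "wedge (v(i := x + y)) = wedge (v(i := x)) + wedge (v(i := y))" for x y
  proof -
    have "(\<chi> j. (x + y) $ (J $ j)) = (\<chi> j. x $ (J $ j)) + (\<chi> j. y $ (J $ j))" for J :: "'n ^ 'k"
      by (simp add: vec_eq_iff)
    then have "wedge (v(i := x + y)) $ J = wedge (v(i := x)) $ J + wedge (v(i := y)) $ J" for J :: "'n ^ 'k"
      unfolding wedge_upd_nth by (simp only: det_row_add)
    then show ?thesis by (simp add: vec_eq_iff)
  qed
  show "wedge (v(i := c *\<^sub>R x)) = c *\<^sub>R wedge (v(i := x))" for c x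
  proof -
    have "(\<chi> j. (c *\<^sub>R x) $ (J $ j)) = c *s (\<chi> j. x $ (J $ j))" for J :: "'n ^ 'k"
      by (simp add: vec_eq_iff)
    then have "wedge (v(i := c *\<^sub>R x)) $ J = c * wedge (v(i := x)) $ J" for J :: "'n ^ 'k"
      unfolding wedge_upd_nth by (simp only: det_row_mul)
    then show ?thesis by (simp add: vec_eq_iff)
  qed
qed

lemma wedge_eq_0: "i \<noteq> j \<Longrightarrow> v i = v j \<Longrightarrow> wedge v = 0"
  unfolding vec_eq_iff wedge_nth
  by (auto intro!: det_identical_rows[of i j] simp: row_def)

lemma wedge_in_simple [simp]: "wedge v \<in> simple_vectors"
  by (simp add: simple_vectors_def)

lemma simple_in_k_vectors: "a \<in> simple_vectors \<Longrightarrow> a \<in> k_vectors"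
  unfolding k_vectors_def by (rule span_base)

text \<open>One factor absorbs the scalar. Such a factor exists because the index type is nonempty,
  so the degree is at least 1.\<close>

lemma simple_vectors_scaleR: 
  assumes "a \<in> simple_vectors"
  shows "c *\<^sub>R a \<in> simple_vectors"
proof -
  from assms obtain v where v: "a = wedge v" by (auto simp: simple_vectors_def)
  have "c *\<^sub>R a = wedge (v(i := c *\<^sub>R v i))" for i
    using linear_cmul[OF linear_wedge[of v i], of c "v i"] v by simp
  then show ?thesis by (metis wedge_in_simple)
qed

section \<open>The tensor power of a linear map\<close>

lemma prod_sum_vec:
  fixes g :: "'k::finite \<Rightarrow> 'n::finite \<Rightarrow> 'r::comm_semiring_1"
  shows "(\<Prod>i\<in>UNIV. \<Sum>m\<in>UNIV. g i m) = (\<Sum>K\<in>UNIV. \<Prod>i\<in>UNIV. g i (K $ i))"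
proof -
  have "bij (vec_nth :: 'n ^ 'k \<Rightarrow> 'k \<Rightarrow> 'n)"
    by (rule bijI') (auto simp: vec_eq_iff fun_eq_iff intro: exI[of _ "vec_lambda _"])
  then have "(\<Sum>K\<in>UNIV. \<Prod>i\<in>UNIV. g i (K $ i)) = (\<Sum>f\<in>UNIV. \<Prod>i\<in>UNIV. g i (f i))"
    by (rule sum.reindex_bij_betw)
  then show ?thesis by (simp add: prod_sum_PiE)
qed

lemma linear_tensor_map: "linear (tensor_map A)"
  by (rule linearI)
    (simp_all add: tensor_map_def vec_eq_iff distrib_left sum.distrib sum_distrib_left algebra_simps)

lemma tensor_map_wedge:
  fixes A :: "real ^ 'n::finite \<Rightarrow> real ^ 'n" and v :: "'k::finite \<Rightarrow> real ^ 'n"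
  assumes "linear A"
  shows "tensor_map A (wedge v) = wedge (\<lambda>i. A (v i))"
proof -
  \<comment> \<open>In this form of the Leibniz formula the product runs over the tensor slots, as
    in \<open>tensor_map\<close>, while the permutation only relabels the vectors.\<close>
  have det: "det (\<chi> i j. M i j) = (\<Sum>p\<in>{p. p permutes UNIV}. of_int (sign p) * (\<Prod>j\<in>UNIV. M (p j) j))"
    for M :: "'k \<Rightarrow> 'k \<Rightarrow> real"
    unfolding det_transpose[of "\<chi> i j. M i j", symmetric]
    by (simp add: det_def transpose_def)
  have "wedge (\<lambda>i. A (v i)) $ J =
     (\<Sum>K\<in>UNIV. (\<Prod>i\<in>UNIV. A (axis (K $ i) 1) $ (J $ i)) * wedge v $ K)" for J :: "'n ^ 'k"
  proof -
    have "wedge (\<lambda>i. A (v i)) $ J =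
      (\<Sum>p\<in>{p. p permutes UNIV}. of_int (sign p) *
        (\<Prod>j\<in>UNIV. \<Sum>m\<in>UNIV. A (axis m 1) $ (J $ j) * v (p j) $ m))"
      unfolding wedge_nth det linear_nth[OF assms, of "v _"] by (simp add: mult.commute)
    also have "\<dots> = (\<Sum>p\<in>{p. p permutes UNIV}. \<Sum>K\<in>UNIV.
        (\<Prod>i\<in>UNIV. A (axis (K $ i) 1) $ (J $ i)) * (of_int (sign p) * (\<Prod>j\<in>UNIV. v (p j) $ (K $ j))))"
      by (simp add: prod_sum_vec prod.distrib sum_distrib_left algebra_simps)
    also have "\<dots> = (\<Sum>K\<in>UNIV. (\<Prod>i\<in>UNIV. A (axis (K $ i) 1) $ (J $ i)) * wedge v $ K)"
      unfolding wedge_nth det sum_distrib_left by (rule sum.swap)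
    finally show ?thesis .
  qed
  then show ?thesis by (simp add: tensor_map_def vec_eq_iff)
qed

lemma tensor_map_compose:
  assumes "linear A"
  shows "tensor_map A (tensor_map B T) = tensor_map (\<lambda>x. A (B x)) T"
proof -
  have "(\<Sum>K\<in>UNIV. (\<Prod>i\<in>UNIV. A (axis (K $ i) 1) $ (J $ i)) *
          (\<Sum>L\<in>UNIV. (\<Prod>i\<in>UNIV. B (axis (L $ i) 1) $ (K $ i)) * T $ L)) =
        (\<Sum>L\<in>UNIV. (\<Prod>i\<in>UNIV. A (B (axis (L $ i) 1)) $ (J $ i)) * T $ L)" for J
  proof -
    have "(\<Sum>K\<in>UNIV. (\<Prod>i\<in>UNIV. A (axis (K $ i) 1) $ (J $ i)) *
          (\<Sum>L\<in>UNIV. (\<Prod>i\<in>UNIV. B (axis (L $ i) 1) $ (K $ i)) * T $ L)) =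
       (\<Sum>K\<in>UNIV. \<Sum>L\<in>UNIV. (\<Prod>i\<in>UNIV. B (axis (L $ i) 1) $ (K $ i) * A (axis (K $ i) 1) $ (J $ i)) * T $ L)"
      by (simp add: sum_distrib_left prod.distrib algebra_simps)
    also have "\<dots> = (\<Sum>L\<in>UNIV. \<Sum>K\<in>UNIV. (\<Prod>i\<in>UNIV. B (axis (L $ i) 1) $ (K $ i) * A (axis (K $ i) 1) $ (J $ i)) * T $ L)"
      by (rule sum.swap)
    also have "\<dots> = (\<Sum>L\<in>UNIV. (\<Prod>i\<in>UNIV. A (B (axis (L $ i) 1)) $ (J $ i)) * T $ L)"
      unfolding linear_nth[OF assms, of "B _"] prod_sum_vec sum_distrib_right ..
    finally show ?thesis .
  qed
  then show ?thesis by (simp add: tensor_map_def)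
qed

lemma tensor_map_ident: "tensor_map (\<lambda>x. x) T = T"
proof -
  have P: "(\<Prod>i\<in>UNIV. axis (K $ i) (1::real) $ (J $ i)) = (if K = J then 1 else 0)" for J K :: "'n::finite ^ 'k::finite"
    by (auto simp: axis_def vec_eq_iff) metis
  then have "tensor_map (\<lambda>x. x) T $ J = (\<Sum>K\<in>UNIV. if K = J then T $ K else 0)" for J
    unfolding tensor_map_def vec_lambda_beta P by (intro sum.cong) auto
  then show ?thesis by (intro vec_eq_iff[THEN iffD2] allI) simp
qed

lemma tensor_map_simple: "linear A \<Longrightarrow> a \<in> simple_vectors \<Longrightarrow> tensor_map A a \<in> simple_vectors"
  by (auto simp: simple_vectors_def tensor_map_wedge)

lemma tensor_map_k_vectors:
  assumes "linear A" "c \<in> k_vectors"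
  shows "tensor_map A c \<in> k_vectors"
  using assms(2) unfolding k_vectors_def
proof (induction rule: span_induct_alt)
  case base
  then show ?case by (simp add: linear_0[OF linear_tensor_map] span_zero)
next
  case (step c x y)
  then show ?case
    using span_base[OF tensor_map_simple[OF assms(1) step.hyps(1)]]
    by (auto simp: linear_add[OF linear_tensor_map] linear_cmul[OF linear_tensor_map] intro!: span_add span_scale)
qed

text \<open>For every multi-index J the coordinate matrix factors through the square matrix of
  \<tau>, so multiplicativity of \<open>det\<close> gives one scalar for all J.\<close>

lemma wedge_combination:
  fixes e :: "'k::finite \<Rightarrow> real ^ 'n::finite"
  shows "wedge (\<lambda>i. \<Sum>m\<in>UNIV. \<tau> i $ m *\<^sub>R e m) = det (\<chi> i. \<tau> i) *\<^sub>R wedge e"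
proof -
  have "(\<chi> i j. (\<Sum>m\<in>UNIV. \<tau> i $ m *\<^sub>R e m) $ (J $ j)) = (\<chi> i. \<tau> i) ** (\<chi> m j. e m $ (J $ j))" for J :: "'n ^ 'k"
    by (simp add: vec_eq_iff matrix_matrix_mult_def sum_component)
  then have "wedge (\<lambda>i. \<Sum>m\<in>UNIV. \<tau> i $ m *\<^sub>R e m) $ J = det (\<chi> i. \<tau> i) * wedge e $ J" for J :: "'n ^ 'k"
    unfolding wedge_nth by (simp only: det_mul)
  then show ?thesis by (simp add: vec_eq_iff)
qed

text \<open>A \<open>k\<close>-fold product with \<open>k - 1\<close> factors in the plane of \<open>wedge e\<close> is tangent to the cone of
  simple vectors at \<open>wedge e\<close>, along a straight line inside the cone.\<close>

lemma wedge_replace_line: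
  fixes e :: "'k::finite \<Rightarrow> real ^ 'n::finite"
  defines "v \<equiv> \<lambda>\<tau> j. \<Sum>m\<in>UNIV. \<tau> j $ m *\<^sub>R e m"
  shows "wedge e + s *\<^sub>R wedge ((v \<tau>)(i := w)) \<in> simple_vectors"
proof (cases "\<exists>x. det (\<chi> j. (\<tau>(i := x)) j) \<noteq> 0")
  case True
  \<comment> \<open>The coefficient vectors other than \<open>\<tau> i\<close> can be completed to a
    basis, so a multiple of \<open>wedge e\<close> has a factorisation containing the corresponding
    vectors. In the other case they are dependent, and the product is 0.\<close>
  then obtain x d where d: "d = det (\<chi> j. (\<tau>(i := x)) j)" "d \<noteq> 0" by blast
  define f where "f = v (\<tau>(i := x))"
  have f: "wedge f = d *\<^sub>R wedge e"
    unfolding f_def v_def d(1) by (rule wedge_combination)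
  \<comment> \<open>Since f agrees with \<open>v \<tau>\<close> off slot i, both summands share k -
    1 factors and add up to a single product.\<close>
  have "wedge (f(i := (1 / d) *\<^sub>R f i + s *\<^sub>R w)) = (1 / d) *\<^sub>R wedge (f(i := f i)) + s *\<^sub>R wedge (f(i := w))"
    by (simp only: linear_add[OF linear_wedge] linear_cmul[OF linear_wedge])
  also have "f(i := w) = (v \<tau>)(i := w)"
    by (auto simp: f_def v_def fun_eq_iff)
  also have "(1 / d) *\<^sub>R wedge (f(i := f i)) = wedge e"
    using d(2) f by simp
  finally show ?thesis by (metis wedge_in_simple)
next
  case False
  \<comment> \<open>Fewer than k vectors leave some x outside their span. In a relation c among the
    family completed by x, the coefficient of x must be 0, so c already relates the others, whatever
    slot i holds.\<close>
  define S where "S = span (\<tau> ` (- {i}))"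
  have "dim S \<le> card (\<tau> ` (- {i}))"
    unfolding S_def by (simp add: dim_le_card')
  also have "\<dots> \<le> card (- {i})" by (rule card_image_le) simp
  also have "\<dots> < CARD('k)" by (rule psubset_card_mono) auto
  finally have "S \<noteq> UNIV" by auto
  then obtain x where x: "x \<notin> S" by blast
  have "det (transpose (\<chi> j. (\<tau>(i := x)) j)) = 0"
    using False by (simp add: det_transpose)
  then obtain c where c: "c \<noteq> 0" "transpose (\<chi> j. (\<tau>(i := x)) j) *v c = 0"
    by (metis det_eq_0_iff_kernel)
  have c2: "(\<Sum>j\<in>UNIV. c $ j *\<^sub>R (\<tau>(i := x)) j) = 0"
    using c(2) by (simp add: matrix_vector_mult_def transpose_def vec_eq_iff sum_component mult.commute)
  have UNIV: "(UNIV :: 'k set) = insert i (- {i})" by auto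
  have c3: "c $ i *\<^sub>R x + (\<Sum>j\<in>- {i}. c $ j *\<^sub>R \<tau> j) = 0"
  proof -
    have "(\<Sum>j\<in>- {i}. c $ j *\<^sub>R (\<tau>(i := x)) j) = (\<Sum>j\<in>- {i}. c $ j *\<^sub>R \<tau> j)"
      by (rule sum.cong) auto
    then show ?thesis using c2 by (subst (asm) UNIV) simp
  qed
  have ci: "c $ i = 0"
  proof (rule ccontr)
    assume "c $ i \<noteq> 0"
    then have "x = (1 / c $ i) *\<^sub>R (c $ i *\<^sub>R x)" by simp
    also have "c $ i *\<^sub>R x = - (\<Sum>j\<in>- {i}. c $ j *\<^sub>R \<tau> j)"
      using c3 by (simp add: eq_neg_iff_add_eq_0)
    moreover have "(1 / c $ i) *\<^sub>R - (\<Sum>j\<in>- {i}. c $ j *\<^sub>R \<tau> j) \<in> S"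
      unfolding S_def by (intro span_scale span_neg span_sum span_base) auto
    ultimately show False using x by simp
  qed
  have "(\<Sum>j\<in>UNIV. c $ j *\<^sub>R ((v \<tau>)(i := w)) j) = 0"
  proof -
    have Z: "(\<Sum>j\<in>UNIV. c $ j * \<tau> j $ m) = 0" for m
    proof -
      have "(\<Sum>j\<in>UNIV. c $ j *\<^sub>R \<tau> j) = (\<Sum>j\<in>UNIV. c $ j *\<^sub>R (\<tau>(i := x)) j)"
        using ci by (intro sum.cong) auto
      then have "(\<Sum>j\<in>UNIV. c $ j *\<^sub>R \<tau> j) $ m = 0" using c2 by simp
      then show ?thesis by (simp add: sum_component)
    qed
    have "(\<Sum>j\<in>UNIV. c $ j *\<^sub>R ((v \<tau>)(i := w)) j) = (\<Sum>j\<in>UNIV. c $ j *\<^sub>R v \<tau> j)"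
      using ci by (intro sum.cong) auto
    also have "\<dots> = (\<Sum>m\<in>UNIV. (\<Sum>j\<in>UNIV. c $ j * \<tau> j $ m) *\<^sub>R e m)"
      unfolding v_def scaleR_sum_right scaleR_sum_left scaleR_scaleR by (rule sum.swap)
    also have "\<dots> = 0" using Z by simp
    finally show ?thesis .
  qed
  then have c4: "(\<Sum>j\<in>UNIV. c $ j * ((v \<tau>)(i := w)) j $ m) = 0" for m
    by (drule_tac arg_cong[of _ _ "\<lambda>x. x $ m"])
      (simp only: sum_component vector_scaleR_component zero_index real_scaleR_def)
  have "wedge ((v \<tau>)(i := w)) = 0"
  proof -
    have "det (transpose (\<chi> l j. ((v \<tau>)(i := w)) l $ (J $ j))) = 0" for J
    proof -
      have "transpose (\<chi> l j. ((v \<tau>)(i := w)) l $ (J $ j)) *v c = 0"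
        using c4 by (simp add: matrix_vector_mult_def transpose_def vec_eq_iff mult.commute)
      then show ?thesis using c(1) det_eq_0_iff_kernel by blast
    qed
    then show ?thesis unfolding vec_eq_iff wedge_nth det_transpose by simp
  qed
  then show ?thesis by simp
qed

text \<open>Near a simple vector with \<open>a $ J \<noteq> 0\<close> this is, up to a positive factor on the cone, a
  retraction onto the cone of simple vectors. The contractions of \<open>a\<close> with all but one of the
  coordinate covectors selected by \<open>J\<close> span the plane of \<open>a\<close>.\<close>

definition simple_proj :: "'n::finite ^ 'k::finite \<Rightarrow> ('n, 'k) tensor \<Rightarrow> ('n, 'k) tensor" where
  "simple_proj J T = (T $ J) ^ (CARD('k) + 1) *\<^sub>R
     wedge (\<lambda>i. \<chi> m. T $ (\<chi> j. if j = i then m else J $ j))"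

lemma simple_proj_in_simple: "simple_proj J T \<in> simple_vectors"
  unfolding simple_proj_def by (intro simple_vectors_scaleR wedge_in_simple)

text \<open>Let A be the square matrix of the coordinates of e selected by J, so that
  \<open>det A = T $ J\<close>. By Cramer's rule the vectors in \<open>simple_proj\<close> are the
  rows of \<open>det A\<close> times the inverse of A times the matrix of e, hence
  \<open>det A\<close> times their product is \<open>det A ^ CARD('k)\<close> times T. Of the
  exponent k + 1, one factor clears the inverse determinant and the other k make the resulting power
  even.\<close>

lemma simple_proj_simple:
  fixes T :: "('n::finite, 'k::finite) tensor"
  assumes "T \<in> simple_vectors"
  shows "simple_proj J T = (T $ J) ^ (2 * CARD('k)) *\<^sub>R T"
proof (cases "T $ J = 0")
  case False
  obtain e where e: "T = wedge e" using assms by (auto simp: simple_vectors_def)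
  define A :: "real ^ 'k ^ 'k" where "A = (\<chi> i j. e i $ (J $ j))"
  have dA: "det A = T $ J" by (simp add: A_def e wedge_nth)
  then have "\<exists>B. A ** B = mat 1 \<and> B ** A = mat 1"
    using False by (metis invertible_det_nz invertible_def)
  then have inv: "A ** matrix_inv A = mat 1"
    unfolding matrix_inv_def by (metis (mono_tags, lifting) someI_ex)
  define x where "x m = matrix_inv A *v (\<chi> i. e i $ m)" for m
  have Ax: "A *v x m = (\<chi> i. e i $ m)" for m
    by (simp add: x_def matrix_vector_mul_assoc inv)
  have T: "T $ (\<chi> j. if j = i then m else J $ j) = det A * x m $ i" for i m
  proof -
    have "T $ (\<chi> j. if j = i then m else J $ j) = det (\<chi> l j. if j = i then (A *v x m) $ l else A $ l $ j)"
      unfolding e wedge_nth Ax by (rule arg_cong[of _ _ det]) (simp add: vec_eq_iff A_def)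
    then show ?thesis by (simp add: cramer_lemma mult.commute)
  qed
  have "det A * wedge (\<lambda>i. \<chi> m. T $ (\<chi> j. if j = i then m else J $ j)) $ K = det A ^ CARD('k) * T $ K" for K
  proof -
    have "wedge (\<lambda>i. \<chi> m. T $ (\<chi> j. if j = i then m else J $ j)) $ K =
       det (\<chi> i. det A *s (\<chi> j. x (K $ j) $ i))"
      unfolding wedge_nth T by (rule arg_cong[of _ _ det]) (simp add: vec_eq_iff)
    also have "\<dots> = det A ^ CARD('k) * det (\<chi> i j. x (K $ j) $ i)"
      by (simp add: det_rows_mul)
    finally have 1: "wedge (\<lambda>i. \<chi> m. T $ (\<chi> j. if j = i then m else J $ j)) $ K =
       det A ^ CARD('k) * det (\<chi> i j. x (K $ j) $ i)" .
    have "(\<chi> i j. e i $ (K $ j)) = A ** (\<chi> i j. x (K $ j) $ i)"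
    proof -
      have "(A *v x (K $ j)) $ i = e i $ (K $ j)" for i j by (simp add: Ax)
      then show ?thesis by (simp add: vec_eq_iff matrix_matrix_mult_def matrix_vector_mult_def)
    qed
    then have "T $ K = det A * det (\<chi> i j. x (K $ j) $ i)"
      by (simp add: e wedge_nth det_mul)
    then show ?thesis using 1 by simp
  qed
  then show ?thesis
    by (simp add: simple_proj_def vec_eq_iff dA[symmetric] mult_2 power_add mult.assoc)
qed (simp add: simple_proj_def)

lemma smooth_on_wedge:
  assumes "open U" "\<And>i. smooth_on U (v i)"
  shows "smooth_on U (\<lambda>z. wedge (\<lambda>i. v i z))"
  unfolding wedge_def det_def
  by (intro smooth_on_vec assms(1) smooth_on_sum smooth_on_mult smooth_on_prod smooth_on_const)
    (simp add: smooth_on_nth assms)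

lemma smooth_on_tensor_map:
  assumes "open U" "\<And>m. smooth_on U (\<lambda>z. A z (axis m 1))" "smooth_on U T"
  shows "smooth_on U (\<lambda>z. tensor_map (A z) (T z))"
  unfolding tensor_map_def
  by (intro smooth_on_vec smooth_on_sum smooth_on_mult smooth_on_prod smooth_on_nth assms)

lemma smooth_on_power:
  fixes f :: "'v::real_normed_vector \<Rightarrow> real"
  assumes "open U" "smooth_on U f"
  shows "smooth_on U (\<lambda>x. f x ^ n)"
  using smooth_on_prod[of U "{..<n}" "\<lambda>_. f"] assms by simp

lemma smooth_on_simple_proj:
  assumes "open U" "smooth_on U T"
  shows "smooth_on U (\<lambda>z. simple_proj J (T z))"
  unfolding simple_proj_def
  by (intro smooth_on_scaleR smooth_on_power smooth_on_wedge smooth_on_vec smooth_on_nth assms)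

section \<open>Densities in coordinates\<close>

lemma fst_fun_upd: "(\<lambda>i. fst ((u(j := x)) i)) = (\<lambda>i. fst (u i))(j := fst x)"
  by auto

text \<open>An orthonormal basis has coefficients \<open>c \<bullet> b\<close>, which are linear and
  continuous in c. Moving k-vectors can thus be paired with moving covectors through finitely many
  real functions.\<close>

lemma k_vectors_expansion:
  "\<exists>B :: ('n::finite, 'k::finite) tensor set. finite B \<and> B \<subseteq> k_vectors \<and> (\<forall>c\<in>k_vectors. (\<Sum>b\<in>B. (c \<bullet> b) *\<^sub>R b) = c)"
proof -
  have "subspace (k_vectors :: ('n, 'k) tensor set)"
    unfolding k_vectors_def by (rule subspace_span)
  then obtain B :: "('n, 'k) tensor set" where B: "B \<subseteq> k_vectors" "pairwise orthogonal B"
    "\<And>x. x \<in> B \<Longrightarrow> norm x = 1" "independent B" "card B = dim (k_vectors :: ('n, 'k) tensor set)"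
    "span B = k_vectors"
    using orthonormal_basis_subspace[of "k_vectors :: ('n, 'k) tensor set"] by blast
  have fin: "finite B" using B(4) by (rule independent_imp_finite)
  have "(\<Sum>b\<in>B. (c \<bullet> b) *\<^sub>R b) = c" if "c \<in> k_vectors" for c
    by (rule orthonormal_basis_expand) (use B fin that in auto)
  then show ?thesis using B fin by blast
qed

text \<open>The orthogonal projection onto \<open>k_vectors\<close> fixes the curve near s, hence
  also its velocity.\<close>

lemma has_vector_derivative_in_k_vectors:
  fixes \<beta> :: "real \<Rightarrow> ('n::finite, 'k::finite) tensor"
  assumes "(\<beta> has_vector_derivative b) (at s)" "\<forall>\<^sub>F t in nhds s. \<beta> t \<in> k_vectors"
  shows "b \<in> k_vectors"
proof -
  obtain B :: "('n, 'k) tensor set" where B: "finite B" "B \<subseteq> k_vectors"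
    "\<And>c. c \<in> k_vectors \<Longrightarrow> (\<Sum>b\<in>B. (c \<bullet> b) *\<^sub>R b) = c"
    using k_vectors_expansion by blast
  have "((\<lambda>t. \<Sum>e\<in>B. (\<beta> t \<bullet> e) *\<^sub>R e) has_vector_derivative (\<Sum>e\<in>B. (b \<bullet> e) *\<^sub>R e)) (at s)"
    by (intro bounded_linear.has_vector_derivative[OF _ assms(1)] bounded_linear_sum
        bounded_linear_scaleR_const bounded_linear_inner_left)
  moreover have "\<forall>\<^sub>F t in nhds s. (\<Sum>e\<in>B. (\<beta> t \<bullet> e) *\<^sub>R e) = \<beta> t"
    using assms(2) by eventually_elim (rule B(3))
  moreover from this have "(\<Sum>e\<in>B. (\<beta> s \<bullet> e) *\<^sub>R e) = \<beta> s"
    by (rule eventually_nhds_x_imp_x)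
  ultimately have "(\<beta> has_vector_derivative (\<Sum>e\<in>B. (b \<bullet> e) *\<^sub>R e)) (at s)"
    by (subst (asm) has_vector_derivative_cong_ev) auto
  then have "b = (\<Sum>e\<in>B. (b \<bullet> e) *\<^sub>R e)"
    by (rule vector_derivative_unique_at[OF assms(1)])
  moreover have "(\<Sum>e\<in>B. (b \<bullet> e) *\<^sub>R e) \<in> k_vectors"
    using B(2) unfolding k_vectors_def by (intro span_sum span_scale) auto
  ultimately show ?thesis by simp
qed

lemma k_covector_sum:
  assumes "k_covector l" "finite B" "B \<subseteq> k_vectors"
  shows "l (\<Sum>b\<in>B. f b *\<^sub>R b) = (\<Sum>b\<in>B. f b * l b)"
  using assms(2,3)
proof (induction B rule: finite_induct)
  case empty
  have "0 \<in> (k_vectors :: ('a, 'b) tensor set)" unfolding k_vectors_def by (rule span_zero)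
  then have "l (0 *\<^sub>R 0) = 0 * l 0" using assms(1) unfolding k_covector_def by blast
  then show ?case by simp
next
  case (insert x F)
  have "(\<Sum>b\<in>F. f b *\<^sub>R b) \<in> k_vectors" "f x *\<^sub>R x \<in> k_vectors"
    using insert.prems unfolding k_vectors_def by (auto intro!: span_sum span_scale)
  then show ?case using insert assms(1) unfolding k_covector_def by auto
qed

lemma k_covector_diff: "k_covector l \<Longrightarrow> k_covector l' \<Longrightarrow> k_covector (\<lambda>c. l c - l' c)"
  unfolding k_covector_def by (auto simp: algebra_simps)

lemma alternating_form_wedge_fst:
  fixes l :: "('n::finite, 'k::finite) tensor \<Rightarrow> real"
  assumes "k_covector l"
  shows "alternating_form (\<lambda>u :: 'k \<Rightarrow> (real ^ 'n) \<times> 'w::real_vector. l (wedge (\<lambda>i. fst (u i))))"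
  unfolding alternating_form_def
proof (intro conjI allI impI)
  have l: "c \<in> k_vectors \<Longrightarrow> d \<in> k_vectors \<Longrightarrow> l (c + d) = l c + l d" "c \<in> k_vectors \<Longrightarrow> l (t *\<^sub>R c) = t * l c" for c d t
    using assms unfolding k_covector_def by auto
  have w: "wedge v \<in> k_vectors" for v :: "'k \<Rightarrow> real ^ 'n" by (simp add: simple_in_k_vectors)
  fix u :: "'k \<Rightarrow> (real ^ 'n) \<times> 'w" and i j
  show "linear (\<lambda>v. l (wedge (\<lambda>ia. fst ((u(i := v)) ia))))"
    unfolding fst_fun_upd
    by (rule linearI) (simp_all add: linear_add[OF linear_wedge] linear_cmul[OF linear_wedge] l w)
  assume "i \<noteq> j" "u i = u j"
  then have "wedge (\<lambda>i. fst (u i)) = 0" by (intro wedge_eq_0[of i j]) auto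
  then show "l (wedge (\<lambda>i. fst (u i))) = 0"
    using l(2)[where c = 0 and t = 0] by (simp add: k_vectors_def span_zero)
qed

section \<open>Curves and their velocities\<close>

lemma curve_stays_in_open:
  fixes \<gamma> :: "real \<Rightarrow> 'v::topological_space"
  assumes "e > 0" "continuous_on {- e<..<e} \<gamma>" "open W" "\<gamma> 0 \<in> W"
  obtains d where "0 < d" "d \<le> e" "\<gamma> ` {- d<..<d} \<subseteq> W"
proof -
  have "open ({- e<..<e} \<inter> \<gamma> -` W)"
    using assms by (intro continuous_open_preimage) auto
  moreover have "0 \<in> {- e<..<e} \<inter> \<gamma> -` W" using assms by auto
  ultimately obtain d where d: "d > 0" "ball 0 d \<subseteq> {- e<..<e} \<inter> \<gamma> -` W"
    using openE by blast
  have "{- min d e<..<min d e} \<subseteq> ball 0 d" by (auto simp: dist_real_def)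
  then have "\<gamma> ` {- min d e<..<min d e} \<subseteq> W" using d(2) by blast
  then show thesis by (intro that[of "min d e"]) (use d assms in auto)
qed

lemma smooth_on_line: "open I \<Longrightarrow> smooth_on I (\<lambda>s::real. y + s *\<^sub>R u)"
  by (intro smooth_on_add smooth_on_scaleR smooth_on_const smooth_on_ident)

lemma has_vector_derivative_line: "((\<lambda>s. y + s *\<^sub>R u) has_vector_derivative u) (at s)"
  unfolding has_vector_derivative_def by (auto intro!: derivative_eq_intros)

lemma tangent_setI:
  assumes "e > 0" "smooth_on {- e<..<e} \<gamma>" "\<gamma> ` {- e<..<e} \<subseteq> S" "\<gamma> 0 = p"
    "(\<gamma> has_vector_derivative v) (at 0)"
  shows "v \<in> tangent_set S p"
  unfolding tangent_set_def using assms by blast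

lemma tangent_setE:
  assumes "v \<in> tangent_set S p" "open W" "p \<in> W"
  obtains \<gamma> e where "e > 0" "smooth_on {- e<..<e} \<gamma>" "\<gamma> ` {- e<..<e} \<subseteq> S \<inter> W" "\<gamma> 0 = p"
    "(\<gamma> has_vector_derivative v) (at 0)"
proof -
  obtain \<gamma> e where g: "e > 0" "smooth_on {- e<..<e} \<gamma>" "\<gamma> ` {- e<..<e} \<subseteq> S" "\<gamma> 0 = p"
    "(\<gamma> has_vector_derivative v) (at 0)"
    using assms(1) unfolding tangent_set_def by blast
  obtain d where d: "0 < d" "d \<le> e" "\<gamma> ` {- d<..<d} \<subseteq> W"
    using curve_stays_in_open[OF g(1) smooth_on_continuous[OF g(2)] assms(2)] g(4) assms(3) by blast
  have "{- d<..<d} \<subseteq> {- e<..<e}" using d by auto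
  then show thesis
    using that[OF d(1) smooth_on_subset[OF g(2)] _ g(4,5)] d(3) g(3) by blast
qed

lemma tangent_set_map:
  fixes S :: "'v::euclidean_space set"
  assumes v: "v \<in> tangent_set S p" and W: "open W" "p \<in> W"
    and F: "smooth_on W F" "F ` (S \<inter> W) \<subseteq> T"
  shows "frechet_derivative F (at p) v \<in> tangent_set T (F p)"
proof -
  obtain \<gamma> e where g: "e > 0" "smooth_on {- e<..<e} \<gamma>" "\<gamma> ` {- e<..<e} \<subseteq> S \<inter> W" "\<gamma> 0 = p"
    "(\<gamma> has_vector_derivative v) (at 0)"
    using tangent_setE[OF v W] by blast
  show ?thesis
  proof (rule tangent_setI[OF g(1)])
    show "smooth_on {- e<..<e} (\<lambda>s. F (\<gamma> s))"
      by (rule smooth_on_compose[OF _ W(1) _ F(1) g(2)]) (use g(3) in auto)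
    show "((\<lambda>s. F (\<gamma> s)) has_vector_derivative frechet_derivative F (at p) v) (at 0)"
      using has_vector_derivative_compose_frechet[of F \<gamma> 0 v] smooth_on_differentiable[OF F(1) W(2)] g
      by simp
    show "(\<lambda>s. F (\<gamma> s)) ` {- e<..<e} \<subseteq> T"
      using g(3) F(2) by (simp add: image_subset_iff)
  qed (use g in auto)
qed

lemma tangent_set_UNIV: "u \<in> tangent_set UNIV p"
  by (rule tangent_setI[of 1 "\<lambda>s. p + s *\<^sub>R u"])
    (auto intro: smooth_on_line has_vector_derivative_line)

lemma frechet_derivative_in_tangent_set:
  fixes F :: "'v::euclidean_space \<Rightarrow> 'w::real_normed_vector"
  assumes "open W" "y \<in> W" "smooth_on W F" "F ` W \<subseteq> S"
  shows "frechet_derivative F (at y) u \<in> tangent_set S (F y)"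
  by (rule tangent_set_map[OF tangent_set_UNIV]) (use assms in auto)

lemma differentiable_form_k_vector:
  assumes W: "open W" "y \<in> W" and l: "\<And>z. z \<in> W \<Longrightarrow> k_covector (l z)"
    and diff: "\<And>v. (\<lambda>z. l z (wedge v)) differentiable at y"
    and c: "c \<in> k_vectors"
  shows "(\<lambda>z. l z c) differentiable at y"
proof -
  \<comment> \<open>The induction also carries membership in the span, as l is additive on
    \<open>k_vectors\<close> only.\<close>
  have "c \<in> span simple_vectors \<and> (\<lambda>z. l z c) differentiable at y"
    using c[unfolded k_vectors_def]
  proof (induction rule: span_induct_alt)
    case base
    have "l z 0 = 0" if "z \<in> W" for z
      using k_covector_sum[OF l[OF that], of "{}"] by simp
    then have "((\<lambda>z. l z 0) has_derivative (\<lambda>_. 0)) (at y)"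
      using has_derivative_transform_within_open[OF has_derivative_const W, of 0 "\<lambda>z. l z 0"] by simp
    then show ?case by (auto intro: differentiableI span_zero)
  next
    case (step t x d)
    obtain v where v: "x = wedge v" using step by (auto simp: simple_vectors_def)
    have "x \<in> k_vectors" "t *\<^sub>R x \<in> k_vectors" "d \<in> k_vectors"
      using step unfolding k_vectors_def by (auto intro: span_base span_scale)
    then have eq: "t * l z x + l z d = l z (t *\<^sub>R x + d)" if "z \<in> W" for z
      using l[OF that] unfolding k_covector_def by simp
    have "(\<lambda>z. t * l z x + l z d) differentiable at y"
      using diff[of v] step.IH v by (intro derivative_intros) auto
    then obtain D where "((\<lambda>z. t * l z x + l z d) has_derivative D) (at y)"
      unfolding differentiable_def by blast
    then have "((\<lambda>z. l z (t *\<^sub>R x + d)) has_derivative D) (at y)"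
      by (rule has_derivative_transform_within_open[OF _ W]) (rule eq)
    then show ?case using \<open>t *\<^sub>R x \<in> k_vectors\<close> \<open>d \<in> k_vectors\<close>
      unfolding k_vectors_def by (auto intro: differentiableI span_add)
  qed
  then show ?thesis by blast
qed

section \<open>The unit bundle of a density over an open set of coordinates\<close>

locale coord_density =
  fixes U :: "(real ^ 'n::finite) set" and ph :: "(real ^ 'n) \<times> ('n, 'k::finite) tensor \<Rightarrow> real"
  assumes open_U: "open U"
    and smooth_ph: "smooth_map_on (U \<times> (simple_vectors - {0})) ph"
    and ph_pos: "\<And>\<xi> a. \<xi> \<in> U \<Longrightarrow> a \<in> simple_vectors \<Longrightarrow> a \<noteq> 0 \<Longrightarrow> ph (\<xi>, a) > 0"
    and ph_scale: "\<And>\<xi> a t. \<xi> \<in> U \<Longrightarrow> a \<in> simple_vectors \<Longrightarrow> ph (\<xi>, t *\<^sub>R a) = \<bar>t\<bar> * ph (\<xi>, a)"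
begin

definition S :: "((real ^ 'n) \<times> ('n, 'k) tensor) set" where
  "S = {(\<xi>, a). \<xi> \<in> U \<and> a \<in> simple_vectors \<and> ph (\<xi>, a) = 1}"

definition normalise :: "(real ^ 'n) \<times> ('n, 'k) tensor \<Rightarrow> ('n, 'k) tensor" where
  "normalise y = (1 / ph y) *\<^sub>R snd y"

lemma S_nonzero: "(\<xi>, a) \<in> S \<Longrightarrow> a \<noteq> 0"
  using ph_scale[of \<xi> a 0] by (auto simp: S_def)

lemma S_subset: "S \<subseteq> U \<times> (simple_vectors - {0})"
  using S_nonzero by (auto simp: S_def)

lemma normalise_in_S:
  "\<xi> \<in> U \<Longrightarrow> a \<in> simple_vectors \<Longrightarrow> a \<noteq> 0 \<Longrightarrow> (\<xi>, normalise (\<xi>, a)) \<in> S"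
  using ph_pos[of \<xi> a] by (simp add: S_def normalise_def simple_vectors_scaleR ph_scale)

lemma normalise_scaleR:
  "(\<xi>, a) \<in> S \<Longrightarrow> c > 0 \<Longrightarrow> normalise (\<xi>, c *\<^sub>R a) = a"
  by (simp add: S_def normalise_def ph_scale)

lemma smooth_on_ph:
  fixes F :: "'v::real_normed_vector \<Rightarrow> _"
  assumes "open W" "smooth_on W F" "F ` W \<subseteq> U \<times> (simple_vectors - {0})"
  shows "smooth_on W (\<lambda>z. ph (F z))"
  by (rule smooth_map_on_compose[OF assms smooth_ph])

lemma smooth_on_normalise:
  fixes F :: "'v::real_normed_vector \<Rightarrow> _"
  assumes "open W" "smooth_on W F" "F ` W \<subseteq> U \<times> (simple_vectors - {0})"
  shows "smooth_on W (\<lambda>z. normalise (F z))"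
proof -
  have "ph (F z) \<noteq> 0" if "z \<in> W" for z
    using assms(3) that ph_pos[of "fst (F z)" "snd (F z)"] by (force simp: image_subset_iff mem_Times_iff)
  then show ?thesis
    unfolding normalise_def
    by (intro smooth_on_scaleR smooth_on_divide smooth_on_ph smooth_on_const smooth_on_snd assms)
qed

definition is_retraction where
  "is_retraction y0 W r \<longleftrightarrow> open W \<and> y0 \<in> W \<and> W \<subseteq> U \<times> UNIV \<and> smooth_on W r \<and> r ` W \<subseteq> S \<and>
     (\<forall>y\<in>W. fst (r y) = fst y) \<and> (\<forall>y\<in>W \<inter> S. r y = y)"

text \<open>Choose J with \<open>a0 $ J\<close> nonzero and normalise \<open>simple_proj J\<close>.
  On \<open>S\<close> the latter multiplies by an even power of coordinate J, which is positive, so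
  normalising returns the vector itself and not its negative.\<close>

lemma retraction_exists:
  assumes "y0 \<in> S"
  shows "\<exists>W r. is_retraction y0 W r"
proof -
  obtain \<xi>0 a0 where y0: "y0 = (\<xi>0, a0)" by (cases y0)
  have "a0 \<noteq> 0" using assms S_nonzero y0 by simp
  then obtain J where J: "a0 $ J \<noteq> 0" by (metis vec_eq_iff zero_index)
  \<comment> \<open>Where \<open>simple_proj J\<close> is nonzero, the normalisation is smooth and
    lands in \<open>S\<close>. A point of \<open>S\<close> lies in W exactly if its coordinate J is
    nonzero.\<close>
  define W where "W = (U \<times> UNIV) \<inter> (\<lambda>y. simple_proj J (snd y)) -` (- {0})"
  define r where "r y = (fst y, normalise (fst y, simple_proj J (snd y)))" for y
  have oU: "open (U \<times> (UNIV :: ('n, 'k) tensor set))" by (intro open_Times open_U open_UNIV)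
  have sP: "smooth_on (U \<times> (UNIV :: ('n, 'k) tensor set)) (\<lambda>y. simple_proj J (snd y))"
    by (intro smooth_on_simple_proj smooth_on_snd smooth_on_ident oU)
  have oW: "open W"
    unfolding W_def by (intro continuous_open_preimage smooth_on_continuous sP oU) auto
  have WU: "W \<subseteq> U \<times> UNIV" by (auto simp: W_def)
  have sr: "smooth_on W r"
    unfolding r_def
    by (intro smooth_on_Pair smooth_on_normalise smooth_on_fst smooth_on_ident oW
        smooth_on_subset[OF sP WU])
      (auto simp: W_def simple_proj_in_simple)
  have rS: "r ` W \<subseteq> S"
    by (auto simp: r_def W_def simple_proj_in_simple intro!: normalise_in_S)
  have "y \<in> W \<longleftrightarrow> snd y $ J \<noteq> 0" "snd y $ J \<noteq> 0 \<Longrightarrow> r y = y" if y: "y \<in> S" for y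
  proof -
    obtain \<xi> a where e: "y = (\<xi>, a)" by (cases y)
    have a: "a \<in> simple_vectors" "a \<noteq> 0" "\<xi> \<in> U"
      using y S_subset unfolding e by auto
    show "y \<in> W \<longleftrightarrow> snd y $ J \<noteq> 0"
      using a by (auto simp: W_def e simple_proj_simple)
    show "r y = y" if "snd y $ J \<noteq> 0"
      using normalise_scaleR[of \<xi> a "(a $ J) ^ (2 * CARD('k))"] y that a
      by (simp add: r_def e simple_proj_simple zero_less_power_eq)
  qed
  then have "is_retraction y0 W r"
    unfolding is_retraction_def using oW WU sr rS J assms y0 by (auto simp: r_def)
  then show ?thesis by blast
qed

lemma retractionD:
  assumes "is_retraction y0 W r"
  shows "open W" "y0 \<in> W" "W \<subseteq> U \<times> UNIV" "smooth_on W r" "r ` W \<subseteq> S"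
    "y \<in> W \<Longrightarrow> r y \<in> S" "y \<in> W \<Longrightarrow> fst (r y) = fst y" "y \<in> W \<Longrightarrow> y \<in> S \<Longrightarrow> r y = y"
  using assms unfolding is_retraction_def by auto

text \<open>Differentiate \<open>r (\<gamma> s) = \<gamma> s\<close> along a curve in
  \<open>S\<close>.\<close>

lemma retraction_derivative_tangent:
  assumes r: "is_retraction y0 W r" and v: "v \<in> tangent_set S y0"
  shows "frechet_derivative r (at y0) v = v"
proof -
  note r' = retractionD[OF r]
  obtain \<gamma> e where g: "e > 0" "smooth_on {- e<..<e} \<gamma>" "\<gamma> ` {- e<..<e} \<subseteq> S \<inter> W" "\<gamma> 0 = y0"
    "(\<gamma> has_vector_derivative v) (at 0)"
    using tangent_setE[OF v r'(1,2)] by blast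
  have "\<gamma> s = r (\<gamma> s)" if "s \<in> {- e<..<e}" for s
    using that g(3) r'(8)[of "\<gamma> s"] by (simp add: image_subset_iff)
  then have "((\<lambda>s. r (\<gamma> s)) has_vector_derivative v) (at 0)"
    using g(1) by (intro has_vector_derivative_transform_within_open[OF g(5), of "{- e<..<e}"]) auto
  then show ?thesis
    using frechet_derivative_along_curve[of r \<gamma> 0 v v] smooth_on_differentiable[OF r'(4,2)] g by auto
qed

lemma retraction_derivative_fst:
  assumes r: "is_retraction y0 W r" and y: "y \<in> W"
  shows "fst (frechet_derivative r (at y) v) = fst v"
proof -
  note r' = retractionD[OF r]
  have "((\<lambda>z. fst (r z)) has_derivative (\<lambda>v. fst (frechet_derivative r (at y) v))) (at y)"
    by (intro has_derivative_fst smooth_on_has_derivative[OF r'(4) y])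
  then have "(fst has_derivative (\<lambda>v. fst (frechet_derivative r (at y) v))) (at y)"
    by (rule has_derivative_transform_within_open[OF _ r'(1) y]) (rule r'(7))
  from has_derivative_unique[OF this has_derivative_fst[OF has_derivative_ident]]
  show ?thesis by (rule fun_cong)
qed

text \<open>In a bundle chart the projection to the base is \<open>fst\<close>, so this is the
  covector composed with the derivative of the projection.\<close>

definition coord_form where
  "coord_form l = (\<lambda>y (u :: 'k \<Rightarrow> (real ^ 'n) \<times> ('n, 'k) tensor). l y (wedge (\<lambda>i. fst (u i))))"

lemma smooth_on_retract_form:
  assumes r: "is_retraction y0 W r" and l: "smooth_map_on (U \<times> (simple_vectors - {0})) (\<lambda>y. l y (wedge v))"
  shows "smooth_on W (\<lambda>y. l (r y) (wedge v))"
  by (rule smooth_map_on_compose[OF _ _ _ l]) (use retractionD[OF r] S_subset in auto)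

text \<open>Near \<open>y0\<close> the pullback of \<Omega> by r is the form on the right: Dr sends
  every vector to a velocity in \<open>S\<close>, where \<Omega> is prescribed, and keeps the base
  component, which is all that \<open>coord_form\<close> reads. At \<open>y0\<close> itself Dr fixes
  the tangent vectors u, so naturality of the exterior derivative gives the left side.\<close>

lemma ext_deriv_extension:
  assumes r: "is_retraction y0 W r" and y0: "y0 \<in> S"
    and V: "open V" "y0 \<in> V" and alt: "\<And>y. y \<in> V \<Longrightarrow> alternating_form (\<Omega> y)"
    and smooth: "\<And>u. smooth_on V (\<lambda>y. \<Omega> y u)"
    and ext: "\<And>y u. y \<in> S \<inter> V \<Longrightarrow> (\<And>i. u i \<in> tangent_set S y) \<Longrightarrow> \<Omega> y u = coord_form l y u"
    and u: "\<And>i. u i \<in> tangent_set S y0"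
  shows "ext_deriv \<Omega> y0 u = ext_deriv (\<lambda>y. coord_form l (r y)) y0 u"
proof -
  note r' = retractionD[OF r]
  have r0: "r y0 = y0" using r' y0 by simp
  define Z where "Z = W \<inter> r -` V"
  have Z: "open Z" "y0 \<in> Z"
    unfolding Z_def using r' V r0 by (auto intro!: continuous_open_preimage smooth_on_continuous)
  have "ext_deriv (\<lambda>y. coord_form l (r y)) y0 u =
      ext_deriv (\<lambda>z u. \<Omega> (r z) (\<lambda>j. frechet_derivative r (at z) (u j))) y0 u"
  proof (rule ext_deriv_cong_open[OF Z, symmetric])
    fix z and u :: "'k \<Rightarrow> (real ^ 'n) \<times> ('n, 'k) tensor"
    assume z: "z \<in> Z"
    have "\<Omega> (r z) (\<lambda>j. frechet_derivative r (at z) (u j)) =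
        coord_form l (r z) (\<lambda>j. frechet_derivative r (at z) (u j))"
      using z r' by (intro ext frechet_derivative_in_tangent_set[of W]) (auto simp: Z_def)
    also have "\<dots> = coord_form l (r z) u"
      using z by (simp add: coord_form_def Z_def retraction_derivative_fst[OF r])
    finally show "\<Omega> (r z) (\<lambda>j. frechet_derivative r (at z) (u j)) = coord_form l (r z) u" .
  qed
  also have "\<dots> = ext_deriv \<Omega> (r y0) (\<lambda>i. frechet_derivative r (at y0) (u i))"
    by (rule ext_deriv_pullback[OF r'(1,2,4) V(1)])
      (use V r0 alt smooth in \<open>auto intro: smooth_on_differentiable\<close>)
  also have "\<dots> = ext_deriv \<Omega> y0 u"
    by (simp add: r0 retraction_derivative_tangent[OF r u])
  finally show ?thesis by simp
qed

text \<open>The conditions on a Legendre map in a chart, with the algebraic ones taken on the unit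
  bundle; the value 1 is the square of the density there.\<close>

definition legendre :: "((real ^ 'n) \<times> ('n, 'k) tensor \<Rightarrow> ('n, 'k) tensor \<Rightarrow> real) \<Rightarrow> bool" where
  "legendre l \<longleftrightarrow> (\<forall>y\<in>S. k_covector (l y)) \<and>
     (\<forall>v. smooth_map_on (U \<times> (simple_vectors - {0})) (\<lambda>y. l y (wedge v))) \<and>
     (\<forall>y\<in>S. l y (snd y) = 1) \<and>
     (\<forall>y\<in>S. \<forall>c\<in>tangent_set {a \<in> simple_vectors. ph (fst y, a) = 1} (snd y). l y c = 0)"

text \<open>Decompose \<open>\<beta>\<close> into its radial part and a curve in the unit fibre.\<close>

lemma legendre_velocity:
  assumes y: "(\<xi>, a) \<in> S" and e: "e > 0" "smooth_on {- e<..<e} \<beta>" "\<beta> ` {- e<..<e} \<subseteq> simple_vectors"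
    "\<beta> 0 = a" "(\<beta> has_vector_derivative b) (at 0)"
  obtains d where "\<And>l. legendre l \<Longrightarrow> l (\<xi>, a) b = d"
proof -
  have a: "a \<noteq> 0" "a \<in> simple_vectors" "\<xi> \<in> U" "ph (\<xi>, a) = 1"
    using y S_nonzero by (auto simp: S_def)
  obtain e' where e': "0 < e'" "e' \<le> e" "\<beta> ` {- e'<..<e'} \<subseteq> - {0}"
    using curve_stays_in_open[OF e(1) smooth_on_continuous[OF e(2)], of "- {0}"] a e(4) by auto
  define I where "I = {- e'<..<e'}"
  have I: "open I" "0 \<in> I" "smooth_on I \<beta>" "\<beta> ` I \<subseteq> simple_vectors - {0}"
  proof -
    have "I \<subseteq> {- e<..<e}" using e' by (auto simp: I_def)
    then show "smooth_on I \<beta>" "\<beta> ` I \<subseteq> simple_vectors - {0}"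
      using e e' by (auto simp: I_def intro: smooth_on_subset)
  qed (use e' in \<open>auto simp: I_def\<close>)
  define g where "g s = 1 / ph (\<xi>, \<beta> s)" for s
  have sp: "smooth_on I (\<lambda>s. (\<xi>, \<beta> s))"
    by (intro smooth_on_Pair smooth_on_const I)
  have img: "(\<lambda>s. (\<xi>, \<beta> s)) ` I \<subseteq> U \<times> (simple_vectors - {0})" using I a by auto
  have pos: "ph (\<xi>, \<beta> s) > 0" if "s \<in> I" for s using img that a by (auto intro!: ph_pos)
  have sg: "smooth_on I g"
    unfolding g_def using pos by (intro smooth_on_divide smooth_on_const smooth_on_ph sp img I) fastforce
  \<comment> \<open>As g is the reciprocal of \<open>ph\<close> along \<beta> and
    \<open>g 0 = 1\<close>, this is the derivative of \<open>ph\<close> along \<beta>. It depends on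
    the density and not on l, so all Legendre maps agree on b.\<close>
  define d where "d = - vector_derivative g (at 0)"
  have g0: "g 0 = 1" using a e by (simp add: g_def)
  have dg: "(g has_vector_derivative - d) (at 0)"
  proof -
    have "g differentiable at 0" by (rule smooth_on_differentiable[OF sg I(2)])
    then show ?thesis by (simp add: d_def vector_derivative_works[symmetric])
  qed
  have "b + (- d) *\<^sub>R a \<in> tangent_set {a \<in> simple_vectors. ph (\<xi>, a) = 1} a"
  proof (rule tangent_setI[OF e'(1)])
    show "smooth_on {- e'<..<e'} (\<lambda>s. g s *\<^sub>R \<beta> s)"
      using I sg by (fold I_def) (intro smooth_on_scaleR)
    show "(\<lambda>s. g s *\<^sub>R \<beta> s) ` {- e'<..<e'} \<subseteq> {a \<in> simple_vectors. ph (\<xi>, a) = 1}"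
    proof (fold I_def, safe)
      fix s assume s: "s \<in> I"
      then have "\<beta> s \<in> simple_vectors" using I by auto
      then show "g s *\<^sub>R \<beta> s \<in> simple_vectors" "ph (\<xi>, g s *\<^sub>R \<beta> s) = 1"
        using pos[OF s] a by (simp_all add: simple_vectors_scaleR ph_scale g_def)
    qed
    show "((\<lambda>s. g s *\<^sub>R \<beta> s) has_vector_derivative b + (- d) *\<^sub>R a) (at 0)"
      using bounded_bilinear.has_vector_derivative[OF bounded_bilinear_scaleR dg e(5)]
      by (simp add: g0 e(4))
  qed (simp add: g0 e)
  then have 0: "l (\<xi>, a) (b + (- d) *\<^sub>R a) = 0" if "legendre l" for l
    using that y unfolding legendre_def by force
  have "\<forall>\<^sub>F t in nhds 0. \<beta> t \<in> k_vectors"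
    unfolding eventually_nhds using I simple_in_k_vectors by (intro exI[of _ I]) auto
  \<comment> \<open>Additivity of l applies only once b is known to be a k-vector.\<close>
  then have bk: "b \<in> k_vectors" by (rule has_vector_derivative_in_k_vectors[OF e(5)])
  have ak: "a \<in> k_vectors" "(- d) *\<^sub>R a \<in> k_vectors"
    using a by (auto intro!: simple_in_k_vectors simple_vectors_scaleR simp del: scaleR_minus_left)
  show thesis
  proof (rule that)
    fix l assume l: "legendre l"
    then have "k_covector (l (\<xi>, a))" "l (\<xi>, a) a = 1" using y unfolding legendre_def by force+
    then have "l (\<xi>, a) (b + (- d) *\<^sub>R a) = l (\<xi>, a) b + (- d) * 1"
      using bk ak unfolding k_covector_def by (simp del: scaleR_minus_left)
    then show "l (\<xi>, a) b = d" using 0[OF l] by simp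
  qed
qed

end

section \<open>The difference of two Legendre maps\<close>

locale legendre_pair = coord_density U ph
  for U :: "(real ^ 'n::finite) set" and ph :: "(real ^ 'n) \<times> ('n, 'k::finite) tensor \<Rightarrow> real" +
  fixes l l' :: "(real ^ 'n) \<times> ('n, 'k) tensor \<Rightarrow> ('n, 'k) tensor \<Rightarrow> real"
  assumes legendre_l: "legendre l" and legendre_l': "legendre l'"
begin

definition h where "h y c = l y c - l' y c"

lemma h_covector: "y \<in> S \<Longrightarrow> k_covector (h y)"
  using legendre_l legendre_l' unfolding h_def legendre_def by (auto intro: k_covector_diff)

lemma h_radial: "y \<in> S \<Longrightarrow> h y (snd y) = 0"
  using legendre_l legendre_l' unfolding h_def legendre_def by auto

lemma h_velocity:
  assumes "(\<xi>, a) \<in> S" "e > 0" "smooth_on {- e<..<e} \<beta>" "\<beta> ` {- e<..<e} \<subseteq> simple_vectors"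
    "\<beta> 0 = a" "(\<beta> has_vector_derivative b) (at 0)"
  shows "h (\<xi>, a) b = 0"
  using legendre_velocity[OF assms] legendre_l legendre_l' unfolding h_def by (metis diff_self)

text \<open>By \<open>wedge_replace_line\<close> the straight line through a in the direction of
  this product stays in the cone, so the product is a velocity at a. Dividing the parameter by c
  accounts for a being a multiple of \<open>wedge e\<close>.\<close>

lemma h_plane:
  assumes a: "(\<xi>, a) \<in> S" "a = c *\<^sub>R wedge e"
  shows "h (\<xi>, a) (wedge ((\<lambda>j. \<Sum>m\<in>UNIV. \<tau> j $ m *\<^sub>R e m)(i := w))) = 0"
proof -
  define z where "z = wedge ((\<lambda>j. \<Sum>m\<in>UNIV. \<tau> j $ m *\<^sub>R e m)(i := w))"
  have c: "c \<noteq> 0" using a S_nonzero[of \<xi> a] by auto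
  have "a + s *\<^sub>R z \<in> simple_vectors" for s
  proof -
    have "a + s *\<^sub>R z = c *\<^sub>R (wedge e + (s / c) *\<^sub>R z)"
      using c by (simp add: a(2) scaleR_add_right)
    also have "\<dots> \<in> simple_vectors"
      unfolding z_def by (rule simple_vectors_scaleR[OF wedge_replace_line])
    finally show ?thesis .
  qed
  then have "h (\<xi>, a) z = 0"
    by (intro h_velocity[OF a(1), of 1 "\<lambda>s. a + s *\<^sub>R z"])
      (auto intro: smooth_on_line has_vector_derivative_line)
  then show ?thesis by (simp add: z_def)
qed

lemma h_retract_differentiable:
  assumes r: "is_retraction y0 W r" and y: "y \<in> W"
  shows "(\<lambda>z. h (r z) (wedge v)) differentiable at y"
proof -
  have "smooth_on W (\<lambda>z. h (r z) (wedge v))"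
    using legendre_l legendre_l' unfolding h_def legendre_def
    by (intro smooth_on_diff smooth_on_retract_form[OF r] retractionD(1)[OF r]) auto
  then show ?thesis using y by (rule smooth_on_differentiable)
qed

lemma h_retract_k_differentiable:
  assumes r: "is_retraction y0 W r" and y: "y \<in> W" and c: "c \<in> k_vectors"
  shows "(\<lambda>z. h (r z) c) differentiable at y"
  by (rule differentiable_form_k_vector[OF retractionD(1)[OF r] y h_covector h_retract_differentiable[OF r y] c])
    (rule retractionD(6)[OF r])

text \<open>Differentiate \<open>h (\<gamma> s) (\<alpha> s) = 0\<close> along a curve \<open>\<gamma> = (\<xi>, \<alpha>)\<close> in the unit bundle: the other
  term is \<open>h y0\<close> on the velocity of a curve of simple vectors.\<close>

lemma h_radial_derivative:
  assumes r: "is_retraction y0 W r" and y0: "y0 \<in> S" and w: "w \<in> tangent_set S y0"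
  shows "frechet_derivative (\<lambda>y. h (r y) (snd y0)) (at y0) w = 0"
proof -
  note r' = retractionD[OF r]
  obtain \<xi>0 a0 where y0_eq: "y0 = (\<xi>0, a0)" by (cases y0)
  obtain \<gamma> e where g: "e > 0" "smooth_on {- e<..<e} \<gamma>" "\<gamma> ` {- e<..<e} \<subseteq> S \<inter> W" "\<gamma> 0 = y0"
    "(\<gamma> has_vector_derivative w) (at 0)"
    using tangent_setE[OF w r'(1,2)] by blast
  define I where "I = {- e<..<e}"
  have I: "open I" "0 \<in> I" using g(1) by (auto simp: I_def)
  have \<gamma>: "\<gamma> s \<in> S" "\<gamma> s \<in> W" "r (\<gamma> s) = \<gamma> s" if "s \<in> I" for s
    using that g(3) r'(8)[of "\<gamma> s"] by (auto simp: I_def image_subset_iff)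
  define \<alpha> where "\<alpha> s = snd (\<gamma> s)" for s
  have \<alpha>: "\<alpha> s \<in> simple_vectors" if "s \<in> I" for s
    using \<gamma>(1)[OF that] by (auto simp: \<alpha>_def S_def)
  have \<alpha>k: "\<alpha> s \<in> k_vectors" if "s \<in> I" for s
    by (rule simple_in_k_vectors[OF \<alpha>[OF that]])
  have d\<alpha>: "(\<alpha> has_vector_derivative snd w) (at 0)"
    unfolding \<alpha>_def by (rule bounded_linear.has_vector_derivative[OF bounded_linear_snd g(5)])
  have s\<alpha>: "smooth_on I \<alpha>"
    unfolding \<alpha>_def using g(2) by (intro smooth_on_snd I) (simp add: I_def)
  have wk: "snd w \<in> k_vectors"
    by (rule has_vector_derivative_in_k_vectors[OF d\<alpha>])
      (use I \<alpha>k in \<open>auto simp: eventually_nhds intro!: exI[of _ I]\<close>)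
  \<comment> \<open>The base point moves along \<gamma>, so \<alpha> may leave the unit fibre over
    \<open>\<xi>0\<close>. It stays in the cone, which is what \<open>h_velocity\<close> asks
    for.\<close>
  have hw: "h y0 (snd w) = 0"
    unfolding y0_eq by (rule h_velocity[of _ _ e \<alpha>])
      (use g \<alpha> s\<alpha> d\<alpha> y0 in \<open>auto simp: y0_eq I_def \<alpha>_def\<close>)
  obtain B :: "('n, 'k) tensor set" where B: "finite B" "B \<subseteq> k_vectors"
    "\<And>c. c \<in> k_vectors \<Longrightarrow> (\<Sum>b\<in>B. (c \<bullet> b) *\<^sub>R b) = c"
    using k_vectors_expansion by blast
  \<comment> \<open>Covector and argument both move along \<gamma>. In the fixed basis B their
    pairing is a finite sum of products of real functions, open to the product rule.\<close>
  have exp: "(\<Sum>b\<in>B. (c \<bullet> b) * h y b) = h y c" if "y \<in> S" "c \<in> k_vectors" for y c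
    using k_covector_sum[OF h_covector[OF that(1)] B(1,2), of "\<lambda>b. c \<bullet> b"] B(3)[OF that(2)] by simp
  define X where "X c = frechet_derivative (\<lambda>y. h (r y) c) (at y0) w" for c
  have X: "((\<lambda>s. h (r (\<gamma> s)) c) has_vector_derivative X c) (at 0)" if "c \<in> k_vectors" for c
    using has_vector_derivative_compose_frechet[of "\<lambda>y. h (r y) c" \<gamma> 0 w]
      h_retract_k_differentiable[OF r r'(2) that] g(4,5) by (simp add: X_def)
  have a0: "snd y0 \<in> k_vectors" using \<alpha>k[OF I(2)] g(4) by (simp add: \<alpha>_def)
  have XB: "((\<lambda>s. h (r (\<gamma> s)) b) has_vector_derivative X b) (at 0)" if "b \<in> B" for b
    using X B(2) that by blast
  have "((\<lambda>s. \<Sum>b\<in>B. (\<alpha> s \<bullet> b) * h (r (\<gamma> s)) b) has_vector_derivative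
      (\<Sum>b\<in>B. (\<alpha> 0 \<bullet> b) * X b + (snd w \<bullet> b) * h (r (\<gamma> 0)) b)) (at 0)"
    by (intro has_vector_derivative_sum bounded_bilinear.has_vector_derivative[OF bounded_bilinear_mult]
        bounded_linear.has_vector_derivative[OF bounded_linear_inner_left d\<alpha>] XB)
  moreover have "(\<Sum>b\<in>B. (\<alpha> s \<bullet> b) * h (r (\<gamma> s)) b) = 0" if "s \<in> I" for s
    using exp[OF \<gamma>(1) \<alpha>k] h_radial[OF \<gamma>(1)] \<gamma>(3) that by (simp add: \<alpha>_def)
  ultimately have "((\<lambda>s. 0) has_vector_derivative
      (\<Sum>b\<in>B. (\<alpha> 0 \<bullet> b) * X b + (snd w \<bullet> b) * h (r (\<gamma> 0)) b)) (at 0)"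
    by (rule has_vector_derivative_transform_within_open[OF _ I]) auto
  then have "(\<Sum>b\<in>B. (\<alpha> 0 \<bullet> b) * X b + (snd w \<bullet> b) * h (r (\<gamma> 0)) b) = 0"
    using vector_derivative_unique_at[OF _ has_vector_derivative_const] by blast
  moreover have "r (\<gamma> 0) = y0" using \<gamma>(3)[OF I(2)] g(4) by simp
  ultimately have sum0: "(\<Sum>b\<in>B. (snd y0 \<bullet> b) * X b) = 0"
    using exp[OF y0 wk] hw g(4) by (simp add: sum.distrib \<alpha>_def)
  \<comment> \<open>With the argument frozen at \<open>snd y0\<close>, the derivative is the very
    sum just found to be 0.\<close>
  have "((\<lambda>s. \<Sum>b\<in>B. (snd y0 \<bullet> b) * h (r (\<gamma> s)) b) has_vector_derivative
      (\<Sum>b\<in>B. (snd y0 \<bullet> b) * X b)) (at 0)"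
    by (intro has_vector_derivative_sum bounded_linear.has_vector_derivative[OF bounded_linear_mult_right] XB)
  then have "((\<lambda>s. h (r (\<gamma> s)) (snd y0)) has_vector_derivative (\<Sum>b\<in>B. (snd y0 \<bullet> b) * X b)) (at 0)"
    by (rule has_vector_derivative_transform_within_open[OF _ I]) (use exp[OF \<gamma>(1) a0] \<gamma>(3) in auto)
  from vector_derivative_unique_at[OF this X[OF a0]] sum0 show ?thesis by (simp add: X_def)
qed

text \<open>On the product of T with the real line the arguments become constant vector fields, so
  each term of \<open>ext_deriv_expand\<close> is the derivative of one real function along a
  straight line.\<close>

lemma ext_deriv_vanishes:
  fixes \<psi> :: "real ^ 'k \<Rightarrow> real ^ 'n" and A :: "real ^ 'k \<Rightarrow> ('n, 'k) tensor"
  assumes r: "is_retraction y0 W r" and y0: "y0 \<in> S"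
    and T: "open T" "t0 \<in> T" "smooth_on T \<psi>" "smooth_on T A"
    and TS: "\<And>t. t \<in> T \<Longrightarrow> (\<psi> t, A t) \<in> S"
    and plane: "\<And>t. t \<in> T \<Longrightarrow> \<exists>c. A t = c *\<^sub>R wedge (\<lambda>i. frechet_derivative \<psi> (at t) (axis i 1))"
    and t0: "(\<psi> t0, A t0) = y0"
    and b: "\<And>i. b i = (frechet_derivative \<psi> (at t0) (\<tau> i), frechet_derivative A (at t0) (\<tau> i))"
    and w: "w \<in> tangent_set S y0"
  shows "ext_deriv (\<lambda>y. coord_form h (r y)) y0 (case_option w b) = 0"
proof -
  note r' = retractionD[OF r]
  \<comment> \<open>For nonzero \<open>snd z\<close> this may leave \<open>S\<close>. That does no
    harm: r is applied before h, and only the first order in \<open>snd z\<close> matters.\<close>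
  define G where "G z = (\<psi> (fst z), A (fst z)) + snd z *\<^sub>R w" for z :: "(real ^ 'k) \<times> real"
  define TT where "TT = T \<times> (UNIV :: real set)"
  have oTT: "open TT" unfolding TT_def by (intro open_Times T open_UNIV)
  have sfst: "smooth_on TT (\<lambda>z. F (fst z))" if "smooth_on T F" for F :: "real ^ 'k \<Rightarrow> 'c::real_normed_vector"
    by (rule smooth_on_compose[OF oTT T(1) _ that smooth_on_fst[OF oTT smooth_on_ident[OF oTT]]]) (auto simp: TT_def)
  have sG: "smooth_on TT G"
    unfolding G_def by (intro smooth_on_add smooth_on_Pair smooth_on_scaleR smooth_on_snd smooth_on_ident
        smooth_on_const sfst T oTT)
  define D where "D = TT \<inter> G -` W"
  have oD: "open D"
    unfolding D_def by (intro continuous_open_preimage smooth_on_continuous sG oTT r')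
  have z0: "G (t0, 0) = y0" "(t0, 0) \<in> TT" "(t0, 0) \<in> D"
    using t0 T r'(2) by (auto simp: G_def D_def TT_def)
  have DG: "frechet_derivative G (at z) v =
      (frechet_derivative \<psi> (at (fst z)) (fst v), frechet_derivative A (at (fst z)) (fst v)) + snd v *\<^sub>R w"
    if "z \<in> TT" for z v
  proof -
    have fz: "fst z \<in> T" using that by (auto simp: TT_def)
    have comp: "((\<lambda>z. F (fst z)) has_derivative (\<lambda>v. frechet_derivative F (at (fst z)) (fst v))) (at z)"
      if "smooth_on T F" for F :: "real ^ 'k \<Rightarrow> 'c::real_normed_vector"
      by (rule has_derivative_compose[OF has_derivative_fst[OF has_derivative_ident] smooth_on_has_derivative[OF that fz]])
    have "(G has_derivative (\<lambda>v. (frechet_derivative \<psi> (at (fst z)) (fst v), frechet_derivative A (at (fst z)) (fst v)) + snd v *\<^sub>R w)) (at z)"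
      unfolding G_def
      by (intro has_derivative_add has_derivative_Pair comp T has_derivative_scaleR_left has_derivative_snd has_derivative_ident)
    from fun_cong[OF frechet_derivative_at[OF this]] show ?thesis by metis
  qed
  define \<Theta> where "\<Theta> = (\<lambda>y. coord_form h (r y))"
  have alt: "alternating_form (\<Theta> y)" if "y \<in> W" for y
    unfolding \<Theta>_def coord_form_def by (intro alternating_form_wedge_fst h_covector r' that)
  have diff: "(\<lambda>y. \<Theta> y u) differentiable at y" if "y \<in> W" for y u
    unfolding \<Theta>_def coord_form_def by (rule h_retract_differentiable[OF r that])
  define P where "P z u = \<Theta> (G z) (\<lambda>j. frechet_derivative G (at z) (u j))" for z u
  have P: "P z u = h (r (G z)) (wedge (\<lambda>j. frechet_derivative \<psi> (at (fst z)) (fst (u j)) + snd (u j) *\<^sub>R fst w))"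
    if "z \<in> TT" for z u
    unfolding P_def \<Theta>_def coord_form_def by (simp add: DG[OF that])
  have Pdiff: "(\<lambda>z. P z u) differentiable at (t0, 0)" for u
    unfolding P_def
    by (rule differentiableI, rule has_derivative_form_compose[where F = G and V = W and \<Omega> = \<Theta>])
      (use r' z0 alt diff in \<open>auto intro!: smooth_on_has_derivative[OF _ z0(2)] smooth_on_frechet_derivative sG\<close>)
  \<comment> \<open>Preimages under the derivative of G: (0, 1) goes to w, and (\<tau> i, 0) goes to
    \<open>b i\<close>.\<close>
  define u where "u = case_option (0 :: real ^ 'k, 1 :: real) (\<lambda>i. (\<tau> i, 0))"
  have "ext_deriv \<Theta> y0 (case_option w b) = ext_deriv P (t0, 0) u"
  proof -
    have "(\<lambda>i. frechet_derivative G (at (t0, 0)) (u i)) = case_option w b"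
    proof
      fix i
      have "frechet_derivative \<psi> (at t0) 0 = 0" "frechet_derivative A (at t0) 0 = 0"
        using T by (auto intro!: linear_0 linear_frechet_derivative smooth_on_differentiable)
      then show "frechet_derivative G (at (t0, 0)) (u i) = case_option w b i"
        by (cases i) (auto simp: DG[OF z0(2)] u_def b zero_prod_def[symmetric])
    qed
    then show ?thesis
      unfolding P_def
      using ext_deriv_pullback[OF oTT z0(2) sG r'(1), of \<Theta> u] z0 r'(2) alt diff by simp
  qed
  also have "ext_deriv P (t0, 0) u = 0"
  proof -
    have line: "frechet_derivative (\<lambda>z. P z v) (at (t0, 0)) x = 0"
      if "open I" "0 \<in> I" "((\<lambda>s. P ((t0, 0) + s *\<^sub>R x) v) has_vector_derivative 0) (at 0)" for I v x
      using frechet_derivative_along_curve[of "\<lambda>z. P z v" "\<lambda>s. (t0, 0) + s *\<^sub>R x" 0 x 0] Pdiff that(3)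
        has_vector_derivative_line[of "(t0, 0)" x 0] by simp
    have E: "frechet_derivative \<psi> (at t) x = (\<Sum>m\<in>UNIV. x $ m *\<^sub>R frechet_derivative \<psi> (at t) (axis m 1))"
      if "t \<in> T" for t x
    proof -
      have lin: "linear (frechet_derivative \<psi> (at t))"
        by (intro linear_frechet_derivative smooth_on_differentiable[OF T(3) that])
      have "x = (\<Sum>m\<in>UNIV. x $ m *\<^sub>R axis m 1)"
        using basis_expansion[of x] by (simp add: scalar_mult_eq_scaleR)
      then have "frechet_derivative \<psi> (at t) x = frechet_derivative \<psi> (at t) (\<Sum>m\<in>UNIV. x $ m *\<^sub>R axis m 1)"
        by simp
      also have "\<dots> = (\<Sum>m\<in>UNIV. x $ m *\<^sub>R frechet_derivative \<psi> (at t) (axis m 1))"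
        by (simp add: linear_sum[OF lin] linear_cmul[OF lin])
      finally show ?thesis .
    qed
    \<comment> \<open>With w absent from the arguments, the product is formed by D\<psi> at
      \<open>t0\<close> alone: it is constant along (0, 1) and a multiple of \<open>snd y0\<close>.
      What remains is the derivative of h on the fixed vector \<open>snd y0\<close> in direction
      w.\<close>
    have first: "frechet_derivative (\<lambda>z. P z (\<lambda>j. (\<tau> j, 0))) (at (t0, 0)) (0, 1) = 0"
    proof -
      define e where "e i = frechet_derivative \<psi> (at t0) (axis i 1)" for i
      obtain c where "A t0 = c *\<^sub>R wedge e"
        using plane[OF T(2)] unfolding e_def[abs_def] by blast
      then have c: "snd y0 = c *\<^sub>R wedge e" using t0 by auto
      have c0: "c \<noteq> 0" using c y0 S_nonzero[of "fst y0" "snd y0"] by (cases y0) auto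
      \<comment> \<open>The product is the determinant of the \<tau> times \<open>wedge e\<close>,
        and \<open>wedge e\<close> is \<open>snd y0\<close> divided by c.\<close>
      define k where "k = det (\<chi> i. \<tau> i) / c"
      have wd: "wedge (\<lambda>j. frechet_derivative \<psi> (at t0) (\<tau> j)) = k *\<^sub>R snd y0"
        using wedge_combination[of \<tau> e] c0 by (simp add: E[OF T(2), of "\<tau> j" for j] e_def k_def c)
      define I where "I = (\<lambda>s. y0 + s *\<^sub>R w) -` W"
      have I: "open I" "0 \<in> I"
        unfolding I_def using r' by (auto intro!: open_vimage continuous_intros)
      have y0k: "snd y0 \<in> k_vectors" using y0 by (auto simp: S_def intro: simple_in_k_vectors)
      have "((\<lambda>s. h (r (y0 + s *\<^sub>R w)) (snd y0)) has_vector_derivative 0) (at 0)"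
        using has_vector_derivative_compose_frechet[of "\<lambda>y. h (r y) (snd y0)" "\<lambda>s. y0 + s *\<^sub>R w" 0 w]
          h_retract_k_differentiable[OF r r'(2) y0k] has_vector_derivative_line[of y0 w 0]
          h_radial_derivative[OF r y0 w] by simp
      from bounded_linear.has_vector_derivative[OF bounded_linear_mult_right this, of k]
      have "((\<lambda>s. k * h (r (y0 + s *\<^sub>R w)) (snd y0)) has_vector_derivative 0) (at 0)"
        unfolding mult_zero_right .
      moreover have "k * h (r (y0 + s *\<^sub>R w)) (snd y0) = P ((t0, 0) + s *\<^sub>R (0, 1)) (\<lambda>j. (\<tau> j, 0))"
        if "s \<in> I" for s
      proof -
        have "(t0, s) \<in> TT" using T by (simp add: TT_def)
        moreover have "k_covector (h (r (y0 + s *\<^sub>R w)))"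
          using that by (intro h_covector r'(6)) (simp add: I_def)
        ultimately show ?thesis
          using y0k t0 by (simp add: P wd G_def k_covector_def)
      qed
      ultimately have "((\<lambda>s. P ((t0, 0) + s *\<^sub>R (0, 1)) (\<lambda>j. (\<tau> j, 0))) has_vector_derivative 0) (at 0)"
        by (rule has_vector_derivative_transform_within_open[OF _ I])
      then show ?thesis by (rule line[OF I])
    qed
    \<comment> \<open>Along (\<tau> m, 0) the second coordinate stays 0, so G stays in
      \<open>S\<close>, where r is the identity. The vector w fills the single slot m, and
      \<open>h_plane\<close> makes the function vanish on a whole interval of the line.\<close>
    have rest: "frechet_derivative (\<lambda>z. P z ((\<lambda>j. (\<tau> j, 0))(m := (0, 1)))) (at (t0, 0)) (\<tau> m, 0) = 0" for m
    proof -
      define I where "I = (\<lambda>s. (t0, 0) + s *\<^sub>R (\<tau> m, 0)) -` D"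
      have I: "open I" "0 \<in> I"
        unfolding I_def using oD z0(3) by (auto intro!: open_vimage continuous_intros simp: zero_prod_def[symmetric])
      have "0 = P ((t0, 0) + s *\<^sub>R (\<tau> m, 0)) ((\<lambda>j. (\<tau> j, 0))(m := (0, 1)))" if s: "s \<in> I" for s
      proof -
        define t where "t = t0 + s *\<^sub>R \<tau> m"
        have t: "t \<in> T" "(t, 0) \<in> TT" "(\<psi> t, A t) \<in> W"
          using s by (auto simp: t_def I_def D_def TT_def G_def zero_prod_def[symmetric])
        define e where "e i = frechet_derivative \<psi> (at t) (axis i 1)" for i
        obtain c where c: "A t = c *\<^sub>R wedge e"
          using plane[OF t(1)] unfolding e_def[abs_def] by blast
        have D0: "frechet_derivative \<psi> (at t) 0 = 0"
          by (intro linear_0 linear_frechet_derivative smooth_on_differentiable[OF T(3) t(1)])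
        have V: "(\<lambda>j. frechet_derivative \<psi> (at t) (fst (((\<lambda>j. (\<tau> j, 0))(m := (0, 1))) j)) +
            snd (((\<lambda>j. (\<tau> j, 0))(m := (0, 1))) j) *\<^sub>R fst w) =
          (\<lambda>j. \<Sum>m\<in>UNIV. \<tau> j $ m *\<^sub>R e m)(m := fst w)"
          by (auto simp: fun_eq_iff D0 e_def E[OF t(1), of "\<tau> j" for j])
        have rG: "r (G (t, 0)) = (\<psi> t, A t)"
          using r'(8)[OF t(3) TS[OF t(1)]] by (simp add: G_def)
        have z: "(t0, 0) + s *\<^sub>R (\<tau> m, 0) = (t, 0 :: real)" by (simp add: t_def)
        show ?thesis
          unfolding z P[OF t(2)] rG fst_conv V by (rule h_plane[OF TS[OF t(1)] c, symmetric])
      qed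
      then have "((\<lambda>s. P ((t0, 0) + s *\<^sub>R (\<tau> m, 0)) ((\<lambda>j. (\<tau> j, 0))(m := (0, 1)))) has_vector_derivative 0) (at 0)"
        by (rule has_vector_derivative_transform_within_open[OF has_vector_derivative_const I])
      then show ?thesis by (rule line[OF I])
    qed
    show ?thesis
      unfolding ext_deriv_expand by (simp add: u_def first rest)
  qed
  finally show ?thesis by (simp add: \<Theta>_def)
qed

end

section \<open>Manifolds and the bundle of tensors\<close>

lemma smooth_map_on_cong:
  assumes "smooth_map_on S f" "\<And>x. x \<in> S \<Longrightarrow> f x = g x"
  shows "smooth_map_on S g"
  using assms unfolding smooth_map_on_def by (metis IntD1)

lemma tangent_set_mono: "S \<subseteq> T \<Longrightarrow> tangent_set S p \<subseteq> tangent_set T p"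
  unfolding tangent_set_def by blast

locale manifold =
  fixes X :: "'a topology" and \<A> :: "('a, real ^ 'n::finite) chart set"
  assumes smooth_manifold: "smooth_manifold X \<A>"
begin

abbreviation \<kappa> where "\<kappa> \<equiv> chart_at \<A>"

lemma chart_at_mem: "x \<in> topspace X \<Longrightarrow> \<kappa> x \<in> \<A>" "x \<in> topspace X \<Longrightarrow> x \<in> fst (\<kappa> x)"
proof -
  assume "x \<in> topspace X"
  then have "\<exists>C. C \<in> \<A> \<and> x \<in> fst C" using smooth_manifold unfolding smooth_manifold_def by blast
  from someI_ex[OF this] show "\<kappa> x \<in> \<A>" "x \<in> fst (\<kappa> x)" by (auto simp: chart_at_def)
qed

lemma
  assumes "C \<in> \<A>"
  shows chart_openin: "openin X (fst C)" and open_chart_image: "open (snd C ` fst C)"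
    and chart_homeo: "homeomorphic_map (subtopology X (fst C)) (top_of_set (snd C ` fst C)) (snd C)"
  using assms smooth_manifold unfolding smooth_manifold_def by auto

lemma chart_subset: "C \<in> \<A> \<Longrightarrow> fst C \<subseteq> topspace X"
  using chart_openin openin_subset by blast

lemma chart_inj: "C \<in> \<A> \<Longrightarrow> inj_on (snd C) (fst C)"
  using homeomorphic_imp_injective_map[OF chart_homeo] chart_subset by (simp add: inf_absorb2)

lemma chart_inv_chart: "C \<in> \<A> \<Longrightarrow> x \<in> fst C \<Longrightarrow> chart_inv C (snd C x) = x"
  unfolding chart_inv_def by (rule inv_into_f_f[OF chart_inj])

lemma chart_chart_inv: "\<xi> \<in> snd C ` fst C \<Longrightarrow> snd C (chart_inv C \<xi>) = \<xi>"
  and chart_inv_mem: "\<xi> \<in> snd C ` fst C \<Longrightarrow> chart_inv C \<xi> \<in> fst C"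
  unfolding chart_inv_def by (auto intro: f_inv_into_f inv_into_into)

definition overlap where "overlap C D = snd C ` (fst C \<inter> fst D)"

lemma open_overlap:
  assumes "C \<in> \<A>" "D \<in> \<A>"
  shows "open (overlap C D)"
proof -
  have "openin (subtopology X (fst C)) (fst C \<inter> fst D)"
    using chart_openin assms by (simp add: openin_subtopology_Int2)
  then have "openin (top_of_set (snd C ` fst C)) (overlap C D)"
    unfolding overlap_def using homeomorphic_map_openness[OF chart_homeo[OF assms(1)]]
    by (metis openin_subset)
  then show ?thesis using open_chart_image[OF assms(1)] by (rule openin_open_trans)
qed

definition transition where "transition C D = snd D \<circ> chart_inv C"

text \<open>The change from C-coordinates to D-coordinates of tangent vectors at x. Both
  \<open>to_coords\<close> and \<open>from_coords\<close> are cases with one chart preferred, so the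
  cocycle identities are proved once for both.\<close>

definition dtr where "dtr C D x = frechet_derivative (transition C D) (at (snd C x))"

lemma to_coords_eq: "to_coords \<kappa> C x = dtr (\<kappa> x) C x"
  and from_coords_eq: "from_coords \<kappa> C x = dtr C (\<kappa> x) x"
  by (simp_all add: to_coords_def from_coords_def dtr_def transition_def)

lemma smooth_transition: "C \<in> \<A> \<Longrightarrow> D \<in> \<A> \<Longrightarrow> smooth_on (overlap C D) (transition C D)"
  using smooth_manifold unfolding smooth_manifold_def overlap_def transition_def by blast

lemma transition_chart: "C \<in> \<A> \<Longrightarrow> x \<in> fst C \<Longrightarrow> transition C D (snd C x) = snd D x"
  by (simp add: transition_def chart_inv_chart)

lemma transition_has_derivative:
  assumes "C \<in> \<A>" "D \<in> \<A>" "x \<in> fst C" "x \<in> fst D"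
  shows "(transition C D has_derivative dtr C D x) (at (snd C x))"
  unfolding dtr_def
  by (rule smooth_on_has_derivative[OF smooth_transition[OF assms(1,2)]]) (use assms in \<open>auto simp: overlap_def\<close>)

lemma linear_dtr: "C \<in> \<A> \<Longrightarrow> D \<in> \<A> \<Longrightarrow> x \<in> fst C \<Longrightarrow> x \<in> fst D \<Longrightarrow> linear (dtr C D x)"
  using transition_has_derivative has_derivative_linear by blast

lemma dtr_ident:
  assumes "C \<in> \<A>" "x \<in> fst C"
  shows "dtr C C x v = v"
proof -
  have "((\<lambda>\<xi>. \<xi>) has_derivative dtr C C x) (at (snd C x))"
    by (rule has_derivative_transform_within_open[OF transition_has_derivative open_chart_image])
      (use assms in \<open>auto simp: transition_def chart_inv_chart\<close>)
  from has_derivative_unique[OF this has_derivative_ident] show ?thesis by (rule fun_cong)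
qed

lemma dtr_compose:
  assumes "C \<in> \<A>" "D \<in> \<A>" "E \<in> \<A>" "x \<in> fst C" "x \<in> fst D" "x \<in> fst E"
  shows "dtr D E x (dtr C D x v) = dtr C E x v"
proof -
  have "((\<lambda>\<xi>. transition D E (transition C D \<xi>)) has_derivative (\<lambda>v. dtr D E x (dtr C D x v))) (at (snd C x))"
    by (rule has_derivative_compose[where f = "transition C D" and g = "transition D E"])
      (use assms transition_has_derivative in \<open>auto simp: transition_chart\<close>)
  then have "(transition C E has_derivative (\<lambda>v. dtr D E x (dtr C D x v))) (at (snd C x))"
    by (rule has_derivative_transform_within_open[OF _ open_overlap[OF assms(1,2)]])
      (use assms in \<open>auto simp: overlap_def transition_chart\<close>)
  from has_derivative_unique[OF this transition_has_derivative] assms show ?thesis by metis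
qed

lemma dtr_inverse:
  assumes "C \<in> \<A>" "D \<in> \<A>" "x \<in> fst C" "x \<in> fst D"
  shows "dtr D C x (dtr C D x v) = v"
  using dtr_compose[of C D C] dtr_ident assms by simp

lemma tensor_map_dtr_compose:
  assumes "C \<in> \<A>" "D \<in> \<A>" "E \<in> \<A>" "x \<in> fst C" "x \<in> fst D" "x \<in> fst E"
  shows "tensor_map (dtr D E x) (tensor_map (dtr C D x) T) = tensor_map (dtr C E x) T"
  using assms by (simp add: tensor_map_compose linear_dtr dtr_compose)

lemma tensor_map_dtr_inverse:
  assumes "C \<in> \<A>" "D \<in> \<A>" "x \<in> fst C" "x \<in> fst D"
  shows "tensor_map (dtr D C x) (tensor_map (dtr C D x) T) = T"
  using assms by (simp add: tensor_map_compose linear_dtr dtr_inverse tensor_map_ident)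

section \<open>Charts of the tensor bundle\<close>

lemma fst_bundle_chart: "fst (bundle_chart \<kappa> C) = fst C \<times> UNIV"
  by (simp add: bundle_chart_def)

lemma snd_bundle_chart:
  "snd (bundle_chart \<kappa> C) (x, a) = (snd C x, tensor_map (dtr (\<kappa> x) C x) a)"
  by (simp add: bundle_chart_def to_coords_eq)

lemma in_chart:
  assumes "C \<in> \<A>" "x \<in> fst C"
  shows "x \<in> topspace X" "\<kappa> x \<in> \<A>" "x \<in> fst (\<kappa> x)"
  using assms chart_subset chart_at_mem by blast+

lemma bundle_chart_inj: "C \<in> \<A> \<Longrightarrow> inj_on (snd (bundle_chart \<kappa> C)) (fst (bundle_chart \<kappa> C))"
proof (rule inj_onI, clarsimp simp: fst_bundle_chart snd_bundle_chart)
  fix x a y and b :: "('n, 'b) tensor"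
  assume C: "C \<in> \<A>" and *: "x \<in> fst C" "y \<in> fst C" "snd C x = snd C y"
    "tensor_map (dtr (\<kappa> x) C x) a = tensor_map (dtr (\<kappa> y) C y) b"
  then have xy: "x = y" using chart_inj inj_onD by metis
  have "tensor_map (dtr C (\<kappa> x) x) (tensor_map (dtr (\<kappa> x) C x) c) = c" for c :: "('n, 'b) tensor"
    by (rule tensor_map_dtr_inverse) (use C * in_chart in auto)
  then show "x = y \<and> a = b" using * xy by metis
qed

lemma bundle_chart_inv:
  assumes C: "C \<in> \<A>" and \<xi>: "\<xi> \<in> snd C ` fst C"
  shows "chart_inv (bundle_chart \<kappa> C) (\<xi>, \<alpha>) =
    (chart_inv C \<xi>, tensor_map (dtr C (\<kappa> (chart_inv C \<xi>)) (chart_inv C \<xi>)) \<alpha>)"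
  unfolding chart_inv_def[of "bundle_chart \<kappa> C"]
proof (rule inv_into_f_eq[OF bundle_chart_inj[OF C]])
  let ?x = "chart_inv C \<xi>"
  have x: "?x \<in> fst C" "snd C ?x = \<xi>" using \<xi> by (auto simp: chart_inv_mem chart_chart_inv)
  show "(?x, tensor_map (dtr C (\<kappa> ?x) ?x) \<alpha>) \<in> fst (bundle_chart \<kappa> C)"
    using x by (simp add: fst_bundle_chart)
  show "snd (bundle_chart \<kappa> C) (?x, tensor_map (dtr C (\<kappa> ?x) ?x) \<alpha>) = (\<xi>, \<alpha>)"
    unfolding snd_bundle_chart using x in_chart[OF C x(1)] C by (simp add: tensor_map_dtr_inverse)
qed

lemma bundle_chart_inv_chart:
  "C \<in> \<A> \<Longrightarrow> q \<in> fst (bundle_chart \<kappa> C) \<Longrightarrow> chart_inv (bundle_chart \<kappa> C) (snd (bundle_chart \<kappa> C) q) = q"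
  unfolding chart_inv_def[of "bundle_chart \<kappa> C"] by (rule inv_into_f_f[OF bundle_chart_inj])

lemma bundle_chart_chart_inv:
  assumes "C \<in> \<A>" "y \<in> (snd C ` fst C) \<times> UNIV"
  shows "snd (bundle_chart \<kappa> C) (chart_inv (bundle_chart \<kappa> C) y) = y"
    and "chart_inv (bundle_chart \<kappa> C) y \<in> fst (bundle_chart \<kappa> C)"
proof -
  obtain \<xi> \<alpha> where y: "y = (\<xi>, \<alpha>)" "\<xi> \<in> snd C ` fst C" using assms by auto
  let ?x = "chart_inv C \<xi>"
  have x: "?x \<in> fst C" "snd C ?x = \<xi>" using y by (auto simp: chart_inv_mem chart_chart_inv)
  show "chart_inv (bundle_chart \<kappa> C) y \<in> fst (bundle_chart \<kappa> C)"
    using x by (simp add: y bundle_chart_inv[OF assms(1) y(2)] fst_bundle_chart)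
  show "snd (bundle_chart \<kappa> C) (chart_inv (bundle_chart \<kappa> C) y) = y"
    unfolding y(1) bundle_chart_inv[OF assms(1) y(2)] snd_bundle_chart
    using x in_chart[OF assms(1) x(1)] assms(1) by (simp add: tensor_map_dtr_inverse)
qed

lemma bundle_chart_image: "C \<in> \<A> \<Longrightarrow> snd (bundle_chart \<kappa> C) ` fst (bundle_chart \<kappa> C) = (snd C ` fst C) \<times> UNIV"
proof safe
  fix x \<alpha>
  assume "C \<in> \<A>" "x \<in> fst C"
  then show "(snd C x, \<alpha>) \<in> snd (bundle_chart \<kappa> C) ` fst (bundle_chart \<kappa> C)"
    using bundle_chart_chart_inv[of C "(snd C x, \<alpha>)"]
    by (intro image_eqI[of _ _ "chart_inv (bundle_chart \<kappa> C) (snd C x, \<alpha>)"]) auto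
qed (auto simp: fst_bundle_chart snd_bundle_chart)

text \<open>Fibre coordinates refer to the preferred chart of x, which may jump with x. The cocycle
  identity removes it from the change of bundle charts, which is then the base transition together
  with the tensor power of its derivative.\<close>

lemma smooth_bundle_transition:
  assumes "C \<in> \<A>" "D \<in> \<A>"
  shows "smooth_on (overlap C D \<times> UNIV) (snd (bundle_chart \<kappa> D) \<circ> chart_inv (bundle_chart \<kappa> C))"
proof -
  have o: "open (overlap C D \<times> (UNIV :: ('n, 'b) tensor set))"
    by (intro open_Times open_overlap assms open_UNIV)
  have sfst: "smooth_on (overlap C D \<times> (UNIV :: ('n, 'b) tensor set)) (\<lambda>y. F (fst y))"
    if "smooth_on (overlap C D) F" for F :: "real ^ 'n \<Rightarrow> 'c::real_normed_vector"
    by (rule smooth_on_compose[OF o open_overlap[OF assms] _ that smooth_on_fst[OF o smooth_on_ident[OF o]]]) auto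
  have "smooth_on (overlap C D \<times> (UNIV :: ('n, 'b) tensor set))
     (\<lambda>y. (transition C D (fst y), tensor_map (frechet_derivative (transition C D) (at (fst y))) (snd y)))"
    by (intro smooth_on_Pair smooth_on_tensor_map o sfst smooth_on_frechet_derivative
        smooth_transition assms smooth_on_snd smooth_on_ident)
  then show ?thesis
  proof (rule smooth_on_cong[OF o, rotated])
    fix y :: "(real ^ 'n) \<times> ('n, 'b) tensor"
    assume "y \<in> overlap C D \<times> UNIV"
    then obtain x \<alpha> where x: "y = (snd C x, \<alpha>)" "x \<in> fst C" "x \<in> fst D" by (auto simp: overlap_def)
    then show "(transition C D (fst y), tensor_map (frechet_derivative (transition C D) (at (fst y))) (snd y)) =
       (snd (bundle_chart \<kappa> D) \<circ> chart_inv (bundle_chart \<kappa> C)) y"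
      using assms in_chart[OF assms(1) x(2)]
      by (simp add: bundle_chart_inv chart_inv_chart snd_bundle_chart tensor_map_dtr_compose transition_chart dtr_def[symmetric])
  qed
qed

text \<open>The base component of a change of bundle charts depends on the base coordinate
  alone.\<close>

lemma fst_from_coords_bundle:
  fixes a :: "('n, 'k::finite) tensor"
  assumes "C \<in> \<A>" "x \<in> fst C"
  shows "fst (from_coords (bundle_chart_at \<kappa>) (bundle_chart \<kappa> C) (x, a) u) = dtr C (\<kappa> x) x (fst u)"
proof -
  note x = in_chart[OF assms]
  let ?F = "snd (bundle_chart \<kappa> (\<kappa> x)) \<circ> chart_inv (bundle_chart \<kappa> C)"
  let ?y = "snd (bundle_chart \<kappa> C) (x, a)"
  let ?W = "overlap C (\<kappa> x) \<times> (UNIV :: ('n, 'k) tensor set)"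
  have W: "open ?W" "?y \<in> ?W"
    using assms x open_overlap[OF assms(1) x(2)] by (auto simp: overlap_def snd_bundle_chart intro!: open_Times)
  have "((\<lambda>y. fst (?F y)) has_derivative (\<lambda>u. fst (frechet_derivative ?F (at ?y) u))) (at ?y)"
    by (intro has_derivative_fst smooth_on_has_derivative[OF smooth_bundle_transition W(2)] assms x)
  then have "((\<lambda>y. transition C (\<kappa> x) (fst y)) has_derivative (\<lambda>u. fst (frechet_derivative ?F (at ?y) u))) (at ?y)"
  proof (rule has_derivative_transform_within_open[OF _ W])
    fix y assume "y \<in> ?W"
    then show "fst (?F y) = transition C (\<kappa> x) (fst y)"
      using assms by (auto simp: overlap_def bundle_chart_inv snd_bundle_chart chart_inv_chart transition_chart)
  qed
  moreover have "((\<lambda>y. transition C (\<kappa> x) (fst y)) has_derivative (\<lambda>u. dtr C (\<kappa> x) x (fst u))) (at ?y)"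
    by (rule has_derivative_compose[OF has_derivative_fst[OF has_derivative_ident]])
      (use transition_has_derivative[OF assms(1) x(2) assms(2) x(3)] in \<open>simp add: snd_bundle_chart\<close>)
  ultimately have "(\<lambda>u. fst (frechet_derivative ?F (at ?y) u)) = (\<lambda>u. dtr C (\<kappa> x) x (fst u))"
    by (rule has_derivative_unique)
  then show ?thesis
    unfolding from_coords_def bundle_chart_at_def fst_conv by (rule fun_cong)
qed

lemma from_coords_bundle_tangent:
  fixes a :: "('n, 'k::finite) tensor"
  assumes C: "C \<in> \<A>" "x \<in> fst C"
    and u: "u \<in> tangent_set (snd (bundle_chart \<kappa> C) ` (Q \<inter> fst (bundle_chart \<kappa> C))) (snd (bundle_chart \<kappa> C) (x, a))"
  shows "from_coords (bundle_chart_at \<kappa>) (bundle_chart \<kappa> C) (x, a) u \<in> tangent_space (bundle_chart_at \<kappa>) Q (x, a)"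
proof -
  note x = in_chart[OF C]
  let ?F = "snd (bundle_chart \<kappa> (\<kappa> x)) \<circ> chart_inv (bundle_chart \<kappa> C)"
  let ?y = "snd (bundle_chart \<kappa> C) (x, a)"
  let ?W = "overlap C (\<kappa> x) \<times> (UNIV :: ('n, 'k) tensor set)"
  have W: "open ?W" "?y \<in> ?W"
    using C x open_overlap[OF C(1) x(2)] by (auto simp: overlap_def snd_bundle_chart intro!: open_Times)
  have Fy: "?F ?y = snd (bundle_chart \<kappa> (\<kappa> x)) (x, a)"
    using C by (simp add: bundle_chart_inv_chart fst_bundle_chart)
  have "?F z \<in> snd (bundle_chart \<kappa> (\<kappa> x)) ` (Q \<inter> fst (bundle_chart \<kappa> (\<kappa> x)))"
    if z: "z \<in> snd (bundle_chart \<kappa> C) ` (Q \<inter> fst (bundle_chart \<kappa> C)) \<inter> ?W" for z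
  proof -
    obtain q where q: "z = snd (bundle_chart \<kappa> C) q" "q \<in> Q" "q \<in> fst (bundle_chart \<kappa> C)" using z by auto
    obtain x' a' where q': "q = (x', a')" by (cases q)
    \<comment> \<open>Membership in \<open>overlap\<close> is known for the coordinates; injectivity
      of the chart brings it back to the point x'.\<close>
    obtain x'' where "snd C x' = snd C x''" "x'' \<in> fst C" "x'' \<in> fst (\<kappa> x)"
      using z q q' by (auto simp: overlap_def snd_bundle_chart)
    then have "x' \<in> fst (\<kappa> x)"
      using q q' chart_inj[OF C(1)] by (metis fst_bundle_chart inj_onD mem_Sigma_iff)
    then show ?thesis
      using q q' C by (auto simp: bundle_chart_inv_chart fst_bundle_chart)
  qed
  then have "frechet_derivative ?F (at ?y) u \<in>
      tangent_set (snd (bundle_chart \<kappa> (\<kappa> x)) ` (Q \<inter> fst (bundle_chart \<kappa> (\<kappa> x)))) (?F ?y)"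
    by (intro tangent_set_map[OF u W smooth_bundle_transition] C x image_subsetI)
  then show ?thesis
    unfolding Fy by (simp add: tangent_space_def from_coords_def bundle_chart_at_def)
qed

text \<open>Bundle and base use the same preferred chart, in which the projection is the linear map
  \<open>fst\<close>.\<close>

lemma manifold_deriv_fst:
  fixes a :: "('n, 'k::finite) tensor"
  assumes "x \<in> topspace X"
  shows "manifold_deriv (bundle_chart_at \<kappa>) \<kappa> fst (x, a) u = fst u"
proof -
  note x = chart_at_mem[OF assms]
  let ?F = "snd (\<kappa> x) \<circ> fst \<circ> chart_inv (bundle_chart \<kappa> (\<kappa> x))"
  let ?y = "snd (bundle_chart \<kappa> (\<kappa> x)) (x, a)"
  have "frechet_derivative ?F (at ?y) = frechet_derivative fst (at ?y)"
  proof (rule frechet_derivative_cong_open)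
    show "open ((snd (\<kappa> x) ` fst (\<kappa> x)) \<times> (UNIV :: ('n, 'k) tensor set))"
      by (intro open_Times open_chart_image x open_UNIV)
  qed (use x in \<open>auto simp: bundle_chart_inv chart_inv_chart snd_bundle_chart\<close>)
  also have "\<dots> = fst"
    by (rule frechet_derivative_at[symmetric, OF has_derivative_fst[OF has_derivative_ident]])
  finally show ?thesis by (simp add: manifold_deriv_def bundle_chart_at_def)
qed

end

section \<open>Hilbert forms and tangent lifts near one point\<close>

text \<open>The frame e is a positive basis of its own plane, hence of the plane of a.\<close>

lemma oriented_plane_eqD:
  assumes "a \<in> simple_vectors" "a \<noteq> 0" "oriented_plane a = oriented_plane (wedge e)"
  shows "\<exists>c>0. wedge e = c *\<^sub>R a"
proof -
  have "e \<in> oriented_plane (wedge e)" unfolding oriented_plane_def by (auto intro: exI[of _ 1])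
  then show ?thesis using assms(3) unfolding oriented_plane_def by blast
qed

locale density_at = manifold X \<A>
  for X :: "'a topology" and \<A> :: "('a, real ^ 'n::finite) chart set" +
  fixes \<phi> :: "'a \<Rightarrow> ('n, 'k::finite) tensor \<Rightarrow> real" and x0 :: 'a and a0 :: "('n, 'k) tensor"
  assumes density: "k_density (topspace X) (chart_at \<A>) \<phi>"
    and p0: "(x0, a0) \<in> unit_bundle (topspace X) \<phi>"
begin

abbreviation "M \<equiv> topspace X"
abbreviation "SM \<equiv> unit_bundle M \<phi>"
abbreviation "C \<equiv> \<kappa> x0"
abbreviation "B \<equiv> bundle_chart \<kappa> C :: ('a \<times> ('n, 'k) tensor, (real ^ 'n) \<times> ('n, 'k) tensor) chart"

definition U where "U = snd C ` fst C"

definition ph where "ph = (\<lambda>(x, a). \<phi> x a) \<circ> chart_inv B"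

definition y0 where "y0 = snd B (x0, a0)"

lemma x0: "x0 \<in> M" "C \<in> \<A>" "x0 \<in> fst C"
  using p0 chart_at_mem by (auto simp: unit_bundle_def)

lemma in_C:
  assumes "x \<in> fst C"
  shows "x \<in> M" "\<kappa> x \<in> \<A>" "x \<in> fst (\<kappa> x)"
  by (rule in_chart[OF x0(2) assms])+

lemma vector_density: "x \<in> M \<Longrightarrow> vector_density (\<phi> x)"
  using density unfolding k_density_def by blast

lemma phi_zero: "x \<in> M \<Longrightarrow> a \<in> simple_vectors \<Longrightarrow> \<phi> x a = 0 \<longleftrightarrow> a = 0"
  and phi_nonneg: "x \<in> M \<Longrightarrow> a \<in> simple_vectors \<Longrightarrow> \<phi> x a \<ge> 0"
  and phi_scale: "x \<in> M \<Longrightarrow> a \<in> simple_vectors \<Longrightarrow> \<phi> x (t *\<^sub>R a) = \<bar>t\<bar> * \<phi> x a"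
  using vector_density unfolding vector_density_def by blast+

lemma unit_bundle_iff: "(x, a) \<in> SM \<longleftrightarrow> x \<in> M \<and> a \<in> simple_vectors \<and> \<phi> x a = 1"
  by (auto simp: unit_bundle_def unit_fibre_def)

lemma unit_bundle_nonzero: "(x, a) \<in> SM \<Longrightarrow> a \<noteq> 0"
  using phi_zero[of x a] by (auto simp: unit_bundle_iff)

definition from_C :: "'a \<Rightarrow> ('n, 'k) tensor \<Rightarrow> ('n, 'k) tensor" where
  "from_C x = tensor_map (dtr C (\<kappa> x) x)"
definition to_C :: "'a \<Rightarrow> ('n, 'k) tensor \<Rightarrow> ('n, 'k) tensor" where
  "to_C x = tensor_map (dtr (\<kappa> x) C x)"

lemma from_C_to_C: "x \<in> fst C \<Longrightarrow> from_C x (to_C x a) = a"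
  and to_C_from_C: "x \<in> fst C \<Longrightarrow> to_C x (from_C x a) = a"
  unfolding from_C_def to_C_def using x0 in_C by (auto intro!: tensor_map_dtr_inverse)

lemma linear_from_C: "linear (from_C x)" and linear_to_C: "linear (to_C x)"
  unfolding from_C_def to_C_def by (rule linear_tensor_map)+

lemma from_C_simple: "x \<in> fst C \<Longrightarrow> a \<in> simple_vectors \<Longrightarrow> from_C x a \<in> simple_vectors"
  and to_C_simple: "x \<in> fst C \<Longrightarrow> a \<in> simple_vectors \<Longrightarrow> to_C x a \<in> simple_vectors"
  unfolding from_C_def to_C_def using x0 in_C by (auto intro!: tensor_map_simple linear_dtr)

lemma from_C_k_vectors: "x \<in> fst C \<Longrightarrow> c \<in> k_vectors \<Longrightarrow> from_C x c \<in> k_vectors"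
  unfolding from_C_def using x0 in_C by (auto intro!: tensor_map_k_vectors linear_dtr)

lemma from_C_wedge: "x \<in> fst C \<Longrightarrow> from_C x (wedge v) = wedge (\<lambda>i. dtr C (\<kappa> x) x (v i))"
  unfolding from_C_def using x0 in_C by (auto intro!: tensor_map_wedge linear_dtr)

lemma from_C_zero_iff: "x \<in> fst C \<Longrightarrow> from_C x a = 0 \<longleftrightarrow> a = 0"
  using to_C_from_C linear_0[OF linear_to_C] linear_0[OF linear_from_C] by metis

lemma snd_B: "snd B (x, a) = (snd C x, to_C x a)"
  by (simp add: snd_bundle_chart to_C_def)

lemma chart_inv_B: "x \<in> fst C \<Longrightarrow> chart_inv B (snd C x, \<alpha>) = (x, from_C x \<alpha>)"
  using x0 by (simp add: bundle_chart_inv chart_inv_chart from_C_def)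

lemma U_E:
  assumes "\<xi> \<in> U"
  obtains x where "x \<in> fst C" "x \<in> M" "\<xi> = snd C x"
  using assms x0 chart_subset unfolding U_def by blast

lemma ph_eq: "x \<in> fst C \<Longrightarrow> ph (snd C x, \<alpha>) = \<phi> x (from_C x \<alpha>)"
  by (simp add: ph_def chart_inv_B)

lemma nonzero_simple_image:
  "snd B ` (nonzero_simple_bundle M \<inter> fst B) = U \<times> (simple_vectors - {0})"
proof (intro equalityI subsetI)
  fix y assume "y \<in> snd B ` (nonzero_simple_bundle M \<inter> fst B)"
  then obtain x a where y: "y = snd B (x, a)" "x \<in> fst C" "a \<in> simple_vectors" "a \<noteq> 0"
    by (auto simp: nonzero_simple_bundle_def fst_bundle_chart)
  then have "to_C x a \<noteq> 0" using from_C_to_C[of x a] linear_0[OF linear_from_C] by metis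
  then show "y \<in> U \<times> (simple_vectors - {0})" using y to_C_simple by (auto simp: snd_B U_def)
next
  fix y assume "y \<in> U \<times> (simple_vectors - {0 :: ('n, 'k) tensor})"
  then obtain x \<alpha> where y: "y = (snd C x, \<alpha>)" "x \<in> fst C" "x \<in> M" "\<alpha> \<in> simple_vectors" "\<alpha> \<noteq> 0"
    by (auto elim!: U_E)
  then have "y = snd B (x, from_C x \<alpha>)" by (simp add: snd_B to_C_from_C)
  then show "y \<in> snd B ` (nonzero_simple_bundle M \<inter> fst B)"
    using y from_C_simple from_C_zero_iff
    by (intro image_eqI[of _ _ "(x, from_C x \<alpha>)"]) (auto simp: nonzero_simple_bundle_def fst_bundle_chart)
qed

sublocale coord_density U ph
proof
  show "open U" unfolding U_def by (rule open_chart_image[OF x0(2)])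
  have "smooth_function_on (bundle_chart_at \<kappa>) (nonzero_simple_bundle M) (\<lambda>(x, a). \<phi> x a)"
    using density unfolding k_density_def by blast
  \<comment> \<open>Smoothness of \<phi> is stated in the charts at points of the nonzero cone; this
    point supplies the chart \<open>B\<close>.\<close>
  moreover have "(x0, a0) \<in> nonzero_simple_bundle M"
    using p0 unit_bundle_nonzero[OF p0] by (simp add: nonzero_simple_bundle_def unit_bundle_iff)
  ultimately show "smooth_map_on (U \<times> (simple_vectors - {0})) ph"
    unfolding smooth_function_on_def ph_def nonzero_simple_image[symmetric]
    by (auto simp: bundle_chart_at_def)
next
  fix \<xi> and a :: "('n, 'k) tensor" and t :: real
  assume \<xi>: "\<xi> \<in> U" and a: "a \<in> simple_vectors"
  obtain x where x: "x \<in> fst C" "x \<in> M" "\<xi> = snd C x" using \<xi> by (rule U_E)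
  show "ph (\<xi>, t *\<^sub>R a) = \<bar>t\<bar> * ph (\<xi>, a)"
    using x a from_C_simple by (simp add: ph_eq linear_cmul[OF linear_from_C] phi_scale)
  assume "a \<noteq> 0"
  then show "ph (\<xi>, a) > 0"
    using x a phi_zero[of x "from_C x a"] phi_nonneg[of x "from_C x a"] from_C_simple from_C_zero_iff
    by (auto simp: ph_eq less_le)
qed

lemma S_iff: "x \<in> fst C \<Longrightarrow> (snd C x, \<alpha>) \<in> S \<longleftrightarrow> (x, from_C x \<alpha>) \<in> SM"
proof -
  assume x: "x \<in> fst C"
  have "\<alpha> \<in> simple_vectors \<longleftrightarrow> from_C x \<alpha> \<in> simple_vectors"
    using x from_C_simple to_C_simple to_C_from_C by metis
  moreover have "snd C x \<in> U" using x by (simp add: U_def)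
  ultimately show ?thesis
    using x in_C[OF x] by (auto simp: S_def unit_bundle_iff ph_eq)
qed

lemma S_eq: "snd B ` (SM \<inter> fst B) = S"
proof (intro equalityI subsetI)
  fix y assume y: "y \<in> S"
  then have "fst y \<in> U" by (auto simp: S_def)
  then obtain x where x: "x \<in> fst C" "fst y = snd C x" by (rule U_E)
  then have "y = (snd C x, snd y)" by (simp add: prod_eq_iff)
  then have "(x, from_C x (snd y)) \<in> SM" using S_iff[OF x(1), of "snd y"] y by simp
  then show "y \<in> snd B ` (SM \<inter> fst B)"
    using x by (intro image_eqI[of _ _ "(x, from_C x (snd y))"])
      (auto simp: snd_B to_C_from_C fst_bundle_chart prod_eq_iff)
qed (auto simp: fst_bundle_chart snd_B S_iff from_C_to_C)

lemma y0_S: "y0 \<in> S"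
  unfolding S_eq[symmetric] y0_def using p0 x0 by (auto simp: fst_bundle_chart)

lemma bundle_chart_at_p0: "bundle_chart_at \<kappa> (x0, a0) = B"
  by (simp add: bundle_chart_at_def)

definition coord_legendre where
  "coord_legendre L = (\<lambda>y c. case chart_inv B y of (x, a) \<Rightarrow> L x a (from_C x c))"

lemma coord_legendre_eq: "x \<in> fst C \<Longrightarrow> coord_legendre L (snd C x, \<alpha>) c = L x (from_C x \<alpha>) (from_C x c)"
  by (simp add: coord_legendre_def chart_inv_B)

lemma legendre_coord_legendre:
  assumes L: "legendre_map M \<kappa> \<phi> L"
  shows "legendre (coord_legendre L)"
  unfolding legendre_def
proof (intro conjI ballI allI)
  fix y assume "y \<in> S"
  then obtain x \<alpha> where y: "y = (snd C x, \<alpha>)" "x \<in> fst C" "(x, from_C x \<alpha>) \<in> SM"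
    unfolding S_eq[symmetric] by (auto simp: fst_bundle_chart snd_B from_C_to_C)
  then have a: "x \<in> M" "from_C x \<alpha> \<in> simple_vectors" "from_C x \<alpha> \<in> unit_fibre (\<phi> x)" "\<phi> x (from_C x \<alpha>) = 1"
    by (auto simp: unit_bundle_iff unit_fibre_def)
  have "k_covector (L x (from_C x \<alpha>))" using L a unfolding legendre_map_def by blast
  then show "k_covector (coord_legendre L y)"
    using y(2) from_C_k_vectors unfolding k_covector_def y(1)
    by (simp add: coord_legendre_eq linear_add[OF linear_from_C] linear_cmul[OF linear_from_C])
  have "L x (from_C x \<alpha>) (from_C x \<alpha>) = (\<phi> x (from_C x \<alpha>))\<^sup>2"
    using L a unfolding legendre_map_def by blast
  then show "coord_legendre L y (snd y) = 1" using y a by (simp add: coord_legendre_eq)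
  fix c assume c: "c \<in> tangent_set {a \<in> simple_vectors. ph (fst y, a) = 1} (snd y)"
  have bl: "bounded_linear (from_C x)" by (rule linear_conv_bounded_linear[THEN iffD1, OF linear_from_C])
  \<comment> \<open>The linear map \<open>from_C x\<close> takes the unit fibre in coordinates into
    that of \<open>\<phi> x\<close>, hence velocities to velocities, and it is its own
    derivative.\<close>
  have "frechet_derivative (from_C x) (at (snd y)) c \<in> tangent_set (unit_fibre (\<phi> x)) (from_C x (snd y))"
    by (rule tangent_set_map[OF c open_UNIV UNIV_I smooth_on_bounded_linear[OF bl open_UNIV]])
      (use y from_C_simple in \<open>auto simp: unit_fibre_def ph_eq\<close>)
  moreover have "frechet_derivative (from_C x) (at (snd y)) = from_C x"
    by (rule frechet_derivative_at[symmetric, OF bounded_linear_imp_has_derivative[OF bl]])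
  ultimately have "L x (from_C x \<alpha>) (from_C x c) = 0"
    using L a y unfolding legendre_map_def by simp
  then show "coord_legendre L y c = 0" using y by (simp add: coord_legendre_eq)
next
  fix v :: "'k \<Rightarrow> real ^ 'n"
  have "smooth_map_on (snd B ` (nonzero_simple_bundle M \<inter> fst B))
      ((\<lambda>(x, a). L x a (wedge (\<lambda>i. from_coords \<kappa> C x (v i)))) \<circ> chart_inv B)"
    using L x0(1) unfolding legendre_map_def Let_def by blast
  then show "smooth_map_on (U \<times> (simple_vectors - {0})) (\<lambda>y. coord_legendre L y (wedge v))"
    unfolding nonzero_simple_image
    by (rule smooth_map_on_cong)
      (auto elim!: U_E simp: chart_inv_B coord_legendre_eq from_C_wedge from_coords_eq)
qed

text \<open>Passing from \<open>B\<close> to the preferred chart of x acts on base components by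
  \<open>dtr\<close>, and there the projection differentiates to \<open>fst\<close>;
  \<open>coord_legendre\<close> absorbs both. The result has the form in which
  \<open>local_extension\<close> tests a candidate.\<close>

lemma hilbert_form_coord:
  assumes L: "\<forall>(x, a)\<in>SM. \<forall>u. (\<forall>i. u i \<in> tangent_space (bundle_chart_at \<kappa>) SM (x, a)) \<longrightarrow>
      \<omega> (x, a) u = L x a (wedge (\<lambda>i. manifold_deriv (bundle_chart_at \<kappa>) \<kappa> fst (x, a) (u i)))"
    and q: "q \<in> SM \<inter> fst B"
    and u: "\<forall>i. u i \<in> tangent_set (snd B ` (SM \<inter> fst B)) (snd B q)"
  shows "\<omega> q (\<lambda>i. from_coords (bundle_chart_at \<kappa>) B q (u i)) = coord_form (coord_legendre L) (snd B q) u"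
proof -
  obtain x a where xa: "q = (x, a)" by (cases q)
  have x: "x \<in> fst C" "(x, a) \<in> SM" "x \<in> M" using q xa by (auto simp: fst_bundle_chart unit_bundle_iff)
  have "from_coords (bundle_chart_at \<kappa>) B (x, a) (u i) \<in> tangent_space (bundle_chart_at \<kappa>) SM (x, a)" for i
    by (rule from_coords_bundle_tangent[OF x0(2) x(1)]) (use u xa in auto)
  then have "\<omega> (x, a) (\<lambda>i. from_coords (bundle_chart_at \<kappa>) B (x, a) (u i)) =
      L x a (wedge (\<lambda>i. dtr C (\<kappa> x) x (fst (u i))))"
    using L x by (auto simp: manifold_deriv_fst fst_from_coords_bundle[OF x0(2) x(1)])
  then show ?thesis
    using x by (simp add: xa coord_form_def snd_B coord_legendre_eq from_C_to_C from_C_wedge)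
qed

text \<open>A witness is what gives the \<open>SOME\<close> in \<open>form_deriv\<close> a meaning.
  Precomposition with r spreads the form from the unit bundle to an open set.\<close>

lemma local_extension_exists:
  assumes leg: "legendre l"
    and coord: "\<And>q u. q \<in> SM \<inter> fst B \<Longrightarrow> \<forall>i. u i \<in> tangent_set (snd B ` (SM \<inter> fst B)) (snd B q) \<Longrightarrow>
      \<omega> q (\<lambda>i. from_coords (bundle_chart_at \<kappa>) B q (u i)) = coord_form l (snd B q) u"
    and r: "is_retraction y0 W r"
  shows "local_extension (bundle_chart_at \<kappa>) SM \<omega> (x0, a0) (\<lambda>y. coord_form l (r y))"
  unfolding local_extension_def bundle_chart_at_p0
proof (intro exI[of _ W] conjI ballI allI impI)
  note r' = retractionD[OF r]
  show "open W" "snd B (x0, a0) \<in> W" "W \<subseteq> snd B ` fst B"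
    using r'(1-3) x0 by (auto simp: y0_def U_def bundle_chart_image)
  show "alternating_form (coord_form l (r y))" if "y \<in> W" for y
    unfolding coord_form_def by (rule alternating_form_wedge_fst) (use leg r'(6)[OF that] in \<open>auto simp: legendre_def\<close>)
  show "smooth_on W (\<lambda>y. coord_form l (r y) u)" for u
    unfolding coord_form_def by (rule smooth_on_retract_form[OF r]) (use leg in \<open>auto simp: legendre_def\<close>)
  fix q and u :: "'k \<Rightarrow> (real ^ 'n) \<times> ('n, 'k) tensor"
  assume "q \<in> SM \<inter> fst B" "snd B q \<in> W" "\<forall>i. u i \<in> tangent_set (snd B ` (SM \<inter> fst B)) (snd B q)"
  moreover then have "r (snd B q) = snd B q" using r'(8) S_eq by blast
  ultimately show "coord_form l (r (snd B q)) u = \<omega> q (\<lambda>i. from_coords (bundle_chart_at \<kappa>) B q (u i))"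
    using coord by simp
qed

text \<open>Whatever extension \<open>SOME\<close> picks is pinned down on velocities in
  \<open>S\<close>, so \<open>ext_deriv_extension\<close> replaces it by the explicit form.\<close>

lemma form_deriv_eq:
  assumes leg: "legendre l"
    and coord: "\<And>q u. q \<in> SM \<inter> fst B \<Longrightarrow> \<forall>i. u i \<in> tangent_set (snd B ` (SM \<inter> fst B)) (snd B q) \<Longrightarrow>
      \<omega> q (\<lambda>i. from_coords (bundle_chart_at \<kappa>) B q (u i)) = coord_form l (snd B q) u"
    and r: "is_retraction y0 W r"
    and u: "\<And>i. u i \<in> tangent_set S y0"
  shows "form_deriv (bundle_chart_at \<kappa>) SM \<omega> (x0, a0) u = ext_deriv (\<lambda>y. coord_form l (r y)) y0 u"
proof -
  define \<Omega> where "\<Omega> = (SOME \<Omega>. local_extension (bundle_chart_at \<kappa>) SM \<omega> (x0, a0) \<Omega>)"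
  have "local_extension (bundle_chart_at \<kappa>) SM \<omega> (x0, a0) \<Omega>"
    unfolding \<Omega>_def
    by (rule someI[of "local_extension (bundle_chart_at \<kappa>) SM \<omega> (x0, a0)", OF local_extension_exists[OF leg coord r]])
  then obtain V where V: "open V" "y0 \<in> V" "\<forall>y\<in>V. alternating_form (\<Omega> y)" "\<forall>u. smooth_on V (\<lambda>y. \<Omega> y u)"
    and ext: "\<And>q u. q \<in> SM \<inter> fst B \<Longrightarrow> snd B q \<in> V \<Longrightarrow>
       \<forall>i. u i \<in> tangent_set (snd B ` (SM \<inter> fst B)) (snd B q) \<Longrightarrow>
       \<Omega> (snd B q) u = \<omega> q (\<lambda>i. from_coords (bundle_chart_at \<kappa>) B q (u i))"
    unfolding local_extension_def bundle_chart_at_p0 y0_def by blast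
  have "ext_deriv \<Omega> y0 u = ext_deriv (\<lambda>y. coord_form l (r y)) y0 u"
  proof (rule ext_deriv_extension[OF r y0_S V(1,2)])
    fix y and u :: "'k \<Rightarrow> (real ^ 'n) \<times> ('n, 'k) tensor"
    assume y: "y \<in> S \<inter> V" and u: "\<And>i. u i \<in> tangent_set S y"
    then obtain q where q: "q \<in> SM \<inter> fst B" "y = snd B q" using S_eq by blast
    show "\<Omega> y u = coord_form l y u"
      using ext[of q u] coord[of q u] q y u by (simp add: S_eq)
  qed (use V u in auto)
  then show ?thesis
    by (simp add: form_deriv_def \<Omega>_def bundle_chart_at_p0 y0_def)
qed

text \<open>The lift over \<psi> is the normalised product of the coordinate frame. Its tangent
  vectors come from parameters because \<eta>, a smooth left inverse of \<psi>, turns a curve in the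
  lift into a differentiable curve of parameters.\<close>

lemma tangent_lift_parametrisation:
  assumes N: "oriented_submanifold M \<kappa> N ori" and p: "(x0, a0) \<in> tangent_lift M \<phi> N ori"
  obtains T t0 and \<psi> :: "real ^ 'k \<Rightarrow> real ^ 'n" and A :: "real ^ 'k \<Rightarrow> ('n, 'k) tensor"
  where "open T" "t0 \<in> T" "smooth_on T \<psi>" "smooth_on T A" "\<And>t. t \<in> T \<Longrightarrow> (\<psi> t, A t) \<in> S"
    "\<And>t. t \<in> T \<Longrightarrow> \<exists>c. A t = c *\<^sub>R wedge (\<lambda>i. frechet_derivative \<psi> (at t) (axis i 1))"
    "(\<psi> t0, A t0) = y0"
    "\<And>b. b \<in> tangent_space (bundle_chart_at \<kappa>) (tangent_lift M \<phi> N ori) (x0, a0) \<Longrightarrow>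
       \<exists>\<tau>. b = (frechet_derivative \<psi> (at t0) \<tau>, frechet_derivative A (at t0) \<tau>)"
proof -
  let ?NN = "tangent_lift M \<phi> N ori"
  have "x0 \<in> N" using p by (auto simp: tangent_lift_def)
  then obtain W V and \<psi> :: "real ^ 'k \<Rightarrow> real ^ 'n" and \<eta> where
    W: "open W" "snd C x0 \<in> W" "W \<subseteq> snd C ` fst C" and V: "open V"
    and \<psi>: "smooth_on V \<psi>" and \<eta>: "smooth_on W \<eta>"
    and im: "\<psi> ` V = snd C ` (N \<inter> fst C) \<inter> W" and inv: "\<forall>t\<in>V. \<eta> (\<psi> t) = t"
    and ori: "\<forall>t\<in>V. ori (chart_inv C (\<psi> t)) = oriented_plane
        (wedge (\<lambda>i. from_coords \<kappa> C (chart_inv C (\<psi> t)) (frechet_derivative \<psi> (at t) (axis i 1))))"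
    using N unfolding oriented_submanifold_def Let_def by blast
  define Q where "Q t = wedge (\<lambda>i. frechet_derivative \<psi> (at t) (axis i 1))" for t
  have sQ: "smooth_on V Q"
    unfolding Q_def by (intro smooth_on_wedge smooth_on_frechet_derivative V \<psi>)
  \<comment> \<open>Normalising requires a nonzero product. Parameters of points of the lift lie in
    T, as \<open>lift\<close> shows: there \<open>Q t\<close> is a positive multiple of a nonzero
    vector.\<close>
  define T where "T = V \<inter> Q -` (- {0})"
  have T: "open T" "T \<subseteq> V"
    unfolding T_def by (auto intro!: continuous_open_preimage smooth_on_continuous[OF sQ] V)
  have \<psi>U: "\<psi> t \<in> U" if "t \<in> V" for t using im W(3) that unfolding U_def by blast
  define A where "A t = normalise (\<psi> t, Q t)" for t
  have s: "smooth_on T \<psi>" "smooth_on T Q" using \<psi> sQ T by (auto intro: smooth_on_subset)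
  have sA: "smooth_on T A"
    unfolding A_def by (intro smooth_on_normalise smooth_on_Pair s T) (use \<psi>U T in \<open>auto simp: T_def Q_def\<close>)
  have AS: "(\<psi> t, A t) \<in> S" if "t \<in> T" for t
    unfolding A_def by (rule normalise_in_S) (use that \<psi>U T in \<open>auto simp: T_def Q_def\<close>)
  have plane: "\<exists>c. A t = c *\<^sub>R wedge (\<lambda>i. frechet_derivative \<psi> (at t) (axis i 1))" for t
    by (auto simp: A_def normalise_def Q_def)
  have lift: "\<eta> \<xi> \<in> T \<and> \<xi> = \<psi> (\<eta> \<xi>) \<and> \<alpha> = A (\<eta> \<xi>)"
    if y: "(\<xi>, \<alpha>) \<in> snd B ` (?NN \<inter> fst B)" "\<xi> \<in> W" for \<xi> \<alpha>
  proof -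
    obtain x a where x: "(x, a) \<in> ?NN" "x \<in> fst C" "\<xi> = snd C x" "\<alpha> = to_C x a"
      using y(1) by (auto simp: fst_bundle_chart snd_B)
    have a: "(x, a) \<in> SM" "x \<in> N" "oriented_plane a = ori x" "a \<in> simple_vectors" "a \<noteq> 0"
      using x(1) unit_bundle_nonzero[of x a] by (auto simp: tangent_lift_def unit_bundle_iff)
    have "\<xi> \<in> \<psi> ` V" using im x a y(2) by blast
    then obtain t where t: "t \<in> V" "\<xi> = \<psi> t" by blast
    have \<eta>\<xi>: "\<eta> \<xi> = t" using inv t by simp
    have xt: "chart_inv C (\<psi> t) = x" using t x x0 chart_inv_chart by metis
    have "oriented_plane a = oriented_plane (wedge (\<lambda>i. dtr C (\<kappa> x) x (frechet_derivative \<psi> (at t) (axis i 1))))"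
      using ori t(1) a(3) xt by (auto simp: from_coords_eq)
    \<comment> \<open>Equality of the orientations makes c positive, so \<open>normalise\<close>
      recovers \<alpha> and not its negative.\<close>
    from oriented_plane_eqD[OF a(4,5) this] obtain c where c: "c > 0" "from_C x (Q t) = c *\<^sub>R a"
      unfolding Q_def from_C_wedge[OF x(2)] by blast
    have "Q t = to_C x (from_C x (Q t))" using to_C_from_C[OF x(2)] by simp
    also have "\<dots> = c *\<^sub>R \<alpha>" unfolding c(2) x(4) by (rule linear_cmul[OF linear_to_C])
    finally have Q: "Q t = c *\<^sub>R \<alpha>" .
    have \<alpha>S: "(\<xi>, \<alpha>) \<in> S"
      using S_iff[OF x(2), of \<alpha>] a(1) x by (simp add: from_C_to_C)
    then have "\<alpha> \<noteq> 0" by (rule S_nonzero)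
    then have "t \<in> T" using t Q c by (simp add: T_def)
    moreover have "\<alpha> = A t"
      unfolding A_def Q t(2)[symmetric] by (rule normalise_scaleR[OF \<alpha>S c(1), symmetric])
    ultimately show ?thesis using \<eta>\<xi> t by simp
  qed
  define t0 where "t0 = \<eta> (snd C x0)"
  have y0_eq: "y0 = (snd C x0, to_C x0 a0)" by (simp add: y0_def snd_B)
  have "(snd C x0, to_C x0 a0) \<in> snd B ` (?NN \<inter> fst B)"
    using p x0 by (intro image_eqI[of _ _ "(x0, a0)"]) (auto simp: snd_B fst_bundle_chart)
  from lift[OF this W(2)] have t0: "t0 \<in> T" "(\<psi> t0, A t0) = y0" "\<psi> t0 = snd C x0"
    unfolding t0_def y0_eq by auto
  have tan: "\<exists>\<tau>. b = (frechet_derivative \<psi> (at t0) \<tau>, frechet_derivative A (at t0) \<tau>)"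
    if b: "b \<in> tangent_space (bundle_chart_at \<kappa>) ?NN (x0, a0)" for b
  proof -
    have b': "b \<in> tangent_set (snd B ` (?NN \<inter> fst B)) y0"
      using b by (simp add: tangent_space_def bundle_chart_at_p0 y0_def)
    have W': "open (W \<times> (UNIV :: ('n, 'k) tensor set))" "y0 \<in> W \<times> UNIV"
      using W by (auto simp: y0_eq intro!: open_Times)
    obtain \<gamma> e where g: "e > 0" "smooth_on {- e<..<e} \<gamma>"
      "\<gamma> ` {- e<..<e} \<subseteq> snd B ` (?NN \<inter> fst B) \<inter> W \<times> UNIV" "\<gamma> 0 = y0" "(\<gamma> has_vector_derivative b) (at 0)"
      by (rule tangent_setE[OF b' W'])
    have I: "open {- e<..<e}" "0 \<in> {- e<..<e}" using g(1) by auto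
    define t where "t s = \<eta> (fst (\<gamma> s))" for s
    have \<gamma>: "t s \<in> T" "fst (\<gamma> s) = \<psi> (t s)" "snd (\<gamma> s) = A (t s)" if "s \<in> {- e<..<e}" for s
    proof -
      have "\<gamma> s \<in> snd B ` (?NN \<inter> fst B)" "fst (\<gamma> s) \<in> W" using g(3) that by (auto simp: image_subset_iff mem_Times_iff)
      then show "t s \<in> T" "fst (\<gamma> s) = \<psi> (t s)" "snd (\<gamma> s) = A (t s)"
        using lift[of "fst (\<gamma> s)" "snd (\<gamma> s)"] unfolding t_def by auto
    qed
    have f\<gamma>: "((\<lambda>s. fst (\<gamma> s)) has_vector_derivative fst b) (at 0)"
      and s\<gamma>: "((\<lambda>s. snd (\<gamma> s)) has_vector_derivative snd b) (at 0)"
      by (rule bounded_linear.has_vector_derivative[OF _ g(5)]; simp add: bounded_linear_fst bounded_linear_snd)+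
    have t00: "t 0 = t0" by (simp add: t_def g(4) y0_eq t0_def)
    \<comment> \<open>The velocity at 0 of the parameter curve t, which is \<eta> applied to the
      base component of \<gamma>.\<close>
    define \<tau> where "\<tau> = frechet_derivative \<eta> (at (snd C x0)) (fst b)"
    have dt: "(t has_vector_derivative \<tau>) (at 0)"
      using has_vector_derivative_compose_frechet[of \<eta> "\<lambda>s. fst (\<gamma> s)" 0 "fst b"] f\<gamma>
        smooth_on_differentiable[OF \<eta> W(2)] unfolding t_def \<tau>_def by (simp add: g(4) y0_eq)
    have "frechet_derivative \<psi> (at (t 0)) \<tau> = fst b"
      by (rule frechet_derivative_along_curve[OF _ dt has_vector_derivative_transform_within_open[OF f\<gamma> I]])
        (use \<gamma> smooth_on_differentiable[OF s(1)] I in auto)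
    moreover have "frechet_derivative A (at (t 0)) \<tau> = snd b"
      by (rule frechet_derivative_along_curve[OF _ dt has_vector_derivative_transform_within_open[OF s\<gamma> I]])
        (use \<gamma> smooth_on_differentiable[OF sA] I in auto)
    ultimately show ?thesis unfolding t00 by (intro exI[of _ \<tau>]) (simp add: prod_eq_iff)
  qed
  show thesis by (rule that[OF T(1) t0(1) s(1) sA AS plane t0(2) tan])
qed

text \<open>Both exterior derivatives are computed with the same retraction, so they may be
  subtracted as forms on an open set; the difference is the form of \<open>h\<close>, which
  \<open>ext_deriv_vanishes\<close> handles.\<close>

lemma contraction_form_deriv_eq:
  assumes N: "oriented_submanifold M \<kappa> N ori" and p: "(x0, a0) \<in> tangent_lift M \<phi> N ori"
    and \<omega>: "hilbert_form M \<kappa> \<phi> \<omega>" and \<omega>': "hilbert_form M \<kappa> \<phi> \<omega>'"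
    and b: "\<And>i. b i \<in> tangent_space (bundle_chart_at \<kappa>) (tangent_lift M \<phi> N ori) (x0, a0)"
    and w: "w \<in> tangent_space (bundle_chart_at \<kappa>) SM (x0, a0)"
  shows "form_deriv (bundle_chart_at \<kappa>) SM \<omega> (x0, a0) (case_option w b) =
    form_deriv (bundle_chart_at \<kappa>) SM \<omega>' (x0, a0) (case_option w b)"
proof -
  obtain L where L: "legendre_map M \<kappa> \<phi> L" "\<forall>(x, a)\<in>SM. \<forall>u. (\<forall>i. u i \<in> tangent_space (bundle_chart_at \<kappa>) SM (x, a)) \<longrightarrow>
      \<omega> (x, a) u = L x a (wedge (\<lambda>i. manifold_deriv (bundle_chart_at \<kappa>) \<kappa> fst (x, a) (u i)))"
    using \<omega> unfolding hilbert_form_def by blast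
  obtain L' where L': "legendre_map M \<kappa> \<phi> L'" "\<forall>(x, a)\<in>SM. \<forall>u. (\<forall>i. u i \<in> tangent_space (bundle_chart_at \<kappa>) SM (x, a)) \<longrightarrow>
      \<omega>' (x, a) u = L' x a (wedge (\<lambda>i. manifold_deriv (bundle_chart_at \<kappa>) \<kappa> fst (x, a) (u i)))"
    using \<omega>' unfolding hilbert_form_def by blast
  let ?l = "coord_legendre L" and ?l' = "coord_legendre L'"
  interpret legendre_pair U ph ?l ?l'
    by unfold_locales (rule legendre_coord_legendre[OF L(1)] legendre_coord_legendre[OF L'(1)])+
  obtain W r where r: "is_retraction y0 W r" using retraction_exists[OF y0_S] by blast
  have wS: "w \<in> tangent_set S y0"
    using w by (simp add: tangent_space_def bundle_chart_at_p0 y0_def S_eq)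
  have bS: "b i \<in> tangent_set S y0" for i
  proof -
    have "snd B ` (tangent_lift M \<phi> N ori \<inter> fst B) \<subseteq> S"
      unfolding S_eq[symmetric] by (auto simp: tangent_lift_def)
    then have "tangent_set (snd B ` (tangent_lift M \<phi> N ori \<inter> fst B)) y0 \<subseteq> tangent_set S y0"
      by (rule tangent_set_mono)
    moreover have "b i \<in> tangent_set (snd B ` (tangent_lift M \<phi> N ori \<inter> fst B)) y0"
      using b[of i] by (simp only: tangent_space_def bundle_chart_at_p0 y0_def)
    ultimately show ?thesis by (rule subsetD)
  qed
  have u: "case_option w b i \<in> tangent_set S y0" for i
    using wS bS by (cases i) auto
  have diff: "(\<lambda>y. coord_form l (r y) u) differentiable at y0" if "legendre l" for l u
    unfolding coord_form_def
    by (rule smooth_on_differentiable[OF smooth_on_retract_form[OF r] retractionD(2)[OF r]])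
      (use that in \<open>auto simp: legendre_def\<close>)
  obtain T t0 and \<psi> :: "real ^ 'k \<Rightarrow> real ^ 'n" and A :: "real ^ 'k \<Rightarrow> ('n, 'k) tensor" where
    T: "open T" "t0 \<in> T" "smooth_on T \<psi>" "smooth_on T A" "\<And>t. t \<in> T \<Longrightarrow> (\<psi> t, A t) \<in> S"
    "\<And>t. t \<in> T \<Longrightarrow> \<exists>c. A t = c *\<^sub>R wedge (\<lambda>i. frechet_derivative \<psi> (at t) (axis i 1))"
    "(\<psi> t0, A t0) = y0"
    "\<And>b. b \<in> tangent_space (bundle_chart_at \<kappa>) (tangent_lift M \<phi> N ori) (x0, a0) \<Longrightarrow>
       \<exists>\<tau>. b = (frechet_derivative \<psi> (at t0) \<tau>, frechet_derivative A (at t0) \<tau>)"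
    using tangent_lift_parametrisation[OF N p] by blast
  obtain \<tau> where \<tau>: "\<And>i. b i = (frechet_derivative \<psi> (at t0) (\<tau> i), frechet_derivative A (at t0) (\<tau> i))"
    using T(8)[OF b] by metis
  have "0 = ext_deriv (\<lambda>y. coord_form h (r y)) y0 (case_option w b)"
    by (rule ext_deriv_vanishes[OF r y0_S T(1-7) \<tau> wS, symmetric])
  also have "\<dots> = ext_deriv (\<lambda>y. coord_form ?l (r y)) y0 (case_option w b) -
      ext_deriv (\<lambda>y. coord_form ?l' (r y)) y0 (case_option w b)"
    using ext_deriv_diff[OF diff[OF legendre_l] diff[OF legendre_l']]
    by (simp add: coord_form_def h_def)
  finally show ?thesis
    using form_deriv_eq[OF legendre_l hilbert_form_coord[OF L(2)] r u]
      form_deriv_eq[OF legendre_l' hilbert_form_coord[OF L'(2)] r u] by simp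
qed

end

theorem proposition17:
  fixes X :: "'a topology"
    and \<A> :: "('a, real ^ 'n::finite) chart set"
    and \<phi> :: "'a \<Rightarrow> ('n, 'k::finite) tensor \<Rightarrow> real"
    and N :: "'a set"
    and ori :: "'a \<Rightarrow> ('k \<Rightarrow> real ^ 'n) set"
    and \<omega> \<omega>' :: "'a \<times> ('n, 'k) tensor \<Rightarrow> ('k \<Rightarrow> (real ^ 'n) \<times> ('n, 'k) tensor) \<Rightarrow> real"
  assumes "smooth_manifold X \<A>"
    and "k_density (topspace X) (chart_at \<A>) \<phi>"
    and "oriented_submanifold (topspace X) (chart_at \<A>) N ori"
    and "hilbert_form (topspace X) (chart_at \<A>) \<phi> \<omega>"
    and "hilbert_form (topspace X) (chart_at \<A>) \<phi> \<omega>'"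
  shows "\<forall>p\<in>tangent_lift (topspace X) \<phi> N ori. \<forall>b.
    (\<forall>i. b i \<in> tangent_space (bundle_chart_at (chart_at \<A>)) (tangent_lift (topspace X) \<phi> N ori) p) \<longrightarrow>
    (\<forall>w\<in>tangent_space (bundle_chart_at (chart_at \<A>)) (unit_bundle (topspace X) \<phi>) p.
       contraction b (form_deriv (bundle_chart_at (chart_at \<A>)) (unit_bundle (topspace X) \<phi>) \<omega> p) w =
       contraction b (form_deriv (bundle_chart_at (chart_at \<A>)) (unit_bundle (topspace X) \<phi>) \<omega>' p) w)"
proof (intro ballI allI impI)
  fix p w and b :: "'k \<Rightarrow> (real ^ 'n) \<times> ('n, 'k) tensor"
  assume p: "p \<in> tangent_lift (topspace X) \<phi> N ori"
    and b: "\<forall>i. b i \<in> tangent_space (bundle_chart_at (chart_at \<A>)) (tangent_lift (topspace X) \<phi> N ori) p"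
    and w: "w \<in> tangent_space (bundle_chart_at (chart_at \<A>)) (unit_bundle (topspace X) \<phi>) p"
  obtain x a where xa: "p = (x, a)" by (cases p)
  \<comment> \<open>Each point of the lift is treated in its own preferred chart, so the locale is
    interpreted anew for every p.\<close>
  interpret density_at X \<A> \<phi> x a
    by unfold_locales (use assms(1,2) p xa in \<open>auto simp: tangent_lift_def\<close>)
  show "contraction b (form_deriv (bundle_chart_at (chart_at \<A>)) (unit_bundle (topspace X) \<phi>) \<omega> p) w =
    contraction b (form_deriv (bundle_chart_at (chart_at \<A>)) (unit_bundle (topspace X) \<phi>) \<omega>' p) w"
    unfolding contraction_def
    using contraction_form_deriv_eq[OF assms(3) _ assms(4,5), of b w] p b w xa by simp
qed

end
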